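(* Let $G$ and $H$ be topological groups, let $M$ be a (locally contractible) topological manifold endowed with an effective continuous left action of $G$, and let $p:P\to M$ be a locally trivial principal $H$-bundle such that the canonical morphism $\mathrm{Aut}_G(P)\to G$ is an epimorphism. Then the classifying class $c_p$ of the gerbe $p_G^{\mathrm{Aut}_G(P)}:F_G^{\mathrm{Aut}_G(P)}\to B_G$ is the obstruction to the existence of a lifting of the action of $G$ to $P$ (i.e. a lifting exists if and only if $c_p$ vanishes). If this classifying cocycle vanishes, then the set of isomorphism classes of the liftings of $G$ to $P$ is in bijection with $H^1(B_G,L_{\mathcal{G}(P)})$.
   Context: Liftings. The action of $G$ on $M$ can be lifted to $P$ if $P$ carries a left action of $G$ with $g.(x.h)=(g.x).h$ and $p(g.x)=g.p(x)$ for all $x\in P$, $g\in G$, $h\in H$; such an action is a lifting. Two liftings are isomorphic if they are intertwined by a gauge transformation of $P$. Groups. A gauge transformation of $P$ is a homeomorphism of $P$ over $\mathrm{id}_M$ commuting with $H$; $\mathcal{G}(P)$ is the group of gauge transformations. $\mathrm{Aut}_G(P)$ is the group of $H$-equivariant automorphisms of $P$ lying over the action on $M$ of an element of $G$; sending an automorphism to this (unique) element gives the morphism $\mathrm{Aut}_G(P)\to G$ with kernel $\mathcal{G}(P)$. Under the hypothesis there is an exact sequence of topological groups $1\to\mathcal{G}(P)\to\mathrm{Aut}_G(P)\to G\to1$. Topos. The category of topological manifolds carries the topology whose coverings are families of local homeomorphisms that are jointly surjective; extensions of topological groups are studied as extensions of groups in the associated topos $C$ of sheaves. Gerbe of an extension.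 For a group object $N$ of $C$, $B_N$ is the topos of left $N$-objects of $C$, $e_{B_N}$ its final object, and $E_N$ is $N$ with $N$ acting by left translations; right translations make $E_N$ an $N$-torsor over $e_{B_N}$. Given an extension $1\to L\to M'\to N\to 1$ of groups of $C$ (regarded in $B_N$ with trivial action), $F_N^{M'}$ is the category whose objects over $V\in B_N$ are the $M'$-torsors $e_V\to V$ in $B_N$ with an identification of the $N$-torsor $e_V/L$ with the pullback $V\times E_N$ of $E_N$; morphisms over $f:V_1\to V_2$ are $M'$-equivariant morphisms over $f$ compatible with these identifications; $p_N^{M'}:F_N^{M'}\to B_N$ sends $e_V$ to $V$. Conjugation induces $\phi:N\to\mathrm{Out}(L)$, and $(L,\phi)$ defines a band (in Giraud's sense) $L_N$ on $B_N$, by which the gerbe is bounded. Here $L=\mathcal{G}(P)$, $M'=\mathrm{Aut}_G(P)$, $N=G$, and the band is denoted $L_{\mathcal{G}(P)}$. When the gerbe has a global object $s$, $H^1(B_G,L_{\mathcal{G}(P)})$ is the set of isomorphism classes of torsors in $B_G$ under the sheaf of automorphisms of $s$. Classifying cocycle of a gerbe $F$. Choose a covering $(U_i)$ of the final object, objects $e_i\in F_{U_i}$, and isomorphisms $h_{ij}$ from the restriction of $e_j$ to that of $e_i$ over $U_i\times U_j$; the classifying cocycle is $c_{ijk}=h_{ki}h_{ij}h_{jk}$ on $U_i\times U_j\times U_k$. Different choices give cohomologous cocycles; the class vanishes if some choice gives all $c_{ijk}=1$.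
   Formalization: A lifting is an action of G on P continuous along every continuous map from a manifold to G (as in the topos C), which is joint continuity when G is a manifold; with joint continuity for arbitrary topological groups G the claim fails. *)

theory Defs
  imports "HOL-Analysis.Analysis" "HOL-Algebra.Group"
begin

section \<open>Topological groups, actions, principal bundles, liftings\<close>

record 'a topgroup = "'a monoid" +
  topo :: "'a topology"

definition topological_group :: "'a topgroup \<Rightarrow> bool" where
  "topological_group G \<longleftrightarrow>
     group G \<and> topspace (topo G) = carrier G \<and>
     continuous_map (prod_topology (topo G) (topo G)) (topo G) (\<lambda>(g, h). g \<otimes>\<^bsub>G\<^esub> h) \<and>
     continuous_map (topo G) (topo G) (\<lambda>g. inv\<^bsub>G\<^esub> g)"

text \<open>The dimension is allowed to depend on the connected component.\<close>

definition topological_manifold :: "'a topology \<Rightarrow> bool" where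
  "topological_manifold X \<longleftrightarrow>
     Hausdorff_space X \<and> second_countable X \<and>
     (\<forall>x\<in>topspace X. \<exists>n U V. openin X U \<and> x \<in> U \<and> openin (Euclidean_space n) V \<and>
        subtopology X U homeomorphic_space subtopology (Euclidean_space n) V)"

definition locally_contractible_space :: "'a topology \<Rightarrow> bool" where
  "locally_contractible_space X \<longleftrightarrow>
     neighbourhood_base_of (\<lambda>S. contractible_space (subtopology X S)) X"

definition left_action :: "('g, 'z) monoid_scheme \<Rightarrow> 'x set \<Rightarrow> ('g \<Rightarrow> 'x \<Rightarrow> 'x) \<Rightarrow> bool" where
  "left_action G X act \<longleftrightarrow>
     (\<forall>g\<in>carrier G. \<forall>x\<in>X. act g x \<in> X) \<and>
     (\<forall>x\<in>X. act \<one>\<^bsub>G\<^esub> x = x) \<and>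
     (\<forall>g\<in>carrier G. \<forall>h\<in>carrier G. \<forall>x\<in>X. act (g \<otimes>\<^bsub>G\<^esub> h) x = act g (act h x))"

definition continuous_left_action :: "'g topgroup \<Rightarrow> 'x topology \<Rightarrow> ('g \<Rightarrow> 'x \<Rightarrow> 'x) \<Rightarrow> bool" where
  "continuous_left_action G X act \<longleftrightarrow>
     left_action G (topspace X) act \<and>
     continuous_map (prod_topology (topo G) X) X (\<lambda>(g, x). act g x)"

definition effective_action :: "('g, 'z) monoid_scheme \<Rightarrow> 'x set \<Rightarrow> ('g \<Rightarrow> 'x \<Rightarrow> 'x) \<Rightarrow> bool" where
  "effective_action G X act \<longleftrightarrow>
     (\<forall>g\<in>carrier G. (\<forall>x\<in>X. act g x = x) \<longrightarrow> g = \<one>\<^bsub>G\<^esub>)"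

record ('h, 'm, 'p) fibre_bundle =
  Total :: "'p topology"
  Basis :: "'m topology"
  proj :: "'p \<Rightarrow> 'm"
  ract :: "'p \<Rightarrow> 'h \<Rightarrow> 'p"

definition principal_bundle :: "'h topgroup \<Rightarrow> ('h, 'm, 'p) fibre_bundle \<Rightarrow> bool" where
  "principal_bundle H P \<longleftrightarrow>
     continuous_map (Total P) (Basis P) (proj P) \<and>
     continuous_map (prod_topology (Total P) (topo H)) (Total P) (\<lambda>(x, h). ract P x h) \<and>
     (\<forall>x\<in>topspace (Total P). ract P x \<one>\<^bsub>H\<^esub> = x) \<and>
     (\<forall>x\<in>topspace (Total P). \<forall>h\<in>carrier H. \<forall>k\<in>carrier H.
        ract P x (h \<otimes>\<^bsub>H\<^esub> k) = ract P (ract P x h) k) \<and>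
     (\<forall>y\<in>topspace (Basis P). \<exists>U t. openin (Basis P) U \<and> y \<in> U \<and>
        homeomorphic_map (prod_topology (subtopology (Basis P) U) (topo H))
          (subtopology (Total P) {x \<in> topspace (Total P). proj P x \<in> U}) t \<and>
        (\<forall>u\<in>U. \<forall>h\<in>carrier H. proj P (t (u, h)) = u \<and>
           (\<forall>k\<in>carrier H. t (u, h \<otimes>\<^bsub>H\<^esub> k) = ract P (t (u, h)) k)))"

text \<open>
  The H-equivariant automorphisms of P, as maps that are extensional on the total space.
\<close>

definition bundle_automorphisms :: "'h topgroup \<Rightarrow> ('h, 'm, 'p) fibre_bundle \<Rightarrow> ('p \<Rightarrow> 'p) set" where
  "bundle_automorphisms H P =
     {a \<in> extensional (topspace (Total P)).
        homeomorphic_map (Total P) (Total P) a \<and>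
        (\<forall>x\<in>topspace (Total P). \<forall>h\<in>carrier H. a (ract P x h) = ract P (a x) h)}"

definition lies_over :: "('h, 'm, 'p) fibre_bundle \<Rightarrow> ('m \<Rightarrow> 'm) \<Rightarrow> ('p \<Rightarrow> 'p) \<Rightarrow> bool" where
  "lies_over P b a \<longleftrightarrow> (\<forall>x\<in>topspace (Total P). proj P (a x) = b (proj P x))"

definition gauge_transformations :: "'h topgroup \<Rightarrow> ('h, 'm, 'p) fibre_bundle \<Rightarrow> ('p \<Rightarrow> 'p) set" where
  "gauge_transformations H P = {a \<in> bundle_automorphisms H P. lies_over P (\<lambda>y. y) a}"

definition Aut_G :: "'g topgroup \<Rightarrow> 'h topgroup \<Rightarrow> ('h, 'm, 'p) fibre_bundle \<Rightarrow> ('g \<Rightarrow> 'm \<Rightarrow> 'm)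
    \<Rightarrow> ('p \<Rightarrow> 'p) set" where
  "Aut_G G H P act = {a \<in> bundle_automorphisms H P. \<exists>g\<in>carrier G. lies_over P (act g) a}"

text \<open>The element of G is unique because the action is effective and the projection is onto.\<close>

definition Aut_G_to_G :: "'g topgroup \<Rightarrow> ('h, 'm, 'p) fibre_bundle \<Rightarrow> ('g \<Rightarrow> 'm \<Rightarrow> 'm)
    \<Rightarrow> ('p \<Rightarrow> 'p) \<Rightarrow> 'g" where
  "Aut_G_to_G G P act a = (THE g. g \<in> carrier G \<and> lies_over P (act g) a)"


section \<open>The site of topological manifolds and its topos\<close>

text \<open>
  A topological manifold (second countable, Hausdorff) embeds in a space of finite sequences of
  reals, so up to homeomorphism every manifold is a topology on a set of sequences. The type below
  thus carries a small category equivalent to that of all topological manifolds. Arrows are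
  extensional so that hom-sets contain each continuous map once.
\<close>

type_synonym space = "(nat \<Rightarrow> real) topology"
type_synonym smap = "(nat \<Rightarrow> real) \<Rightarrow> (nat \<Rightarrow> real)"

definition man_hom :: "space \<Rightarrow> space \<Rightarrow> smap set" where
  "man_hom K N = {f \<in> extensional (topspace K). continuous_map K N f}"

definition local_homeomorphism :: "space \<Rightarrow> space \<Rightarrow> smap \<Rightarrow> bool" where
  "local_homeomorphism K N f \<longleftrightarrow>
     (\<forall>x\<in>topspace K. \<exists>U. openin K U \<and> x \<in> U \<and> openin N (f ` U) \<and>
        homeomorphic_map (subtopology K U) (subtopology N (f ` U)) f)"

definition man_covering :: "(space \<times> smap) set \<Rightarrow> space \<Rightarrow> bool" where
  "man_covering R N \<longleftrightarrow>
     (\<forall>(K, f)\<in>R. topological_manifold K \<and> f \<in> man_hom K N \<and> local_homeomorphism K N f) \<and>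
     (\<Union>(K, f)\<in>R. f ` topspace K) = topspace N"

text \<open>
  \<open>Sec X N\<close> is the set of sections of X over N, and \<open>Res X K N f\<close> is the restriction along
  an arrow f from K to N. Values outside the manifolds, the arrows and the sets of sections are
  irrelevant; in particular morphisms of sheaves are only meaningful on sections.
\<close>

record 'v sheaf =
  Sec :: "space \<Rightarrow> 'v set"
  Res :: "space \<Rightarrow> space \<Rightarrow> smap \<Rightarrow> 'v \<Rightarrow> 'v"

definition is_presheaf :: "('v, 'z) sheaf_scheme \<Rightarrow> bool" where
  "is_presheaf X \<longleftrightarrow>
     (\<forall>K N f. topological_manifold K \<and> topological_manifold N \<and> f \<in> man_hom K N \<longrightarrow>
        Res X K N f \<in> Sec X N \<rightarrow> Sec X K) \<and>
     (\<forall>N. topological_manifold N \<longrightarrow>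
        (\<forall>x\<in>Sec X N. Res X N N (\<lambda>n\<in>topspace N. n) x = x)) \<and>
     (\<forall>J K N f g. topological_manifold J \<and> topological_manifold K \<and> topological_manifold N \<and>
        g \<in> man_hom J K \<and> f \<in> man_hom K N \<longrightarrow>
        (\<forall>x\<in>Sec X N. Res X J N (compose (topspace J) f g) x = Res X J K g (Res X K N f x)))"

definition is_sheaf :: "('v, 'z) sheaf_scheme \<Rightarrow> bool" where
  "is_sheaf X \<longleftrightarrow> is_presheaf X \<and>
     (\<forall>N R s. topological_manifold N \<and> man_covering R N \<and>
        (\<forall>(K, f)\<in>R. s (K, f) \<in> Sec X K) \<and>
        (\<forall>(K1, f1)\<in>R. \<forall>(K2, f2)\<in>R. \<forall>J a b.
           topological_manifold J \<and> a \<in> man_hom J K1 \<and> b \<in> man_hom J K2 \<and>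
           compose (topspace J) f1 a = compose (topspace J) f2 b \<longrightarrow>
           Res X J K1 a (s (K1, f1)) = Res X J K2 b (s (K2, f2)))
        \<longrightarrow> (\<exists>!x. x \<in> Sec X N \<and> (\<forall>(K, f)\<in>R. Res X K N f x = s (K, f))))"

definition sheaf_mor :: "('v, 'y) sheaf_scheme \<Rightarrow> ('w, 'z) sheaf_scheme
    \<Rightarrow> (space \<Rightarrow> 'v \<Rightarrow> 'w) \<Rightarrow> bool" where
  "sheaf_mor X Y u \<longleftrightarrow>
     (\<forall>N. topological_manifold N \<longrightarrow> u N \<in> Sec X N \<rightarrow> Sec Y N) \<and>
     (\<forall>K N f. topological_manifold K \<and> topological_manifold N \<and> f \<in> man_hom K N \<longrightarrow>
        (\<forall>x\<in>Sec X N. u K (Res X K N f x) = Res Y K N f (u N x)))"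

definition sheaf_epi :: "('v, 'y) sheaf_scheme \<Rightarrow> ('w, 'z) sheaf_scheme
    \<Rightarrow> (space \<Rightarrow> 'v \<Rightarrow> 'w) \<Rightarrow> bool" where
  "sheaf_epi X Y u \<longleftrightarrow> sheaf_mor X Y u \<and>
     (\<forall>N. topological_manifold N \<longrightarrow> (\<forall>y\<in>Sec Y N. \<exists>R. man_covering R N \<and>
        (\<forall>(K, f)\<in>R. \<exists>x\<in>Sec X K. u K x = Res Y K N f y)))"

record 'v group_sheaf = "'v sheaf" +
  Mul :: "space \<Rightarrow> 'v \<Rightarrow> 'v \<Rightarrow> 'v"
  One :: "space \<Rightarrow> 'v"

definition sec_group :: "('v, 'z) group_sheaf_scheme \<Rightarrow> space \<Rightarrow> 'v monoid" where
  "sec_group A K = \<lparr>carrier = Sec A K, mult = Mul A K, one = One A K\<rparr>"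

definition is_group_sheaf :: "('v, 'z) group_sheaf_scheme \<Rightarrow> bool" where
  "is_group_sheaf A \<longleftrightarrow> is_sheaf A \<and>
     (\<forall>K. topological_manifold K \<longrightarrow> group (sec_group A K)) \<and>
     (\<forall>K N f. topological_manifold K \<and> topological_manifold N \<and> f \<in> man_hom K N \<longrightarrow>
        Res A K N f \<in> hom (sec_group A N) (sec_group A K))"


section \<open>The groups of the topos attached to G, to the bundle, and to the action\<close>

definition topgroup_sheaf :: "'g topgroup \<Rightarrow> ((nat \<Rightarrow> real) \<Rightarrow> 'g) group_sheaf" where
  "topgroup_sheaf G =
     \<lparr>Sec = (\<lambda>N. {g \<in> extensional (topspace N). continuous_map N (topo G) g}),
      Res = (\<lambda>K N f g. compose (topspace K) g f),
      Mul = (\<lambda>N g h. \<lambda>n\<in>topspace N. g n \<otimes>\<^bsub>G\<^esub> h n),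
      One = (\<lambda>N. \<lambda>n\<in>topspace N. \<one>\<^bsub>G\<^esub>)\<rparr>"

text \<open>
  A section over N of the automorphism group of P is a continuous family of automorphisms
  parametrised by N, i.e. an automorphism of the pulled back bundle on the product of N and M that
  lies over a continuous map from N to G. No topology has to be chosen on a set of homeomorphisms.
\<close>

definition continuous_family :: "('h, 'm, 'p) fibre_bundle \<Rightarrow> space \<Rightarrow> ((nat \<Rightarrow> real) \<Rightarrow> 'p \<Rightarrow> 'p) \<Rightarrow> bool" where
  "continuous_family P N a \<longleftrightarrow>
     homeomorphic_map (prod_topology N (Total P)) (prod_topology N (Total P)) (\<lambda>(n, x). (n, a n x))"

definition Aut_sheaf :: "'g topgroup \<Rightarrow> 'h topgroup \<Rightarrow> ('h, 'm, 'p) fibre_bundle \<Rightarrow> ('g \<Rightarrow> 'm \<Rightarrow> 'm)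
    \<Rightarrow> ((nat \<Rightarrow> real) \<Rightarrow> 'p \<Rightarrow> 'p) group_sheaf" where
  "Aut_sheaf G H P act =
     \<lparr>Sec = (\<lambda>N. {a \<in> topspace N \<rightarrow>\<^sub>E Aut_G G H P act. continuous_family P N a \<and>
                    continuous_map N (topo G) (\<lambda>n. Aut_G_to_G G P act (a n))}),
      Res = (\<lambda>K N f a. compose (topspace K) a f),
      Mul = (\<lambda>N a b. \<lambda>n\<in>topspace N. compose (topspace (Total P)) (a n) (b n)),
      One = (\<lambda>N. \<lambda>n\<in>topspace N. \<lambda>x\<in>topspace (Total P). x)\<rparr>"

definition gauge_sheaf :: "'h topgroup \<Rightarrow> ('h, 'm, 'p) fibre_bundle
    \<Rightarrow> ((nat \<Rightarrow> real) \<Rightarrow> 'p \<Rightarrow> 'p) group_sheaf" where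
  "gauge_sheaf H P =
     \<lparr>Sec = (\<lambda>N. {a \<in> topspace N \<rightarrow>\<^sub>E gauge_transformations H P. continuous_family P N a}),
      Res = (\<lambda>K N f a. compose (topspace K) a f),
      Mul = (\<lambda>N a b. \<lambda>n\<in>topspace N. compose (topspace (Total P)) (a n) (b n)),
      One = (\<lambda>N. \<lambda>n\<in>topspace N. \<lambda>x\<in>topspace (Total P). x)\<rparr>"

definition Aut_sheaf_to_G :: "'g topgroup \<Rightarrow> ('h, 'm, 'p) fibre_bundle \<Rightarrow> ('g \<Rightarrow> 'm \<Rightarrow> 'm)
    \<Rightarrow> space \<Rightarrow> ((nat \<Rightarrow> real) \<Rightarrow> 'p \<Rightarrow> 'p) \<Rightarrow> ((nat \<Rightarrow> real) \<Rightarrow> 'g)" where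
  "Aut_sheaf_to_G G P act N a = (\<lambda>n\<in>topspace N. Aut_G_to_G G P act (a n))"


section \<open>Liftings\<close>

text \<open>
  Topological groups enter through the sheaves they represent on manifolds, and an action of G on P
  is accordingly required to be continuous along every continuous map from a manifold to G. If G
  is a manifold this is joint continuity, see \<open>lifting_iff_jointly_continuous\<close> below. For other
  groups joint continuity is invisible to the topos: if G is totally disconnected, every
  continuous map from a manifold to G is locally constant.
\<close>

definition is_lifting :: "'g topgroup \<Rightarrow> 'h topgroup \<Rightarrow> ('h, 'm, 'p) fibre_bundle \<Rightarrow> ('g \<Rightarrow> 'm \<Rightarrow> 'm)
    \<Rightarrow> ('g \<Rightarrow> 'p \<Rightarrow> 'p) \<Rightarrow> bool" where
  "is_lifting G H P act b \<longleftrightarrow>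
     left_action G (topspace (Total P)) b \<and>
     (\<forall>(N :: space) f. topological_manifold N \<and> continuous_map N (topo G) f \<longrightarrow>
        continuous_map (prod_topology N (Total P)) (Total P) (\<lambda>(n, x). b (f n) x)) \<and>
     (\<forall>g\<in>carrier G. \<forall>x\<in>topspace (Total P).
        (\<forall>h\<in>carrier H. b g (ract P x h) = ract P (b g x) h) \<and>
        proj P (b g x) = act g (proj P x))"

lemma topological_manifold_open_Euclidean_space:
  assumes "openin (Euclidean_space n) V"
  shows "topological_manifold (subtopology (Euclidean_space n) V)"
proof -
  have "second_countable (euclidean :: (nat \<Rightarrow> real) topology)"
  proof -
    obtain B :: "(nat \<Rightarrow> real) set set" where "countable B" "topological_basis B"
      using ex_countable_basis by blast
    then show ?thesis
      unfolding second_countable_def topological_basis_def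
      by (metis open_openin topological_basisE topological_basis_def)
  qed
  then have "second_countable (Euclidean_space n)"
    by (simp add: Euclidean_space_def euclidean_product_topology second_countable_subtopology)
  moreover have "\<exists>m U W. openin (subtopology (Euclidean_space n) V) U \<and> x \<in> U \<and>
      openin (Euclidean_space m) W \<and>
      subtopology (subtopology (Euclidean_space n) V) U homeomorphic_space
      subtopology (Euclidean_space m) W"
    if "x \<in> topspace (subtopology (Euclidean_space n) V)" for x
  proof (intro exI conjI)
    show "openin (subtopology (Euclidean_space n) V) V"
      using assms openin_subtopology_refl openin_subset by blast
    show "x \<in> V" using that by simp
    show "openin (Euclidean_space n) V" by (fact assms)
    show "subtopology (subtopology (Euclidean_space n) V) V homeomorphic_space
          subtopology (Euclidean_space n) V"
      by (simp add: subtopology_subtopology homeomorphic_space_refl)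
  qed
  ultimately show ?thesis
    by (auto simp: topological_manifold_def Hausdorff_Euclidean_space
        intro: Hausdorff_space_subtopology second_countable_subtopology)
qed

lemma lifting_iff_jointly_continuous:
  assumes "topological_group G" and "topological_manifold (topo G)"
  shows "is_lifting G H P act b \<longleftrightarrow>
     continuous_left_action G (Total P) b \<and>
     (\<forall>g\<in>carrier G. \<forall>x\<in>topspace (Total P).
        (\<forall>h\<in>carrier H. b g (ract P x h) = ract P (b g x) h) \<and>
        proj P (b g x) = act g (proj P x))"
proof -
  let ?T = "Total P" and ?G = "topo G"
  have "(\<forall>(N :: space) f. topological_manifold N \<and> continuous_map N ?G f \<longrightarrow>
        continuous_map (prod_topology N ?T) ?T (\<lambda>(n, x). b (f n) x)) \<longleftrightarrow>
      continuous_map (prod_topology ?G ?T) ?T (\<lambda>(g, x). b g x)" (is "?L \<longleftrightarrow> ?R")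
  proof
    assume R: ?R
    show ?L
    proof (intro allI impI, elim conjE)
      fix N :: space and f
      assume "continuous_map N ?G f"
      then have "continuous_map (prod_topology N ?T) (prod_topology ?G ?T) (\<lambda>(n, x). (f n, x))"
        by (auto simp: continuous_map_prod_top)
      from continuous_map_compose[OF this R]
      show "continuous_map (prod_topology N ?T) ?T (\<lambda>(n, x). b (f n) x)"
        by (simp add: o_def case_prod_unfold)
    qed
  next
    assume L: ?L
    have loc: "\<exists>U. openin ?G U \<and> g \<in> U \<and>
        continuous_map (prod_topology (subtopology ?G U) ?T) ?T (\<lambda>(g, x). b g x)"
      if "g \<in> topspace ?G" for g
    proof -
      obtain n U V where U: "openin ?G U" "g \<in> U" and V: "openin (Euclidean_space n) V"
        and "subtopology ?G U homeomorphic_space subtopology (Euclidean_space n) V"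
        using assms(2) \<open>g \<in> topspace ?G\<close> unfolding topological_manifold_def by metis
      then obtain c d where
        "homeomorphic_maps (subtopology ?G U) (subtopology (Euclidean_space n) V) c d"
        unfolding homeomorphic_space_def by blast
      then have c: "continuous_map (subtopology ?G U) (subtopology (Euclidean_space n) V) c"
        and d: "continuous_map (subtopology (Euclidean_space n) V) (subtopology ?G U) d"
        and dc: "\<And>y. y \<in> topspace (subtopology ?G U) \<Longrightarrow> d (c y) = y"
        unfolding homeomorphic_maps_def by auto
      have "continuous_map (subtopology (Euclidean_space n) V) ?G d"
        using d continuous_map_in_subtopology by blast
      with L topological_manifold_open_Euclidean_space[OF V]
      have 1: "continuous_map (prod_topology (subtopology (Euclidean_space n) V) ?T) ?T
          (\<lambda>(v, x). b (d v) x)" by blast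
      have 2: "continuous_map (prod_topology (subtopology ?G U) ?T)
          (prod_topology (subtopology (Euclidean_space n) V) ?T) (\<lambda>(y, x). (c y, x))"
        using c by (auto simp: continuous_map_prod_top)
      have "continuous_map (prod_topology (subtopology ?G U) ?T) ?T (\<lambda>(g, x). b g x)"
        by (rule continuous_map_eq[OF continuous_map_compose[OF 2 1]]) (auto simp: dc)
      with U show ?thesis by blast
    qed
    show ?R
    proof (rule pasting_lemma[where I = "{U. openin ?G U \<and>
        continuous_map (prod_topology (subtopology ?G U) ?T) ?T (\<lambda>(g, x). b g x)}"
        and T = "\<lambda>U. U \<times> topspace ?T" and f = "\<lambda>_ (g, x). b g x"])
      fix U assume "U \<in> {U. openin ?G U \<and>
        continuous_map (prod_topology (subtopology ?G U) ?T) ?T (\<lambda>(g, x). b g x)}"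
      then show "openin (prod_topology ?G ?T) (U \<times> topspace ?T)"
        and "continuous_map (subtopology (prod_topology ?G ?T) (U \<times> topspace ?T)) ?T
          (\<lambda>(g, x). b g x)"
        by (auto simp: openin_prod_Times_iff prod_topology_subtopology(1)
            simp flip: subtopology_Times)
    qed (use loc in auto)
  qed
  then show ?thesis
    unfolding is_lifting_def continuous_left_action_def by blast
qed

definition lifting_iso :: "'g topgroup \<Rightarrow> 'h topgroup \<Rightarrow> ('h, 'm, 'p) fibre_bundle \<Rightarrow> ('g \<Rightarrow> 'm \<Rightarrow> 'm)
    \<Rightarrow> (('g \<Rightarrow> 'p \<Rightarrow> 'p) \<times> ('g \<Rightarrow> 'p \<Rightarrow> 'p)) set" where
  "lifting_iso G H P act =
     {(b, c). is_lifting G H P act b \<and> is_lifting G H P act c \<and>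
        (\<exists>a\<in>gauge_transformations H P. \<forall>g\<in>carrier G. \<forall>x\<in>topspace (Total P).
           a (b g x) = c g (a x))}"

definition lifting_classes :: "'g topgroup \<Rightarrow> 'h topgroup \<Rightarrow> ('h, 'm, 'p) fibre_bundle \<Rightarrow> ('g \<Rightarrow> 'm \<Rightarrow> 'm)
    \<Rightarrow> ('g \<Rightarrow> 'p \<Rightarrow> 'p) set set" where
  "lifting_classes G H P act = {b. is_lifting G H P act b} // lifting_iso G H P act"


section \<open>The topos of left objects of a group of the topos; torsors\<close>

record ('n, 'v) bobj = "'v sheaf" +
  Lact :: "space \<Rightarrow> 'n \<Rightarrow> 'v \<Rightarrow> 'v"

definition is_bobj :: "('n, 'y) group_sheaf_scheme \<Rightarrow> ('n, 'v, 'z) bobj_scheme \<Rightarrow> bool" where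
  "is_bobj N X \<longleftrightarrow> is_sheaf X \<and>
     (\<forall>K. topological_manifold K \<longrightarrow> left_action (sec_group N K) (Sec X K) (Lact X K)) \<and>
     (\<forall>J K f. topological_manifold J \<and> topological_manifold K \<and> f \<in> man_hom J K \<longrightarrow>
        (\<forall>n\<in>Sec N K. \<forall>x\<in>Sec X K.
           Res X J K f (Lact X K n x) = Lact X J (Res N J K f n) (Res X J K f x)))"

definition bobj_mor :: "('n, 'x) group_sheaf_scheme \<Rightarrow> ('n, 'v, 'y) bobj_scheme
    \<Rightarrow> ('n, 'w, 'z) bobj_scheme \<Rightarrow> (space \<Rightarrow> 'v \<Rightarrow> 'w) \<Rightarrow> bool" where
  "bobj_mor N X Y u \<longleftrightarrow> sheaf_mor X Y u \<and>
     (\<forall>K. topological_manifold K \<longrightarrow>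
        (\<forall>n\<in>Sec N K. \<forall>x\<in>Sec X K. u K (Lact X K n x) = Lact Y K n (u K x)))"

definition final_bobj :: "('n, unit) bobj" where
  "final_bobj = \<lparr>Sec = (\<lambda>K. UNIV), Res = (\<lambda>J K f x. x), Lact = (\<lambda>K n x. x)\<rparr>"

definition prod_bobj :: "('n, 'v, 'y) bobj_scheme \<Rightarrow> ('n, 'w, 'z) bobj_scheme
    \<Rightarrow> ('n, 'v \<times> 'w) bobj" where
  "prod_bobj X Y =
     \<lparr>Sec = (\<lambda>K. Sec X K \<times> Sec Y K),
      Res = (\<lambda>J K f (x, y). (Res X J K f x, Res Y J K f y)),
      Lact = (\<lambda>K n (x, y). (Lact X K n x, Lact Y K n y))\<rparr>"

definition translation_bobj :: "'n group_sheaf \<Rightarrow> ('n, 'n) bobj" where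
  "translation_bobj N = \<lparr>Sec = Sec N, Res = Res N, Lact = Mul N\<rparr>"

record ('n, 'e, 'v, 'a) torsor = "('n, 'e) bobj" +
  Proj :: "space \<Rightarrow> 'e \<Rightarrow> 'v"
  Ract :: "space \<Rightarrow> 'e \<Rightarrow> 'a \<Rightarrow> 'e"

text \<open>
  T is a right A-torsor over V in the topos of left N-objects, where A carries the left action
  \<open>\<alpha>\<close> of N.
\<close>

definition is_torsor :: "'n group_sheaf \<Rightarrow> 'a group_sheaf \<Rightarrow> (space \<Rightarrow> 'n \<Rightarrow> 'a \<Rightarrow> 'a)
    \<Rightarrow> ('n, 'v) bobj \<Rightarrow> ('n, 'e, 'v, 'a, 'z) torsor_scheme \<Rightarrow> bool" where
  "is_torsor N A \<alpha> V T \<longleftrightarrow>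
     is_bobj N T \<and> bobj_mor N T V (Proj T) \<and> sheaf_epi T V (Proj T) \<and>
     (\<forall>K. topological_manifold K \<longrightarrow>
        (\<forall>x\<in>Sec T K. Ract T K x (One A K) = x \<and>
           (\<forall>a\<in>Sec A K. Ract T K x a \<in> Sec T K \<and> Proj T K (Ract T K x a) = Proj T K x \<and>
              (\<forall>b\<in>Sec A K. Ract T K x (Mul A K a b) = Ract T K (Ract T K x a) b) \<and>
              (\<forall>n\<in>Sec N K. Lact T K n (Ract T K x a) = Ract T K (Lact T K n x) (\<alpha> K n a)) \<and>
              (\<forall>J f. topological_manifold J \<and> f \<in> man_hom J K \<longrightarrow>
                 Res T J K f (Ract T K x a) = Ract T J (Res T J K f x) (Res A J K f a))) \<and>
           (\<forall>y\<in>Sec T K. Proj T K y = Proj T K x \<longrightarrow> (\<exists>!a. a \<in> Sec A K \<and> y = Ract T K x a))))"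

definition torsor_iso :: "'n group_sheaf \<Rightarrow> 'a group_sheaf \<Rightarrow> ('n, 'e, 'v, 'a, 'y) torsor_scheme
    \<Rightarrow> ('n, 'f, 'v, 'a, 'z) torsor_scheme \<Rightarrow> (space \<Rightarrow> 'e \<Rightarrow> 'f) \<Rightarrow> bool" where
  "torsor_iso N A S T u \<longleftrightarrow> bobj_mor N S T u \<and>
     (\<forall>K. topological_manifold K \<longrightarrow> bij_betw (u K) (Sec S K) (Sec T K) \<and>
        (\<forall>x\<in>Sec S K. Proj T K (u K x) = Proj S K x \<and>
           (\<forall>a\<in>Sec A K. u K (Ract S K x a) = Ract T K (u K x) a)))"


section \<open>The gerbe of an extension\<close>

text \<open>
  The kernel of the extension is given as a subgroup of the middle term.
\<close>

record ('m, 'n) extension =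
  Ker :: "'m group_sheaf"
  Mid :: "'m group_sheaf"
  Quot :: "'n group_sheaf"
  Pr :: "space \<Rightarrow> 'm \<Rightarrow> 'n"

text \<open>
  The identification of the quotient e/L with the product of V and \<open>E_N\<close> is given by its composite
  \<open>Ident\<close> with the quotient map: an equivariant epimorphism from e to the product over V
  whose fibres on sections are the L-orbits, i.e. a quotient of e by L.
\<close>

record ('n, 'e, 'v, 'm) gerbe_obj = "('n, 'e, 'v, 'm) torsor" +
  Ident :: "space \<Rightarrow> 'e \<Rightarrow> 'v \<times> 'n"

definition is_gerbe_obj :: "('m, 'n) extension \<Rightarrow> ('n, 'v) bobj \<Rightarrow> ('n, 'e, 'v, 'm) gerbe_obj \<Rightarrow> bool" where
  "is_gerbe_obj X V E \<longleftrightarrow>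
     is_bobj (Quot X) V \<and> is_torsor (Quot X) (Mid X) (\<lambda>K n m. m) V E \<and>
     bobj_mor (Quot X) E (prod_bobj V (translation_bobj (Quot X))) (Ident E) \<and>
     sheaf_epi E (prod_bobj V (translation_bobj (Quot X))) (Ident E) \<and>
     (\<forall>K. topological_manifold K \<longrightarrow> (\<forall>x\<in>Sec E K.
        fst (Ident E K x) = Proj E K x \<and>
        (\<forall>m\<in>Sec (Mid X) K. snd (Ident E K (Ract E K x m)) =
           Mul (Quot X) K (snd (Ident E K x)) (Pr X K m)) \<and>
        (\<forall>y\<in>Sec E K. Ident E K y = Ident E K x \<longleftrightarrow> (\<exists>l\<in>Sec (Ker X) K. y = Ract E K x l))))"

definition gerbe_mor :: "('m, 'n) extension \<Rightarrow> (space \<Rightarrow> 'v \<Rightarrow> 'w) \<Rightarrow> ('n, 'e, 'v, 'm) gerbe_obj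
    \<Rightarrow> ('n, 'f, 'w, 'm) gerbe_obj \<Rightarrow> (space \<Rightarrow> 'e \<Rightarrow> 'f) \<Rightarrow> bool" where
  "gerbe_mor X f E1 E2 u \<longleftrightarrow> bobj_mor (Quot X) E1 E2 u \<and>
     (\<forall>K. topological_manifold K \<longrightarrow> (\<forall>x\<in>Sec E1 K.
        Proj E2 K (u K x) = f K (Proj E1 K x) \<and>
        Ident E2 K (u K x) = map_prod (f K) id (Ident E1 K x) \<and>
        (\<forall>m\<in>Sec (Mid X) K. u K (Ract E1 K x m) = Ract E2 K (u K x) m)))"

definition gerbe_iso :: "('m, 'n) extension \<Rightarrow> ('n, 'e, 'v, 'm) gerbe_obj
    \<Rightarrow> ('n, 'f, 'v, 'm) gerbe_obj \<Rightarrow> (space \<Rightarrow> 'e \<Rightarrow> 'f) \<Rightarrow> bool" where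
  "gerbe_iso X E1 E2 u \<longleftrightarrow> gerbe_mor X (\<lambda>K v. v) E1 E2 u \<and>
     (\<forall>K. topological_manifold K \<longrightarrow> bij_betw (u K) (Sec E1 K) (Sec E2 K))"

text \<open>Restriction of an object over V along a morphism f from W to V.\<close>

definition gerbe_restrict :: "('n, 'w) bobj \<Rightarrow> (space \<Rightarrow> 'w \<Rightarrow> 'v) \<Rightarrow> ('n, 'e, 'v, 'm) gerbe_obj
    \<Rightarrow> ('n, 'e \<times> 'w, 'w, 'm) gerbe_obj" where
  "gerbe_restrict W f E =
     \<lparr>Sec = (\<lambda>K. {(x, w). x \<in> Sec E K \<and> w \<in> Sec W K \<and> Proj E K x = f K w}),
      Res = (\<lambda>J K g (x, w). (Res E J K g x, Res W J K g w)),
      Lact = (\<lambda>K n (x, w). (Lact E K n x, Lact W K n w)),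
      Proj = (\<lambda>K (x, w). w),
      Ract = (\<lambda>K (x, w) m. (Ract E K x m, w)),
      Ident = (\<lambda>K (x, w). (w, snd (Ident E K x)))\<rparr>"

text \<open>
  If u is a morphism between restrictions to W of two objects, \<open>mor_restrict f u\<close> is its
  restriction along f; the canonical identification of an iterated restriction with the
  restriction along the composite is built in.
\<close>

definition mor_restrict :: "(space \<Rightarrow> 'w' \<Rightarrow> 'w) \<Rightarrow> (space \<Rightarrow> 'e \<times> 'w \<Rightarrow> 'f \<times> 'w)
    \<Rightarrow> space \<Rightarrow> 'e \<times> 'w' \<Rightarrow> 'f \<times> 'w'" where
  "mor_restrict f u = (\<lambda>K (x, w). (fst (u K (x, f K w)), w))"


section \<open>The classifying class\<close>

definition covers_final :: "('m, 'n) extension \<Rightarrow> 'i set \<Rightarrow> ('i \<Rightarrow> ('n, 'u) bobj) \<Rightarrow> bool" where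
  "covers_final X I U \<longleftrightarrow>
     (\<forall>i\<in>I. is_bobj (Quot X) (U i)) \<and>
     (\<forall>N. topological_manifold N \<longrightarrow> (\<exists>R. man_covering R N \<and>
        (\<forall>(K, f)\<in>R. \<exists>i\<in>I. Sec (U i) K \<noteq> {})))"

definition is_gerbe_choice :: "('m, 'n) extension \<Rightarrow> 'i set \<Rightarrow> ('i \<Rightarrow> ('n, 'u) bobj)
    \<Rightarrow> ('i \<Rightarrow> ('n, 'e, 'u, 'm) gerbe_obj)
    \<Rightarrow> ('i \<Rightarrow> 'i \<Rightarrow> space \<Rightarrow> 'e \<times> 'u \<times> 'u \<Rightarrow> 'e \<times> 'u \<times> 'u) \<Rightarrow> bool" where
  "is_gerbe_choice X I U e h \<longleftrightarrow>
     covers_final X I U \<and> (\<forall>i\<in>I. is_gerbe_obj X (U i) (e i)) \<and>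
     (\<forall>i\<in>I. \<forall>j\<in>I. gerbe_iso X
        (gerbe_restrict (prod_bobj (U i) (U j)) (\<lambda>K (a, b). b) (e j))
        (gerbe_restrict (prod_bobj (U i) (U j)) (\<lambda>K (a, b). a) (e i)) (h i j))"

text \<open>
  The family \<open>c\<^sub>i\<^sub>j\<^sub>k = h\<^sub>k\<^sub>i h\<^sub>i\<^sub>j h\<^sub>j\<^sub>k\<close>, an automorphism of the restriction
  of \<open>e\<^sub>k\<close> to the triple product.
\<close>

definition classifying_cocycle :: "('i \<Rightarrow> 'i \<Rightarrow> space \<Rightarrow> 'e \<times> 'u \<times> 'u \<Rightarrow> 'e \<times> 'u \<times> 'u)
    \<Rightarrow> 'i \<Rightarrow> 'i \<Rightarrow> 'i \<Rightarrow> space \<Rightarrow> 'e \<times> 'u \<times> 'u \<times> 'u \<Rightarrow> 'e \<times> 'u \<times> 'u \<times> 'u" where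
  "classifying_cocycle h i j k K =
     mor_restrict (\<lambda>K (a, b, c). (c, a)) (h k i) K \<circ>
     mor_restrict (\<lambda>K (a, b, c). (a, b)) (h i j) K \<circ>
     mor_restrict (\<lambda>K (a, b, c). (b, c)) (h j k) K"

text \<open>
  The type 'v plays the role of a universe: the small sets are the sets of elements of 'v, and the
  sheaves considered take values in 'v. The classifying class of the gerbe is represented by the
  collection of all classifying cocycles, each with the covering and the objects it refers to.
\<close>

type_synonym ('m, 'n, 'v) gerbe_cocycle =
  "'v set \<times> ('v \<Rightarrow> ('n, 'v) bobj) \<times> ('v \<Rightarrow> ('n, 'v, 'v, 'm) gerbe_obj) \<times>
   ('v \<Rightarrow> 'v \<Rightarrow> 'v \<Rightarrow> space \<Rightarrow> 'v \<times> 'v \<times> 'v \<times> 'v \<Rightarrow> 'v \<times> 'v \<times> 'v \<times> 'v)"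

definition classifying_class :: "('m, 'n) extension \<Rightarrow> ('m, 'n, 'v) gerbe_cocycle set" where
  "classifying_class X = {(I, U, e, classifying_cocycle h) | I U e h. is_gerbe_choice X I U e h}"

definition class_vanishes :: "('m, 'n, 'v) gerbe_cocycle set \<Rightarrow> bool" where
  "class_vanishes C \<longleftrightarrow> (\<exists>(I, U, e, c)\<in>C. \<forall>i\<in>I. \<forall>j\<in>I. \<forall>k\<in>I. \<forall>K. topological_manifold K \<longrightarrow>
     (\<forall>z\<in>Sec (gerbe_restrict (prod_bobj (U i) (prod_bobj (U j) (U k))) (\<lambda>K (a, b, c). c) (e k)) K.
        c i j k K z = z))"


section \<open>Automorphisms of a global object, and first cohomology of the band\<close>

type_synonym ('n, 'm, 'v) global_obj = "('n, 'v, unit, 'm) gerbe_obj"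

definition is_global_obj :: "('m, 'n) extension \<Rightarrow> ('n, 'm, 'v) global_obj \<Rightarrow> bool" where
  "is_global_obj X s \<longleftrightarrow> is_gerbe_obj X final_bobj s"

text \<open>
  The sheaf of automorphisms of s as a group of the topos of left N-objects. Its sections over K
  are the automorphisms of the restriction of s to K, i.e. compatible families of bijections of
  the sections of s over all manifolds J above K, and N acts by conjugation; morphisms from V to
  this object correspond to automorphisms, in the fibre over V, of the restriction of s to V.
\<close>

definition arrows_to :: "space \<Rightarrow> (space \<times> smap) set" where
  "arrows_to K = {(J, f). topological_manifold J \<and> f \<in> man_hom J K}"

definition obj_Aut_sheaf :: "('m, 'n) extension \<Rightarrow> ('n, 'm, 'v) global_obj
    \<Rightarrow> (space \<times> smap \<Rightarrow> 'v \<Rightarrow> 'v) group_sheaf" where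
  "obj_Aut_sheaf X s =
     \<lparr>Sec = (\<lambda>K. {u \<in> extensional (arrows_to K).
        \<forall>(J, f)\<in>arrows_to K. u (J, f) \<in> extensional (Sec s J) \<and>
          bij_betw (u (J, f)) (Sec s J) (Sec s J) \<and>
          (\<forall>x\<in>Sec s J. Ident s J (u (J, f) x) = Ident s J x \<and>
             (\<forall>m\<in>Sec (Mid X) J. u (J, f) (Ract s J x m) = Ract s J (u (J, f) x) m) \<and>
             (\<forall>(J', g)\<in>arrows_to J.
                Res s J' J g (u (J, f) x) = u (J', compose (topspace J') f g) (Res s J' J g x)))}),
      Res = (\<lambda>J K f u. \<lambda>(J', g)\<in>arrows_to J. u (J', compose (topspace J') f g)),
      Mul = (\<lambda>K u v. \<lambda>(J, f)\<in>arrows_to K. compose (Sec s J) (u (J, f)) (v (J, f))),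
      One = (\<lambda>K. \<lambda>(J, f)\<in>arrows_to K. \<lambda>x\<in>Sec s J. x)\<rparr>"

definition obj_Aut_conj :: "('m, 'n) extension \<Rightarrow> ('n, 'm, 'v) global_obj
    \<Rightarrow> space \<Rightarrow> 'n \<Rightarrow> (space \<times> smap \<Rightarrow> 'v \<Rightarrow> 'v) \<Rightarrow> (space \<times> smap \<Rightarrow> 'v \<Rightarrow> 'v)" where
  "obj_Aut_conj X s K n u = (\<lambda>(J, f)\<in>arrows_to K. \<lambda>x\<in>Sec s J.
     (let n' = Res (Quot X) J K f n in
      Lact s J n' (u (J, f) (Lact s J (inv\<^bsub>sec_group (Quot X) J\<^esub> n') x))))"

text \<open>
  The first cohomology set of the band of the gerbe is by definition the set of isomorphism classes
  of torsors under the automorphism sheaf of a global object s.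
\<close>

type_synonym ('m, 'n, 'v) obj_Aut_torsor = "('n, 'v, unit, space \<times> smap \<Rightarrow> 'v \<Rightarrow> 'v) torsor"

definition H1_torsors :: "('m, 'n) extension \<Rightarrow> ('n, 'm, 'v) global_obj
    \<Rightarrow> ('m, 'n, 'v) obj_Aut_torsor set" where
  "H1_torsors X s = {T. is_torsor (Quot X) (obj_Aut_sheaf X s) (obj_Aut_conj X s) final_bobj T}"

definition H1 :: "('m, 'n) extension \<Rightarrow> ('n, 'm, 'v) global_obj
    \<Rightarrow> ('m, 'n, 'v) obj_Aut_torsor set set" where
  "H1 X s = H1_torsors X s //
     {(S, T). S \<in> H1_torsors X s \<and> T \<in> H1_torsors X s \<and>
        (\<exists>u. torsor_iso (Quot X) (obj_Aut_sheaf X s) S T u)}"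


section \<open>The extension attached to the bundle\<close>

definition Aut_extension :: "'g topgroup \<Rightarrow> 'h topgroup \<Rightarrow> ('h, 'm, 'p) fibre_bundle \<Rightarrow> ('g \<Rightarrow> 'm \<Rightarrow> 'm)
    \<Rightarrow> ((nat \<Rightarrow> real) \<Rightarrow> 'p \<Rightarrow> 'p, (nat \<Rightarrow> real) \<Rightarrow> 'g) extension" where
  "Aut_extension G H P act =
     \<lparr>Ker = gauge_sheaf H P, Mid = Aut_sheaf G H P act, Quot = topgroup_sheaf G,
      Pr = Aut_sheaf_to_G G P act\<rparr>"

text \<open>
  'v is a universe large enough to contain the values of the representable sheaves, of G, and of
  the automorphism group of P.
\<close>

definition universe_for :: "'v itself \<Rightarrow> 'g itself \<Rightarrow> 'p itself \<Rightarrow> bool" where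
  "universe_for _ _ _ \<longleftrightarrow>
     (\<exists>\<iota> :: smap \<Rightarrow> 'v. inj \<iota>) \<and>
     (\<exists>\<iota> :: ((nat \<Rightarrow> real) \<Rightarrow> 'g) \<Rightarrow> 'v. inj \<iota>) \<and>
     (\<exists>\<iota> :: ((nat \<Rightarrow> real) \<Rightarrow> 'p \<Rightarrow> 'p) \<Rightarrow> 'v. inj \<iota>)"

end

theory Submission
  imports Defs
begin

text \<open>
  A lifting of the action is the same thing as a splitting \<open>\<sigma>\<close> of the extension of sheaves of groups
  \<open>1 \<rightarrow> L \<rightarrow> M \<rightarrow> N \<rightarrow> 1\<close> attached to the bundle, and two liftings are isomorphic iff their splittings
  are conjugate under a section of L over the point. The key fact about the site is that every
  covering of the one-point manifold has a section, so that epimorphisms of sheaves are onto on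
  sections over the point and torsors become trivial once the action of N is forgotten.

  A splitting turns M into a global object of the gerbe, with N acting on the left through \<open>\<sigma>\<close>.
  Conversely, if the classifying cocycle vanishes for some choice, let u be a section over the point
  of one of the \<open>U\<^sub>i\<close>. The isomorphisms between restrictions of \<open>e\<^sub>i\<close> carry the fibre over nu back
  to the fibre over u, which gives an action of N on the latter, and a base point \<open>x\<^sub>0\<close> of this fibre
  is moved according to \<open>n x\<^sub>0 = x\<^sub>0 \<sigma>(n)\<close> for a splitting \<open>\<sigma>\<close>.

  A base point of a global object s yields a splitting \<open>\<sigma>\<^sub>0\<close> and identifies the automorphism sheaf of s
  with L, on which N acts by conjugation through \<open>\<sigma>\<^sub>0\<close>. A point t of a torsor under this sheaf
  satisfies \<open>n t = t a(n)\<close> for a crossed homomorphism a, and \<open>\<sigma>(n) = a(n) \<sigma>\<^sub>0(n)\<close> is the splitting that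
  corresponds to the torsor.
\<close>

section \<open>Sheaves on the site of manifolds\<close>

text \<open>The obstacle in the converse is that a section \<open>u\<close> of \<open>U i\<close>
  over the point need not be fixed by N: the left translation by n leads from the fibre over u to
  the fibre over nu, so the fibre over u has no left action of its own. The isomorphisms over the
  product of \<open>U i\<close> with itself compare the fibres over all pairs of sections, in
  particular over u and nu. Objects are not glued; the argument stays in one fibre, where c_iii = 1
  supplies the multiplicativity of the transported action. Splittings are the pivot because left
  translations by N commute with right translations by M. Relative to a base point, n therefore acts
  as a right multiplication by \<sigma>(n), and \<sigma> is a homomorphism rather than an
  antihomomorphism. Vanishing cocycles, global objects, torsors and liftings are each compared with
  splittings. A lifting can be read off from a splitting because sections of the sheaves attached to
  the bundle are functions, determined by their restrictions to points, and because the continuity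
  demanded of a lifting is tested along maps from manifolds.\<close>

definition point_space :: space where
  "point_space = Euclidean_space 0"

definition to_point :: "space \<Rightarrow> smap" where
  "to_point K = (\<lambda>k\<in>topspace K. \<lambda>_. 0)"

lemma topspace_point_space [simp]: "topspace point_space = {\<lambda>_. 0}"
  by (auto simp: point_space_def topspace_Euclidean_space)

lemma manifold_point_space [simp]: "topological_manifold point_space"
  unfolding point_space_def
  by (metis openin_topspace subtopology_topspace topological_manifold_open_Euclidean_space)

lemma man_hom_image: "f \<in> man_hom K N \<Longrightarrow> k \<in> topspace K \<Longrightarrow> f k \<in> topspace N"
  by (auto simp: man_hom_def continuous_map_def)

lemma man_hom_extensional: "f \<in> man_hom K N \<Longrightarrow> f \<in> extensional (topspace K)"
  by (simp add: man_hom_def)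

lemma man_hom_continuous: "f \<in> man_hom K N \<Longrightarrow> continuous_map K N f"
  by (simp add: man_hom_def)

lemma man_hom_id [simp]: "(\<lambda>n\<in>topspace N. n) \<in> man_hom N N"
  by (auto simp: man_hom_def intro: continuous_map_eq[OF continuous_map_id])

lemma man_hom_compose:
  assumes "g \<in> man_hom J K" and "f \<in> man_hom K N"
  shows "compose (topspace J) f g \<in> man_hom J N"
  using assms
  by (auto simp: man_hom_def compose_def
      intro: continuous_map_eq[OF continuous_map_compose[of J K g N f]])

lemma compose_id_left:
  assumes "f \<in> man_hom K N"
  shows "compose (topspace K) (\<lambda>n\<in>topspace N. n) f = f"
  using man_hom_extensional[OF assms] man_hom_image[OF assms]
  by (auto simp: compose_def fun_eq_iff extensional_def)

lemma to_point_hom [simp]: "to_point K \<in> man_hom K point_space"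
  by (auto simp: man_hom_def to_point_def intro: continuous_map_eq[of _ _ "\<lambda>_ _. 0"])

lemma to_point_compose: "f \<in> man_hom J K \<Longrightarrow> compose (topspace J) (to_point K) f = to_point J"
  by (auto simp: compose_def to_point_def fun_eq_iff dest: man_hom_image)

text \<open>Points of K are arrows from the one-point manifold, so evaluating a function-valued
  section at \<open>k\<close> is a restriction. Pointwise arguments about sheaves use these
  arrows.\<close>

lemma from_point_hom:
  assumes "k \<in> topspace K"
  shows "(\<lambda>_\<in>topspace point_space. k) \<in> man_hom point_space K"
  using assms by (auto simp: man_hom_def simp del: topspace_point_space
      intro: continuous_map_eq[of _ _ "\<lambda>_. k"])

lemma man_covering_id: "topological_manifold N \<Longrightarrow> man_covering {(N, \<lambda>n\<in>topspace N. n)} N"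
proof -
  assume N: "topological_manifold N"
  have "(\<lambda>n\<in>topspace N. n) ` topspace N = topspace N" by simp
  moreover have "homeomorphic_map N N (\<lambda>n\<in>topspace N. n)"
    by (rule homeomorphic_map_eq[OF iffD2[OF homeomorphic_map_id]]) auto
  ultimately have "local_homeomorphism N N (\<lambda>n\<in>topspace N. n)"
    unfolding local_homeomorphism_def by (metis openin_topspace subtopology_topspace)
  with N show ?thesis by (simp add: man_covering_def)
qed

lemma man_covering_hom: "man_covering R N \<Longrightarrow> (K, f) \<in> R \<Longrightarrow> f \<in> man_hom K N"
  and man_covering_manifold: "man_covering R N \<Longrightarrow> (K, f) \<in> R \<Longrightarrow> topological_manifold K"
  by (auto simp: man_covering_def)

lemma man_covering_point:
  assumes "man_covering R N" and "n \<in> topspace N"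
  obtains K f k where "(K, f) \<in> R" "k \<in> topspace K" "f k = n"
proof -
  have "n \<in> (\<Union>(K, f)\<in>R. f ` topspace K)" using assms unfolding man_covering_def by simp
  then show thesis by (auto intro: that)
qed

section \<open>Presheaves, global elements, and coverings of the point\<close>

lemma presheaf_Res_in:
  assumes "is_presheaf X" "topological_manifold K" "topological_manifold N" "f \<in> man_hom K N"
    and "x \<in> Sec X N"
  shows "Res X K N f x \<in> Sec X K"
  using assms unfolding is_presheaf_def by blast

lemma presheaf_Res_id:
  assumes "is_presheaf X" "topological_manifold N" "x \<in> Sec X N"
  shows "Res X N N (\<lambda>n\<in>topspace N. n) x = x"
  using assms unfolding is_presheaf_def by blast

lemma presheaf_Res_Res:
  assumes "is_presheaf X" "topological_manifold J" "topological_manifold K" "topological_manifold N"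
    and "g \<in> man_hom J K" "f \<in> man_hom K N" "x \<in> Sec X N"
  shows "Res X J K g (Res X K N f x) = Res X J N (compose (topspace J) f g) x"
  using assms unfolding is_presheaf_def by metis

text \<open>Sections over the point are global elements of X; this spreads one over all manifolds,
  compatibly with restriction by \<open>Res_const_sec\<close>. The base points of fibres, of global
  objects and of torsors are made this way.\<close>

definition const_sec :: "('v, 'z) sheaf_scheme \<Rightarrow> space \<Rightarrow> 'v \<Rightarrow> 'v" where
  "const_sec X K x = Res X K point_space (to_point K) x"

lemma const_sec_in:
  "is_presheaf X \<Longrightarrow> topological_manifold K \<Longrightarrow> x \<in> Sec X point_space \<Longrightarrow> const_sec X K x \<in> Sec X K"
  by (simp add: const_sec_def presheaf_Res_in)

lemma Res_const_sec:
  assumes "is_presheaf X" "topological_manifold J" "topological_manifold K" "f \<in> man_hom J K"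
    and "x \<in> Sec X point_space"
  shows "Res X J K f (const_sec X K x) = const_sec X J x"
  using assms by (simp add: const_sec_def presheaf_Res_Res to_point_compose)

lemma sheaf_mor_in:
  "sheaf_mor X Y u \<Longrightarrow> topological_manifold N \<Longrightarrow> x \<in> Sec X N \<Longrightarrow> u N x \<in> Sec Y N"
  unfolding sheaf_mor_def by blast

lemma sheaf_mor_Res:
  "sheaf_mor X Y u \<Longrightarrow> topological_manifold K \<Longrightarrow> topological_manifold N \<Longrightarrow> f \<in> man_hom K N \<Longrightarrow>
    x \<in> Sec X N \<Longrightarrow> u K (Res X K N f x) = Res Y K N f (u N x)"
  unfolding sheaf_mor_def by blast

lemma sheaf_mor_const_sec:
  "sheaf_mor X Y u \<Longrightarrow> topological_manifold K \<Longrightarrow> x \<in> Sec X point_space \<Longrightarrow>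
    u K (const_sec X K x) = const_sec Y K (u point_space x)"
  by (simp add: const_sec_def sheaf_mor_Res)

text \<open>A point \<open>k\<close> of a member K of the covering is an arrow whose composite with
  f is the identity of the point, so a local section over K restricts along it to a section over the
  point. \<open>Q\<close> stands for whatever the covering provides locally.\<close>

lemma section_over_point_of_covering:
  assumes "is_presheaf X" and "man_covering R point_space"
    and "\<forall>(K, f)\<in>R. \<exists>x\<in>Sec X K. Q K f x"
  obtains K f x k where "topological_manifold K" "f \<in> man_hom K point_space" "x \<in> Sec X K" "Q K f x"
    "(\<lambda>_\<in>topspace point_space. k) \<in> man_hom point_space K"
    "compose (topspace point_space) f (\<lambda>_\<in>topspace point_space. k) = (\<lambda>n\<in>topspace point_space. n)"
    "Res X point_space K (\<lambda>_\<in>topspace point_space. k) x \<in> Sec X point_space"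
proof -
  obtain K f k where Kf: "(K, f) \<in> R" and k: "k \<in> topspace K" "f k = (\<lambda>_. 0)"
    by (rule man_covering_point[OF assms(2), of "\<lambda>_. 0"]) auto
  obtain x where x: "x \<in> Sec X K" "Q K f x" using assms(3) Kf by blast
  have K: "topological_manifold K" "f \<in> man_hom K point_space"
    using man_covering_manifold[OF assms(2) Kf] man_covering_hom[OF assms(2) Kf] .
  show thesis
    by (rule that[OF K x from_point_hom[OF k(1)]])
      (use k K x in \<open>auto simp: compose_def fun_eq_iff
        intro!: presheaf_Res_in[OF assms(1)] from_point_hom[simplified]\<close>)
qed

text \<open>A covering of the point has a section, given by any point of any of its members.\<close>

lemma sheaf_epi_onto_point:
  assumes "is_presheaf X" "is_presheaf Y" "sheaf_epi X Y u" "y \<in> Sec Y point_space"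
  obtains x where "x \<in> Sec X point_space" "u point_space x = y"
proof -
  have mor: "sheaf_mor X Y u" using assms(3) by (simp add: sheaf_epi_def)
  obtain R where R: "man_covering R point_space"
    "\<forall>(K, f)\<in>R. \<exists>x\<in>Sec X K. u K x = Res Y K point_space f y"
    using assms(3,4) manifold_point_space unfolding sheaf_epi_def by blast
  from section_over_point_of_covering[OF assms(1) R] obtain K f x k where
    K: "topological_manifold K" "f \<in> man_hom K point_space" and x: "x \<in> Sec X K"
      "u K x = Res Y K point_space f y"
    and k: "(\<lambda>_\<in>topspace point_space. k) \<in> man_hom point_space K"
    and fk: "compose (topspace point_space) f (\<lambda>_\<in>topspace point_space. k) =
      (\<lambda>n\<in>topspace point_space. n)"
    and r: "Res X point_space K (\<lambda>_\<in>topspace point_space. k) x \<in> Sec X point_space" .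
  have "u point_space (Res X point_space K (\<lambda>_\<in>topspace point_space. k) x) = y"
    unfolding sheaf_mor_Res[OF mor manifold_point_space K(1) k x(1)] x(2)
      presheaf_Res_Res[OF assms(2) manifold_point_space K(1) manifold_point_space k K(2) assms(4)]
      fk by (rule presheaf_Res_id[OF assms(2) manifold_point_space assms(4)])
  with r show thesis by (rule that)
qed

text \<open>Restricting a local section of some \<open>U i\<close> to a point of its manifold makes
  it global. This is why a single index of the covering is enough later on.\<close>

lemma covers_final_point:
  assumes "covers_final X I U"
  obtains i u where "i \<in> I" "u \<in> Sec (U i) point_space"
proof -
  obtain R where R: "man_covering R point_space" "\<forall>(K, f)\<in>R. \<exists>i\<in>I. Sec (U i) K \<noteq> {}"
    using assms manifold_point_space unfolding covers_final_def by blast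
  obtain K f k where Kf: "(K, f) \<in> R" and k: "k \<in> topspace K"
    by (rule man_covering_point[OF R(1), of "\<lambda>_. 0"]) auto
  obtain i x where i: "i \<in> I" "x \<in> Sec (U i) K" using R(2) Kf by blast
  have "is_presheaf (U i)"
    using assms i(1) by (auto simp: covers_final_def is_bobj_def is_sheaf_def)
  from presheaf_Res_in[OF this manifold_point_space man_covering_manifold[OF R(1) Kf]
      from_point_hom[OF k] i(2)] i(1)
  show thesis by (rule that[rotated])
qed

section \<open>Criteria for being a sheaf\<close>

lemma is_sheafI:
  assumes "is_presheaf X"
    and "\<And>N R s. \<lbrakk>topological_manifold N; man_covering R N; \<forall>(K, f)\<in>R. s (K, f) \<in> Sec X K;
        \<forall>(K1, f1)\<in>R. \<forall>(K2, f2)\<in>R. \<forall>J a b.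
           topological_manifold J \<and> a \<in> man_hom J K1 \<and> b \<in> man_hom J K2 \<and>
           compose (topspace J) f1 a = compose (topspace J) f2 b \<longrightarrow>
           Res X J K1 a (s (K1, f1)) = Res X J K2 b (s (K2, f2))\<rbrakk>
      \<Longrightarrow> \<exists>!x. x \<in> Sec X N \<and> (\<forall>(K, f)\<in>R. Res X K N f x = s (K, f))"
  shows "is_sheaf X"
  unfolding is_sheaf_def
proof (intro conjI allI impI, goal_cases)
  case (2 N R s)
  then show ?case by (elim conjE) (rule assms(2))
qed (rule assms(1))

lemma is_sheaf_glue:
  assumes "is_sheaf X" "topological_manifold N" " man_covering R N" " \<forall>(K, f)\<in>R. s (K, f) \<in> Sec X K"
    and "        \<forall>(K1, f1)\<in>R. \<forall>(K2, f2)\<in>R. \<forall>J a b.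
           topological_manifold J \<and> a \<in> man_hom J K1 \<and> b \<in> man_hom J K2 \<and>
           compose (topspace J) f1 a = compose (topspace J) f2 b \<longrightarrow>
           Res X J K1 a (s (K1, f1)) = Res X J K2 b (s (K2, f2))"
  shows "\<exists>!x. x \<in> Sec X N \<and> (\<forall>(K, f)\<in>R. Res X K N f x = s (K, f))"
  by (rule assms(1)[unfolded is_sheaf_def, THEN conjunct2, rule_format]) (intro conjI assms(2-))

text \<open>Objects of the gerbe and torsors must take values in the universe 'v. This transports
  the sheaf property of the groups M and L along an injection into 'v.\<close>

lemma is_sheaf_inj_image:
  assumes X: "is_sheaf X" and emb: "inj emb"
    and Sec: "\<And>K. Sec Y K = emb ` Sec X K"
    and Res: "\<And>K N f x. Res Y K N f (emb x) = emb (Res X K N f x)"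
  shows "is_sheaf Y"
proof -
  have pX: "is_presheaf X" using X by (simp add: is_sheaf_def)
  have "is_presheaf Y"
    using pX unfolding is_presheaf_def Sec by (auto simp: Res Pi_iff)
  moreover have "\<exists>!y. y \<in> Sec Y N \<and> (\<forall>(K, f)\<in>R. Res Y K N f y = s (K, f))"
    if N: "topological_manifold N" "man_covering R N" and s: "\<forall>(K, f)\<in>R. s (K, f) \<in> Sec Y K"
      and match: "\<forall>(K1, f1)\<in>R. \<forall>(K2, f2)\<in>R. \<forall>J a b.
           topological_manifold J \<and> a \<in> man_hom J K1 \<and> b \<in> man_hom J K2 \<and>
           compose (topspace J) f1 a = compose (topspace J) f2 b \<longrightarrow>
           Res Y J K1 a (s (K1, f1)) = Res Y J K2 b (s (K2, f2))" for N R s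
  proof -
    define s' where "s' = the_inv emb \<circ> s"
    have s': "s (K, f) = emb (s' (K, f))" "s' (K, f) \<in> Sec X K" if "(K, f) \<in> R" for K f
      using s that emb unfolding Sec s'_def by (force simp: the_inv_f_f)+
    have "\<exists>!x. x \<in> Sec X N \<and> (\<forall>(K, f)\<in>R. Res X K N f x = s' (K, f))"
    proof -
      have "\<forall>(K, f)\<in>R. s' (K, f) \<in> Sec X K" using s' by blast
      moreover have "\<forall>(K1, f1)\<in>R. \<forall>(K2, f2)\<in>R. \<forall>J a b.
           topological_manifold J \<and> a \<in> man_hom J K1 \<and> b \<in> man_hom J K2 \<and>
           compose (topspace J) f1 a = compose (topspace J) f2 b \<longrightarrow>
           Res X J K1 a (s' (K1, f1)) = Res X J K2 b (s' (K2, f2))"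
        using match s'(1) emb by (fastforce simp: Res inj_eq)
      ultimately show ?thesis by (rule is_sheaf_glue[OF X N])
    qed
    then obtain x where x: "x \<in> Sec X N" "\<forall>(K, f)\<in>R. Res X K N f x = s' (K, f)"
      and uniq: "\<And>x'. x' \<in> Sec X N \<Longrightarrow> \<forall>(K, f)\<in>R. Res X K N f x' = s' (K, f) \<Longrightarrow> x' = x"
      by blast
    show ?thesis
    proof (rule ex1I[of _ "emb x"])
      show "emb x \<in> Sec Y N \<and> (\<forall>(K, f)\<in>R. Res Y K N f (emb x) = s (K, f))"
        using x s' by (auto simp: Sec Res)
      fix y assume y: "y \<in> Sec Y N \<and> (\<forall>(K, f)\<in>R. Res Y K N f y = s (K, f))"
      then obtain x' where x': "y = emb x'" "x' \<in> Sec X N" by (auto simp: Sec)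
      have "\<forall>(K, f)\<in>R. Res X K N f x' = s' (K, f)"
        using y s'(1) emb by (fastforce simp: x' Res inj_eq)
      from uniq[OF x'(2) this] show "y = emb x" by (simp add: x')
    qed
  qed
  ultimately show ?thesis by (rule is_sheafI)
qed

lemma is_sheaf_singleton:
  assumes "\<And>K. Sec X K = {v}" and "\<And>K N f. Res X K N f v = v"
  shows "is_sheaf X"
  unfolding is_sheaf_def is_presheaf_def assms(1) by (auto simp: assms(2))

text \<open>Gluing along points: two maps from the one-point manifold detect whether a family matches.\<close>

lemma is_sheaf_functions:
  assumes Sec: "\<And>N. Sec X N = {a \<in> topspace N \<rightarrow>\<^sub>E A. Q N a}"
    and Res: "\<And>K N f a. Res X K N f a = compose (topspace K) a f"
    and pull: "\<And>K N f a. \<lbrakk>topological_manifold K; topological_manifold N; f \<in> man_hom K N;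
        a \<in> topspace N \<rightarrow>\<^sub>E A; Q N a\<rbrakk> \<Longrightarrow> Q K (compose (topspace K) a f)"
    and glue: "\<And>N R a. \<lbrakk>topological_manifold N; man_covering R N; a \<in> topspace N \<rightarrow>\<^sub>E A;
        \<And>K f. (K, f) \<in> R \<Longrightarrow> Q K (compose (topspace K) a f)\<rbrakk> \<Longrightarrow> Q N a"
  shows "is_sheaf X"
proof -
  have "is_presheaf X"
    unfolding is_presheaf_def
  proof (intro conjI allI impI ballI, goal_cases)
    case (1 K N f)
    then show ?case
      using pull[of K N f] man_hom_image[of f K N] by (auto simp: Sec Res compose_def PiE_iff)
  next
    case (2 N x)
    then show ?case by (auto simp: Sec Res compose_def fun_eq_iff PiE_iff extensional_def)
  next
    case (3 J K N f g x)
    then show ?case using man_hom_image[of g J K]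
      by (auto simp: Res compose_def fun_eq_iff)
  qed
  moreover have "\<exists>!x. x \<in> Sec X N \<and> (\<forall>(K, f)\<in>R. Res X K N f x = s (K, f))"
    if N: "topological_manifold N" "man_covering R N" and s: "\<forall>(K, f)\<in>R. s (K, f) \<in> Sec X K"
      and match: "\<forall>(K1, f1)\<in>R. \<forall>(K2, f2)\<in>R. \<forall>J a b.
           topological_manifold J \<and> a \<in> man_hom J K1 \<and> b \<in> man_hom J K2 \<and>
           compose (topspace J) f1 a = compose (topspace J) f2 b \<longrightarrow>
           Res X J K1 a (s (K1, f1)) = Res X J K2 b (s (K2, f2))" for N R s
  proof -
    have eq: "s (K1, f1) k1 = s (K2, f2) k2"
      if "(K1, f1) \<in> R" "(K2, f2) \<in> R" "k1 \<in> topspace K1" "k2 \<in> topspace K2" "f1 k1 = f2 k2"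
      for K1 f1 K2 f2 k1 k2
    proof -
      let ?a = "\<lambda>_\<in>topspace point_space. k1" and ?b = "\<lambda>_\<in>topspace point_space. k2"
      have "compose (topspace point_space) f1 ?a = compose (topspace point_space) f2 ?b"
        using that by (auto simp: compose_def fun_eq_iff)
      then have "Res X point_space K1 ?a (s (K1, f1)) = Res X point_space K2 ?b (s (K2, f2))"
        using match that(1,2) from_point_hom[OF that(3)] from_point_hom[OF that(4)]
          manifold_point_space by fast
      from fun_cong[OF this, of "\<lambda>_. 0"] show ?thesis by (simp add: Res compose_def)
    qed
    \<comment> \<open>By \<open>eq\<close> the value at n depends neither on the member of the
      covering nor on the preimage of n, so the glued function is forced; \<open>glue\<close> then
      supplies the condition \<open>Q\<close>.\<close>
    have "\<forall>n\<in>topspace N. \<exists>v. \<forall>(K, f)\<in>R. \<forall>k\<in>topspace K. f k = n \<longrightarrow> v = s (K, f) k"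
    proof
      fix n assume "n \<in> topspace N"
      with N(2) obtain K f k where "(K, f) \<in> R" "k \<in> topspace K" "f k = n"
        by (rule man_covering_point)
      then show "\<exists>v. \<forall>(K, f)\<in>R. \<forall>k\<in>topspace K. f k = n \<longrightarrow> v = s (K, f) k"
        by (intro exI[of _ "s (K, f) k"]) (auto intro!: eq)
    qed
    from bchoice[OF this] obtain x0 where
      x0: "\<forall>n\<in>topspace N. \<forall>(K, f)\<in>R. \<forall>k\<in>topspace K. f k = n \<longrightarrow> x0 n = s (K, f) k" ..
    define x where "x = restrict x0 (topspace N)"
    have res: "compose (topspace K) x f = s (K, f)" if "(K, f) \<in> R" for K f
    proof
      fix k
      have "s (K, f) \<in> extensional (topspace K)" using s that by (auto simp: Sec PiE_iff)
      moreover have "f k \<in> topspace N" if "k \<in> topspace K"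
        using man_hom_image[OF man_covering_hom[OF N(2) \<open>(K, f) \<in> R\<close>] that] .
      moreover have "x0 (f k) = s (K, f) k" if "k \<in> topspace K" "f k \<in> topspace N"
        using x0 that \<open>(K, f) \<in> R\<close> by fast
      ultimately show "compose (topspace K) x f k = s (K, f) k"
        by (auto simp: compose_def x_def extensional_def)
    qed
    have "x n \<in> A" if "n \<in> topspace N" for n
    proof -
      from N(2) that obtain K f k where K: "(K, f) \<in> R" "k \<in> topspace K" "f k = n"
        by (rule man_covering_point)
      from fun_cong[OF res[OF K(1)], of k] K s show ?thesis
        by (auto simp: compose_def Sec)
    qed
    then have xA: "x \<in> topspace N \<rightarrow>\<^sub>E A" by (auto simp: x_def)
    have "Q N x"
      by (rule glue[OF N xA]) (use res s in \<open>auto simp: Sec\<close>)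
    with xA have xS: "x \<in> Sec X N" by (simp add: Sec)
    show ?thesis
    proof (rule ex1I[of _ x])
      show "x \<in> Sec X N \<and> (\<forall>(K, f)\<in>R. Res X K N f x = s (K, f))" using xS res by (auto simp: Res)
      fix y assume y: "y \<in> Sec X N \<and> (\<forall>(K, f)\<in>R. Res X K N f y = s (K, f))"
      show "y = x"
      proof
        fix n show "y n = x n"
        proof (cases "n \<in> topspace N")
          case True
          with N(2) obtain K f k where K: "(K, f) \<in> R" "k \<in> topspace K" "f k = n"
            by (rule man_covering_point)
          have "compose (topspace K) y f = s (K, f)" using y K by (auto simp: Res)
          from fun_cong[OF this, of k] fun_cong[OF res[OF K(1)], of k] K
          show ?thesis by (simp add: compose_def)
        next
          case False
          with y xS show ?thesis by (auto simp: Sec PiE_iff extensional_def)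
        qed
      qed
    qed
  qed
  ultimately show ?thesis by (rule is_sheafI)
qed

section \<open>Continuity is local for coverings by local homeomorphisms\<close>

lemma local_homeomorphism_open_map:
  assumes "local_homeomorphism K N f" and "f \<in> man_hom K N"
  shows "open_map K N f"
  unfolding open_map_def
proof (intro allI impI)
  fix W assume W: "openin K W"
  have "\<exists>V. openin N V \<and> y \<in> V \<and> V \<subseteq> f ` W" if "y \<in> f ` W" for y
  proof -
    from that obtain x where x: "x \<in> W" "y = f x" by blast
    with W have "x \<in> topspace K" using openin_subset by blast
    then obtain U where U: "openin K U" "x \<in> U" "openin N (f ` U)"
      "homeomorphic_map (subtopology K U) (subtopology N (f ` U)) f"
      using assms(1) unfolding local_homeomorphism_def by blast
    have "openin (subtopology K U) (U \<inter> W)"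
      using W by (simp add: openin_subtopology_Int2)
    then have "openin (subtopology N (f ` U)) (f ` (U \<inter> W))"
      using U(4) unfolding homeomorphic_eq_everything_map open_map_def by blast
    then have "openin N (f ` (U \<inter> W))" using U(3) openin_trans_full by blast
    with x U show ?thesis by blast
  qed
  then show "openin N (f ` W)" by (subst openin_subopen) blast
qed

text \<open>Openness of the covering maps is what makes continuity descend. The preimage of W is the
  union of the images of the preimages \<open>B K f\<close> computed on the members, and these
  images are open because an open rectangle U \<times> V in such a preimage goes to the open
  rectangle f(U) \<times> V. The factor X is carried along for families of maps of the total
  space.\<close>

lemma continuous_map_of_covering:
  assumes R: "man_covering R N"
    and cont: "\<And>K f. (K, f) \<in> R \<Longrightarrow> continuous_map (prod_topology K X) Y (\<lambda>(k, x). F (f k) x)"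
  shows "continuous_map (prod_topology N X) Y (\<lambda>(n, x). F n x)"
  unfolding continuous_map_def
proof (intro conjI allI impI)
  show "(\<lambda>(n, x). F n x) \<in> topspace (prod_topology N X) \<rightarrow> topspace Y"
  proof clarify
    fix n x assume "(n, x) \<in> topspace (prod_topology N X)"
    then have n: "n \<in> topspace N" and x: "x \<in> topspace X" by auto
    from R n obtain K f k where K: "(K, f) \<in> R" "k \<in> topspace K" "f k = n"
      by (rule man_covering_point)
    have "(k, x) \<in> topspace (prod_topology K X)" using K x by simp
    from continuous_map_funspace[OF cont[OF K(1)]] this
    have "(\<lambda>(k, x). F (f k) x) (k, x) \<in> topspace Y" by (rule funcset_mem)
    then show "F n x \<in> topspace Y" by (simp add: K(3))
  qed
  fix W assume W: "openin Y W"
  define B :: "space \<Rightarrow> smap \<Rightarrow> ((nat \<Rightarrow> real) \<times> _) set" where "B K f = {z \<in> topspace (prod_topology K X). (\<lambda>(k, x). F (f k) x) z \<in> W}" for K f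
  have "{z \<in> topspace (prod_topology N X). (\<lambda>(n, x). F n x) z \<in> W} =
      (\<Union>(K, f)\<in>R. (\<lambda>(k, x). (f k, x)) ` B K f)" (is "?A = ?B")
  proof
    show "?A \<subseteq> ?B"
    proof
      fix z assume z: "z \<in> ?A"
      obtain n x where zz: "z = (n, x)" by force
      with z have "n \<in> topspace N" by auto
      with R obtain K f k where K: "(K, f) \<in> R" "k \<in> topspace K" "f k = n"
        by (rule man_covering_point)
      have "(k, x) \<in> B K f" using z zz K(2,3) by (simp add: B_def)
      then have "(f k, x) \<in> (\<lambda>(k, x). (f k, x)) ` B K f" by (rule rev_image_eqI) simp
      then have "z \<in> (\<lambda>(k, x). (f k, x)) ` B K f" using K zz by simp
      then show "z \<in> ?B" using K(1) by blast
    qed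
    show "?B \<subseteq> ?A"
    proof
      fix z assume "z \<in> ?B"
      then obtain K f k x where "(K, f) \<in> R" "(k, x) \<in> B K f" "z = (f k, x)" by auto
      moreover from this have "f k \<in> topspace N"
        using man_hom_image[OF man_covering_hom[OF R, of K f], of k] by (simp add: B_def)
      ultimately show "z \<in> ?A" by (simp add: B_def)
    qed
  qed
  moreover have "openin (prod_topology N X) ((\<lambda>(k, x). (f k, x)) ` B K f)" if Kf: "(K, f) \<in> R" for K f
  proof -
    have f: "open_map K N f"
    proof (rule local_homeomorphism_open_map)
      show "local_homeomorphism K N f" using R Kf by (auto simp: man_covering_def)
    qed (rule man_covering_hom[OF R Kf])
    have B: "openin (prod_topology K X) (B K f)"
      unfolding B_def by (rule openin_continuous_map_preimage[OF cont[OF Kf] W])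
    show ?thesis
    proof (subst openin_subopen, clarify)
      fix k x assume "(k, x) \<in> B K f"
      with B have "\<exists>U V. openin K U \<and> openin X V \<and> k \<in> U \<and> x \<in> V \<and> U \<times> V \<subseteq> B K f"
        unfolding openin_prod_topology_alt by simp
      then obtain U V where "openin K U" "openin X V" "k \<in> U" "x \<in> V" "U \<times> V \<subseteq> B K f"
        by blast
      moreover from this have "openin (prod_topology N X) (f ` U \<times> V)"
        using f by (simp add: openin_prod_Times_iff open_map_def)
      ultimately show "\<exists>T. openin (prod_topology N X) T \<and> (f k, x) \<in> T \<and>
          T \<subseteq> (\<lambda>(k, x). (f k, x)) ` B K f"
        by (intro exI[of _ "f ` U \<times> V"]) auto
    qed
  qed
  ultimately show "openin (prod_topology N X) {z \<in> topspace (prod_topology N X). (\<lambda>(n, x). F n x) z \<in> W}"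
    by (simp only:) (auto intro!: openin_Union)
qed

lemma continuous_map_of_covering_simple:
  assumes "man_covering R N" and "\<And>K f. (K, f) \<in> R \<Longrightarrow> continuous_map K Y (\<lambda>k. F (f k))"
  shows "continuous_map N Y F"
proof -
  have "continuous_map (prod_topology N point_space) Y (\<lambda>(n, x). F n)"
  proof (rule continuous_map_of_covering[OF assms(1)])
    fix K f assume "(K, f) \<in> R"
    from continuous_map_compose[OF continuous_map_fst assms(2)[OF this]]
    show "continuous_map (prod_topology K point_space) Y (\<lambda>(k, x). F (f k))"
      by (simp add: o_def case_prod_unfold)
  qed
  moreover have "continuous_map N (prod_topology N point_space) (\<lambda>n. (n, \<lambda>_. 0))"
    by (simp add: continuous_map_pairedI)
  ultimately show ?thesis
    using continuous_map_compose[of N "prod_topology N point_space" "\<lambda>n. (n, \<lambda>_. 0)" Y "\<lambda>(n, x). F n"]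
    by (simp add: o_def)
qed

section \<open>Groups, left objects and torsors of the topos\<close>

lemma is_bobjD:
  assumes "is_bobj N X"
  shows bobj_presheaf: "is_presheaf X"
    and bobj_Lact_in: "\<And>K n x. \<lbrakk>topological_manifold K; n \<in> Sec N K; x \<in> Sec X K\<rbrakk> \<Longrightarrow>
      Lact X K n x \<in> Sec X K"
    and bobj_Lact_Mul: "\<And>K m n x. \<lbrakk>topological_manifold K; m \<in> Sec N K; n \<in> Sec N K; x \<in> Sec X K\<rbrakk> \<Longrightarrow>
      Lact X K (Mul N K m n) x = Lact X K m (Lact X K n x)"
    and bobj_Res_Lact: "\<And>J K f n x. \<lbrakk>topological_manifold J; topological_manifold K; f \<in> man_hom J K;
      n \<in> Sec N K; x \<in> Sec X K\<rbrakk> \<Longrightarrow>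
      Res X J K f (Lact X K n x) = Lact X J (Res N J K f n) (Res X J K f x)"
  using assms by (auto simp: is_bobj_def is_sheaf_def left_action_def sec_group_def)

lemma is_torsorD:
  assumes "is_torsor N A \<alpha> V T"
  shows torsor_bobj: "is_bobj N T" and torsor_bobj_mor: "bobj_mor N T V (Proj T)"
    and torsor_epi: "sheaf_epi T V (Proj T)"
    and torsor_Ract_one: "\<And>K x. \<lbrakk>topological_manifold K; x \<in> Sec T K\<rbrakk> \<Longrightarrow> Ract T K x (One A K) = x"
    and torsor_Ract_in: "\<And>K x a. \<lbrakk>topological_manifold K; x \<in> Sec T K; a \<in> Sec A K\<rbrakk> \<Longrightarrow>
      Ract T K x a \<in> Sec T K"
    and torsor_Proj_Ract: "\<And>K x a. \<lbrakk>topological_manifold K; x \<in> Sec T K; a \<in> Sec A K\<rbrakk> \<Longrightarrow>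
      Proj T K (Ract T K x a) = Proj T K x"
    and torsor_Ract_Mul: "\<And>K x a b. \<lbrakk>topological_manifold K; x \<in> Sec T K; a \<in> Sec A K; b \<in> Sec A K\<rbrakk> \<Longrightarrow>
      Ract T K x (Mul A K a b) = Ract T K (Ract T K x a) b"
    and torsor_Lact_Ract: "\<And>K n x a. \<lbrakk>topological_manifold K; n \<in> Sec N K; x \<in> Sec T K; a \<in> Sec A K\<rbrakk> \<Longrightarrow>
      Lact T K n (Ract T K x a) = Ract T K (Lact T K n x) (\<alpha> K n a)"
    and torsor_Res_Ract: "\<And>J K f x a. \<lbrakk>topological_manifold J; topological_manifold K; f \<in> man_hom J K;
      x \<in> Sec T K; a \<in> Sec A K\<rbrakk> \<Longrightarrow>
      Res T J K f (Ract T K x a) = Ract T J (Res T J K f x) (Res A J K f a)"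
    and torsor_transitive: "\<And>K x y. \<lbrakk>topological_manifold K; x \<in> Sec T K; y \<in> Sec T K;
      Proj T K y = Proj T K x\<rbrakk> \<Longrightarrow> \<exists>!a. a \<in> Sec A K \<and> y = Ract T K x a"
  using assms unfolding is_torsor_def by blast+

lemma is_torsorI:
  assumes "is_bobj N T" "bobj_mor N T V (Proj T)" "sheaf_epi T V (Proj T)"
    and "\<And>K x. \<lbrakk>topological_manifold K; x \<in> Sec T K\<rbrakk> \<Longrightarrow> Ract T K x (One A K) = x"
    and "\<And>K x a. \<lbrakk>topological_manifold K; x \<in> Sec T K; a \<in> Sec A K\<rbrakk> \<Longrightarrow>
      Ract T K x a \<in> Sec T K"
    and "\<And>K x a. \<lbrakk>topological_manifold K; x \<in> Sec T K; a \<in> Sec A K\<rbrakk> \<Longrightarrow>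
      Proj T K (Ract T K x a) = Proj T K x"
    and "\<And>K x a b. \<lbrakk>topological_manifold K; x \<in> Sec T K; a \<in> Sec A K; b \<in> Sec A K\<rbrakk> \<Longrightarrow>
      Ract T K x (Mul A K a b) = Ract T K (Ract T K x a) b"
    and "\<And>K n x a. \<lbrakk>topological_manifold K; n \<in> Sec N K; x \<in> Sec T K; a \<in> Sec A K\<rbrakk> \<Longrightarrow>
      Lact T K n (Ract T K x a) = Ract T K (Lact T K n x) (\<alpha> K n a)"
    and "\<And>J K f x a. \<lbrakk>topological_manifold J; topological_manifold K; f \<in> man_hom J K;
      x \<in> Sec T K; a \<in> Sec A K\<rbrakk> \<Longrightarrow>
      Res T J K f (Ract T K x a) = Ract T J (Res T J K f x) (Res A J K f a)"
    and "\<And>K x y. \<lbrakk>topological_manifold K; x \<in> Sec T K; y \<in> Sec T K;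
      Proj T K y = Proj T K x\<rbrakk> \<Longrightarrow> \<exists>!a. a \<in> Sec A K \<and> y = Ract T K x a"
  shows "is_torsor N A \<alpha> V T"
  unfolding is_torsor_def using assms by simp

lemma is_presheaf_prod_bobj:
  "is_presheaf X \<Longrightarrow> is_presheaf Y \<Longrightarrow> is_presheaf (prod_bobj X Y)"
  unfolding is_presheaf_def prod_bobj_def by (auto simp: Pi_iff)

locale group_sheaf =
  fixes A :: "'v group_sheaf"
  assumes is_group_sheaf: "is_group_sheaf A"
begin

abbreviation Inv :: "space \<Rightarrow> 'v \<Rightarrow> 'v" where
  "Inv K a \<equiv> inv\<^bsub>sec_group A K\<^esub> a"

lemma sheaf: "is_sheaf A" and presheaf: "is_presheaf A"
  using is_group_sheaf by (auto simp: is_group_sheaf_def is_sheaf_def)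

lemma sec_group: "topological_manifold K \<Longrightarrow> group (sec_group A K)"
  using is_group_sheaf by (auto simp: is_group_sheaf_def)

lemma sec_group_simps [simp]: "carrier (sec_group A K) = Sec A K"
  "mult (sec_group A K) = Mul A K" "one (sec_group A K) = One A K"
  by (auto simp: sec_group_def)

context
  fixes K :: space assumes K: "topological_manifold K"
begin

interpretation group "sec_group A K" by (rule sec_group[OF K])

lemma Mul_in [simp]: "a \<in> Sec A K \<Longrightarrow> b \<in> Sec A K \<Longrightarrow> Mul A K a b \<in> Sec A K"
  using m_closed by simp

lemma One_in [simp]: "One A K \<in> Sec A K"
  using one_closed by simp

lemma Inv_in [simp]: "a \<in> Sec A K \<Longrightarrow> Inv K a \<in> Sec A K"
  using inv_closed by simp

lemma Mul_One [simp]: "a \<in> Sec A K \<Longrightarrow> Mul A K a (One A K) = a"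
  using r_one by simp

lemma One_Mul [simp]: "a \<in> Sec A K \<Longrightarrow> Mul A K (One A K) a = a"
  using l_one by simp

lemma Mul_assoc [simp]: "a \<in> Sec A K \<Longrightarrow> b \<in> Sec A K \<Longrightarrow> c \<in> Sec A K \<Longrightarrow>
    Mul A K (Mul A K a b) c = Mul A K a (Mul A K b c)"
  using m_assoc by simp

lemma Mul_Inv [simp]: "a \<in> Sec A K \<Longrightarrow> Mul A K a (Inv K a) = One A K"
  using r_inv by simp

lemma Inv_Mul [simp]: "a \<in> Sec A K \<Longrightarrow> Mul A K (Inv K a) a = One A K"
  using l_inv by simp

lemma Mul_cancel_left [simp]: "a \<in> Sec A K \<Longrightarrow> b \<in> Sec A K \<Longrightarrow> c \<in> Sec A K \<Longrightarrow>
    Mul A K a b = Mul A K a c \<longleftrightarrow> b = c"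
  using Units_l_cancel[of a b c] Units_eq by simp

lemma Mul_cancel_right [simp]: "a \<in> Sec A K \<Longrightarrow> b \<in> Sec A K \<Longrightarrow> c \<in> Sec A K \<Longrightarrow>
    Mul A K b a = Mul A K c a \<longleftrightarrow> b = c"
  using right_cancel by simp

lemma Mul_Inv_left [simp]: "a \<in> Sec A K \<Longrightarrow> b \<in> Sec A K \<Longrightarrow> Mul A K a (Mul A K (Inv K a) b) = b"
  by (simp flip: Mul_assoc)

lemma Inv_Mul_left [simp]: "a \<in> Sec A K \<Longrightarrow> b \<in> Sec A K \<Longrightarrow> Mul A K (Inv K a) (Mul A K a b) = b"
  by (simp flip: Mul_assoc)

lemma Inv_Mul_distrib [simp]: "a \<in> Sec A K \<Longrightarrow> b \<in> Sec A K \<Longrightarrow>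
    Inv K (Mul A K a b) = Mul A K (Inv K b) (Inv K a)"
  using inv_mult_group by simp

lemma Inv_unique: "a \<in> Sec A K \<Longrightarrow> b \<in> Sec A K \<Longrightarrow> Mul A K a b = One A K \<Longrightarrow> Inv K b = a"
  using inv_equality by simp

lemma Inv_One [simp]: "Inv K (One A K) = One A K"
  by (rule Inv_unique) simp_all

end

lemma Res_in [simp]: "topological_manifold J \<Longrightarrow> topological_manifold K \<Longrightarrow> f \<in> man_hom J K \<Longrightarrow>
    a \<in> Sec A K \<Longrightarrow> Res A J K f a \<in> Sec A J"
  by (rule presheaf_Res_in[OF presheaf])

lemma Res_Mul [simp]: "topological_manifold J \<Longrightarrow> topological_manifold K \<Longrightarrow> f \<in> man_hom J K \<Longrightarrow>
    a \<in> Sec A K \<Longrightarrow> b \<in> Sec A K \<Longrightarrow>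
    Res A J K f (Mul A K a b) = Mul A J (Res A J K f a) (Res A J K f b)"
  using is_group_sheaf unfolding is_group_sheaf_def hom_def by simp

text \<open>A homomorphism in the sense of \<open>hom\<close> is only required to be multiplicative;
  the image of the unit is idempotent, hence the unit by cancellation. \<open>pr_One\<close> and
  \<open>splitting_One\<close> argue in the same way.\<close>

lemma Res_One [simp]: "topological_manifold J \<Longrightarrow> topological_manifold K \<Longrightarrow> f \<in> man_hom J K \<Longrightarrow>
    Res A J K f (One A K) = One A J"
  using Mul_cancel_left[of J "Res A J K f (One A K)" "Res A J K f (One A K)" "One A J"]
    Res_Mul[of J K f "One A K" "One A K"] by simp

lemma Res_Inv [simp]:
  assumes "topological_manifold J" "topological_manifold K" "f \<in> man_hom J K" "a \<in> Sec A K"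
  shows "Res A J K f (Inv K a) = Inv J (Res A J K f a)"
  by (rule Inv_unique[symmetric]) (use assms in \<open>simp_all flip: Res_Mul\<close>)

end

section \<open>Splittings of an extension\<close>

text \<open>Isolates what the gerbe arguments use of the bundle: L is, section by section, the
  kernel of M \<rightarrow> N with the restrictions of M. The extension attached to a bundle is an
  instance through the sublocale of \<open>bundle_action\<close>.\<close>

locale group_sheaf_extension =
  fixes X :: "('a, 'n) extension"
  assumes mid_group: "is_group_sheaf (Mid X)" and quot_group: "is_group_sheaf (Quot X)"
    and ker_sheaf: "is_sheaf (Ker X)"
    and ker_Sec: "\<And>K. topological_manifold K \<Longrightarrow>
      Sec (Ker X) K = {m \<in> Sec (Mid X) K. Pr X K m = One (Quot X) K}"
    and ker_Res: "Res (Ker X) = Res (Mid X)"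
    and pr_mor: "sheaf_mor (Mid X) (Quot X) (Pr X)"
    and pr_Mul [simp]: "\<And>K a b. \<lbrakk>topological_manifold K; a \<in> Sec (Mid X) K; b \<in> Sec (Mid X) K\<rbrakk> \<Longrightarrow>
      Pr X K (Mul (Mid X) K a b) = Mul (Quot X) K (Pr X K a) (Pr X K b)"
begin

sublocale mid: group_sheaf "Mid X" by unfold_locales (rule mid_group)
sublocale quot: group_sheaf "Quot X" by unfold_locales (rule quot_group)

lemma pr_in [simp]: "topological_manifold K \<Longrightarrow> a \<in> Sec (Mid X) K \<Longrightarrow> Pr X K a \<in> Sec (Quot X) K"
  by (rule sheaf_mor_in[OF pr_mor])

lemma pr_Res: "topological_manifold J \<Longrightarrow> topological_manifold K \<Longrightarrow> f \<in> man_hom J K \<Longrightarrow>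
    a \<in> Sec (Mid X) K \<Longrightarrow> Pr X J (Res (Mid X) J K f a) = Res (Quot X) J K f (Pr X K a)"
  by (rule sheaf_mor_Res[OF pr_mor])

lemma pr_One [simp]:
  assumes "topological_manifold K"
  shows "Pr X K (One (Mid X) K) = One (Quot X) K"
  using assms quot.Mul_cancel_left[of K "Pr X K (One (Mid X) K)" "Pr X K (One (Mid X) K)" "One (Quot X) K"]
    pr_Mul[of K "One (Mid X) K" "One (Mid X) K"] by simp

lemma pr_Inv [simp]:
  assumes "topological_manifold K" "a \<in> Sec (Mid X) K"
  shows "Pr X K (mid.Inv K a) = quot.Inv K (Pr X K a)"
  by (rule quot.Inv_unique[symmetric]) (use assms in \<open>simp_all flip: pr_Mul\<close>)

definition splitting :: "(space \<Rightarrow> 'n \<Rightarrow> 'a) \<Rightarrow> bool" where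
  "splitting \<sigma> \<longleftrightarrow>
     (\<forall>K. topological_manifold K \<longrightarrow> (\<forall>n\<in>Sec (Quot X) K.
        \<sigma> K n \<in> Sec (Mid X) K \<and> Pr X K (\<sigma> K n) = n \<and>
        (\<forall>n'\<in>Sec (Quot X) K. \<sigma> K (Mul (Quot X) K n n') = Mul (Mid X) K (\<sigma> K n) (\<sigma> K n')))) \<and>
     (\<forall>J K f. topological_manifold J \<and> topological_manifold K \<and> f \<in> man_hom J K \<longrightarrow>
        (\<forall>n\<in>Sec (Quot X) K. \<sigma> J (Res (Quot X) J K f n) = Res (Mid X) J K f (\<sigma> K n)))"

lemma splittingD:
  assumes "splitting \<sigma>"
  shows splitting_in: "\<And>K n. topological_manifold K \<Longrightarrow> n \<in> Sec (Quot X) K \<Longrightarrow> \<sigma> K n \<in> Sec (Mid X) K"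
    and splitting_pr: "\<And>K n. topological_manifold K \<Longrightarrow> n \<in> Sec (Quot X) K \<Longrightarrow> Pr X K (\<sigma> K n) = n"
    and splitting_Mul: "\<And>K n n'. topological_manifold K \<Longrightarrow> n \<in> Sec (Quot X) K \<Longrightarrow>
      n' \<in> Sec (Quot X) K \<Longrightarrow> \<sigma> K (Mul (Quot X) K n n') = Mul (Mid X) K (\<sigma> K n) (\<sigma> K n')"
    and splitting_Res: "\<And>J K f n. topological_manifold J \<Longrightarrow> topological_manifold K \<Longrightarrow>
      f \<in> man_hom J K \<Longrightarrow> n \<in> Sec (Quot X) K \<Longrightarrow>
      \<sigma> J (Res (Quot X) J K f n) = Res (Mid X) J K f (\<sigma> K n)"
  using assms unfolding splitting_def by blast+

lemma splitting_One:
  assumes "splitting \<sigma>" "topological_manifold K"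
  shows "\<sigma> K (One (Quot X) K) = One (Mid X) K"
  using assms mid.Mul_cancel_left[of K "\<sigma> K (One (Quot X) K)" "\<sigma> K (One (Quot X) K)" "One (Mid X) K"]
    splitting_Mul[of \<sigma> K "One (Quot X) K" "One (Quot X) K"]
  by (simp add: splitting_in)

lemma splitting_Inv:
  assumes "splitting \<sigma>" "topological_manifold K" "n \<in> Sec (Quot X) K"
  shows "\<sigma> K (quot.Inv K n) = mid.Inv K (\<sigma> K n)"
  by (rule mid.Inv_unique[symmetric])
    (use assms in \<open>simp_all add: splitting_in splitting_One flip: splitting_Mul[OF assms(1)]\<close>)

text \<open>Written as l \<sigma> = \<tau> l instead of \<tau> = l \<sigma> l^-1, this has the shape
  of the intertwining relation between two liftings. The section l lives over the point and is
  spread over K as a constant one.\<close>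

definition conjugate :: "(space \<Rightarrow> 'n \<Rightarrow> 'a) \<Rightarrow> (space \<Rightarrow> 'n \<Rightarrow> 'a) \<Rightarrow> bool" where
  "conjugate \<sigma> \<tau> \<longleftrightarrow> (\<exists>l\<in>Sec (Ker X) point_space. \<forall>K. topological_manifold K \<longrightarrow>
     (\<forall>n\<in>Sec (Quot X) K. Mul (Mid X) K (const_sec (Mid X) K l) (\<sigma> K n) =
        Mul (Mid X) K (\<tau> K n) (const_sec (Mid X) K l)))"

text \<open>If the quotient acts on the left of a trivial right torsor under the middle term, then
  \<open>n x\<^sub>0 = x\<^sub>0 \<sigma>(n)\<close> defines a splitting.\<close>

lemma splitting_of_action:
  fixes S :: "space \<Rightarrow> 'e set"
  assumes base_in: "\<And>K. topological_manifold K \<Longrightarrow> base K \<in> S K"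
    and base_res: "\<And>J K f. \<lbrakk>topological_manifold J; topological_manifold K; f \<in> man_hom J K\<rbrakk> \<Longrightarrow>
      res J K f (base K) = base J"
    and ra_in: "\<And>K x m. \<lbrakk>topological_manifold K; x \<in> S K; m \<in> Sec (Mid X) K\<rbrakk> \<Longrightarrow> ra K x m \<in> S K"
    and ra_Mul: "\<And>K x m m'. \<lbrakk>topological_manifold K; x \<in> S K; m \<in> Sec (Mid X) K; m' \<in> Sec (Mid X) K\<rbrakk> \<Longrightarrow>
      ra K x (Mul (Mid X) K m m') = ra K (ra K x m) m'"
    and ra_ex1: "\<And>K y. \<lbrakk>topological_manifold K; y \<in> S K\<rbrakk> \<Longrightarrow>
      \<exists>!m. m \<in> Sec (Mid X) K \<and> y = ra K (base K) m"
    and ra_res: "\<And>J K f x m. \<lbrakk>topological_manifold J; topological_manifold K; f \<in> man_hom J K;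
      x \<in> S K; m \<in> Sec (Mid X) K\<rbrakk> \<Longrightarrow> res J K f (ra K x m) = ra J (res J K f x) (Res (Mid X) J K f m)"
    and st_in: "\<And>K n x. \<lbrakk>topological_manifold K; n \<in> Sec (Quot X) K; x \<in> S K\<rbrakk> \<Longrightarrow> st K n x \<in> S K"
    and st_ra: "\<And>K n x m. \<lbrakk>topological_manifold K; n \<in> Sec (Quot X) K; x \<in> S K; m \<in> Sec (Mid X) K\<rbrakk> \<Longrightarrow>
      st K n (ra K x m) = ra K (st K n x) m"
    and st_Mul: "\<And>K n n' x. \<lbrakk>topological_manifold K; n \<in> Sec (Quot X) K; n' \<in> Sec (Quot X) K; x \<in> S K\<rbrakk> \<Longrightarrow>
      st K (Mul (Quot X) K n n') x = st K n (st K n' x)"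
    and st_res: "\<And>J K f n x. \<lbrakk>topological_manifold J; topological_manifold K; f \<in> man_hom J K;
      n \<in> Sec (Quot X) K; x \<in> S K\<rbrakk> \<Longrightarrow>
      res J K f (st K n x) = st J (Res (Quot X) J K f n) (res J K f x)"
    and id_base: "\<And>K. topological_manifold K \<Longrightarrow> idn K (base K) = One (Quot X) K"
    and id_ra: "\<And>K x m. \<lbrakk>topological_manifold K; x \<in> S K; m \<in> Sec (Mid X) K\<rbrakk> \<Longrightarrow>
      idn K (ra K x m) = Mul (Quot X) K (idn K x) (Pr X K m)"
    and id_st: "\<And>K n x. \<lbrakk>topological_manifold K; n \<in> Sec (Quot X) K; x \<in> S K\<rbrakk> \<Longrightarrow>
      idn K (st K n x) = Mul (Quot X) K n (idn K x)"
  obtains \<sigma> where "splitting \<sigma>"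
    "\<And>K n. \<lbrakk>topological_manifold K; n \<in> Sec (Quot X) K\<rbrakk> \<Longrightarrow> st K n (base K) = ra K (base K) (\<sigma> K n)"
proof -
  define \<sigma> where "\<sigma> K n = (THE m. m \<in> Sec (Mid X) K \<and> st K n (base K) = ra K (base K) m)" for K n
  have \<sigma>: "\<sigma> K n \<in> Sec (Mid X) K \<and> st K n (base K) = ra K (base K) (\<sigma> K n)"
    if "topological_manifold K" "n \<in> Sec (Quot X) K" for K n
    unfolding \<sigma>_def by (rule theI'[OF ra_ex1[OF that(1) st_in[OF that base_in[OF that(1)]]]])
  have uniq: "m = m'" if "topological_manifold K" "m \<in> Sec (Mid X) K" "m' \<in> Sec (Mid X) K"
    "ra K (base K) m = ra K (base K) m'" for K m m'
    using ra_ex1[OF that(1) ra_in[OF that(1) base_in[OF that(1)] that(2)]] that by blast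
  have "splitting \<sigma>"
    unfolding splitting_def
  proof (intro conjI allI impI ballI, goal_cases)
    case (1 K n) with \<sigma> show ?case by blast
  next
    case (2 K n)
    \<comment> \<open>The identification of n x0 is computed twice: through the left action it is n,
      through the right action it is the image of \<sigma>(n) in N.\<close>
    have "n = idn K (st K n (base K))" using 2 by (simp add: id_st id_base base_in)
    also have "\<dots> = Pr X K (\<sigma> K n)" using 2 \<sigma>[OF 2] by (simp add: id_ra id_base base_in)
    finally show ?case by simp
  next
    case (3 K n n')
    show ?case
    proof (rule uniq[OF 3(1)])
      \<comment> \<open>As the two actions commute, n (n' x0) = n (x0 \<sigma>(n')) = (n x0)
        \<sigma>(n') = x0 \<sigma>(n) \<sigma>(n'): the factors come out in the original
        order.\<close>
      have "ra K (base K) (\<sigma> K (Mul (Quot X) K n n')) = st K n (st K n' (base K))"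
        using 3 \<sigma>[of K "Mul (Quot X) K n n'"] by (simp add: st_Mul base_in)
      also have "\<dots> = ra K (base K) (Mul (Mid X) K (\<sigma> K n) (\<sigma> K n'))"
        using 3 \<sigma>[of K n] \<sigma>[of K n'] by (simp add: st_ra ra_Mul base_in)
      finally show "ra K (base K) (\<sigma> K (Mul (Quot X) K n n')) =
        ra K (base K) (Mul (Mid X) K (\<sigma> K n) (\<sigma> K n'))" .
    qed (use 3 \<sigma> in auto)
  next
    case (4 J K f n)
    then have JK: "topological_manifold J" "topological_manifold K" "f \<in> man_hom J K" by auto
    show ?case
    proof (rule uniq[OF JK(1)])
      have "ra J (base J) (\<sigma> J (Res (Quot X) J K f n)) = res J K f (st K n (base K))"
        using JK 4(2) \<sigma>[of J "Res (Quot X) J K f n"] by (simp add: st_res base_in base_res)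
      also have "\<dots> = ra J (base J) (Res (Mid X) J K f (\<sigma> K n))"
        using JK 4(2) \<sigma>[of K n] by (simp add: ra_res base_in base_res)
      finally show "ra J (base J) (\<sigma> J (Res (Quot X) J K f n)) = ra J (base J) (Res (Mid X) J K f (\<sigma> K n))" .
    qed (use JK 4(2) \<sigma> in auto)
  qed
  with \<sigma> show thesis by (intro that) auto
qed

section \<open>The object of the gerbe given by a splitting\<close>

definition split_obj :: "('a \<Rightarrow> 'v) \<Rightarrow> 'w \<Rightarrow> (space \<Rightarrow> 'n \<Rightarrow> 'a) \<Rightarrow> ('n, 'v, 'w, 'a) gerbe_obj" where
  "split_obj emb v \<sigma> =
     \<lparr>Sec = (\<lambda>K. emb ` Sec (Mid X) K),
      Res = (\<lambda>J K f x. emb (Res (Mid X) J K f (the_inv emb x))),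
      Lact = (\<lambda>K n x. emb (Mul (Mid X) K (\<sigma> K n) (the_inv emb x))),
      Proj = (\<lambda>K x. v),
      Ract = (\<lambda>K x m. emb (Mul (Mid X) K (the_inv emb x) m)),
      Ident = (\<lambda>K x. (v, Pr X K (the_inv emb x)))\<rparr>"

text \<open>A final object whose element may have any type: the bases in a gerbe cocycle take values
  in 'v, while global objects live over \<open>final_bobj\<close>, which is the case v = ().\<close>

definition one_point_bobj :: "'w \<Rightarrow> ('n, 'w) bobj" where
  "one_point_bobj v = \<lparr>Sec = (\<lambda>K. {v}), Res = (\<lambda>J K f x. x), Lact = (\<lambda>K n x. x)\<rparr>"

lemma one_point_bobj_simps [simp]:
  "Sec (one_point_bobj v) K = {v}" "Res (one_point_bobj v) J K f x = x" "Lact (one_point_bobj v) K n x = x"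
  by (simp_all add: one_point_bobj_def)

lemma final_bobj_eq: "final_bobj = one_point_bobj ()"
  by (simp add: final_bobj_def one_point_bobj_def UNIV_unit)

lemma is_bobj_one_point: "is_bobj (Quot X) (one_point_bobj v)"
  by (auto simp: is_bobj_def left_action_def intro: is_sheaf_singleton)

lemma sheaf_epiI:
  assumes "sheaf_mor S T u" and "is_presheaf T"
    and "\<And>N y. topological_manifold N \<Longrightarrow> y \<in> Sec T N \<Longrightarrow> \<exists>x\<in>Sec S N. u N x = y"
  shows "sheaf_epi S T u"
  unfolding sheaf_epi_def
proof (intro conjI assms(1) allI impI ballI)
  fix N y assume N: "topological_manifold N" "y \<in> Sec T N"
  show "\<exists>R. man_covering R N \<and> (\<forall>(K, f)\<in>R. \<exists>x\<in>Sec S K. u K x = Res T K N f y)"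
    using man_covering_id[OF N(1)] assms(3)[OF N] presheaf_Res_id[OF assms(2) N]
    by (intro exI[of _ "{(N, \<lambda>n\<in>topspace N. n)}"]) auto
qed

text \<open>The map M \<rightarrow> N is onto already on sections, because \<sigma>(n) lies over n,
  and its fibres are the cosets of L. The left action through \<sigma> commutes with right
  multiplication in M by associativity.\<close>

lemma split_obj_gerbe_obj:
  assumes emb: "inj emb" and \<sigma>: "splitting \<sigma>"
  shows "is_gerbe_obj X (one_point_bobj v) (split_obj emb v \<sigma>)"
proof -
  note [simp] = the_inv_f_f[OF emb] inj_eq[OF emb] splittingD[OF \<sigma>] splitting_One[OF \<sigma>]
  let ?E = "split_obj emb v \<sigma>" and ?V = "one_point_bobj v"
  let ?W = "prod_bobj ?V (translation_bobj (Quot X))"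
  have simps [simp]: "Sec ?E K = emb ` Sec (Mid X) K" "Proj ?E K x = v"
    "Res ?E J K f (emb m) = emb (Res (Mid X) J K f m)"
    "Lact ?E K n (emb m) = emb (Mul (Mid X) K (\<sigma> K n) m)"
    "Ract ?E K (emb m) m' = emb (Mul (Mid X) K m m')"
    "Ident ?E K (emb m) = (v, Pr X K m)" for J K f m m' n x
    by (simp_all add: split_obj_def)
  have Wsimps [simp]: "Sec ?W K = {v} \<times> Sec (Quot X) K"
    "Res ?W J K f (v', n) = (v', Res (Quot X) J K f n)"
    "Lact ?W K n (v', n') = (v', Mul (Quot X) K n n')" for J K f n n' v'
    by (simp_all add: prod_bobj_def translation_bobj_def)
  have bE: "is_bobj (Quot X) ?E"
    unfolding is_bobj_def
  proof (intro conjI)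
    show "is_sheaf ?E" by (rule is_sheaf_inj_image[OF mid.sheaf emb]) simp_all
  qed (auto simp: left_action_def)
  have pV: "is_presheaf ?V" by (rule bobj_presheaf[OF is_bobj_one_point])
  have "is_presheaf (translation_bobj (Quot X))"
    using quot.presheaf by (simp add: is_presheaf_def translation_bobj_def)
  then have pW: "is_presheaf ?W" by (rule is_presheaf_prod_bobj[OF pV])
  have mV: "bobj_mor (Quot X) ?E ?V (Proj ?E)"
    by (auto simp: bobj_mor_def sheaf_mor_def)
  have mW: "bobj_mor (Quot X) ?E ?W (Ident ?E)"
    by (auto simp: bobj_mor_def sheaf_mor_def pr_Res)
  have tors: "is_torsor (Quot X) (Mid X) (\<lambda>K n m. m) ?V ?E"
  proof (rule is_torsorI[OF bE mV sheaf_epiI[OF _ pV]])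
    show "sheaf_mor ?E ?V (Proj ?E)" using mV by (simp add: bobj_mor_def)
    fix N y assume "topological_manifold N" "y \<in> Sec ?V N"
    then show "\<exists>x\<in>Sec ?E N. Proj ?E N x = y" by (auto intro: mid.One_in)
  next
    fix K x y assume K: "topological_manifold K" "x \<in> Sec ?E K" "y \<in> Sec ?E K"
    then obtain m m' where "x = emb m" "y = emb m'" "m \<in> Sec (Mid X) K" "m' \<in> Sec (Mid X) K" by auto
    then show "\<exists>!a. a \<in> Sec (Mid X) K \<and> y = Ract ?E K x a"
      using K(1) by (intro ex1I[of _ "Mul (Mid X) K (mid.Inv K m) m'"]) auto
  qed auto
  have "sheaf_epi ?E ?W (Ident ?E)"
  proof (rule sheaf_epiI[OF _ pW])
    show "sheaf_mor ?E ?W (Ident ?E)" using mW by (simp add: bobj_mor_def)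
    fix N y assume "topological_manifold N" "y \<in> Sec ?W N"
    then show "\<exists>x\<in>Sec ?E N. Ident ?E N x = y"
      by (intro bexI[of _ "emb (\<sigma> N (snd y))"]) auto
  qed
  moreover have "Pr X K m' = Pr X K m \<longleftrightarrow> (\<exists>l\<in>Sec (Ker X) K. m' = Mul (Mid X) K m l)"
    if "topological_manifold K" "m \<in> Sec (Mid X) K" "m' \<in> Sec (Mid X) K" for K m m'
  proof
    assume "Pr X K m' = Pr X K m"
    with that show "\<exists>l\<in>Sec (Ker X) K. m' = Mul (Mid X) K m l"
      by (intro bexI[of _ "Mul (Mid X) K (mid.Inv K m) m'"]) (auto simp: ker_Sec)
  qed (use that in \<open>auto simp: ker_Sec\<close>)
  ultimately show ?thesis
    unfolding is_gerbe_obj_def using is_bobj_one_point tors mW by auto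
qed

text \<open>Cover the final object by a single one-point object. The two projections from its square
  agree on sections, so both restrictions of the object are the same record; with identities for the
  comparison maps the cocycle is trivial.\<close>

lemma class_vanishes_if_splitting:
  assumes emb: "inj (emb :: 'a \<Rightarrow> 'v)" and \<sigma>: "splitting \<sigma>"
  shows "class_vanishes (classifying_class X :: ('a, 'n, 'v) gerbe_cocycle set)"
proof -
  define v :: 'v where "v = undefined"
  let ?V = "\<lambda>_. one_point_bobj v" and ?E = "\<lambda>_. split_obj emb v \<sigma>"
  let ?h = "\<lambda>(_ :: 'v) (_ :: 'v) (_ :: space) (z :: 'v \<times> 'v \<times> 'v). z"
  have g: "is_gerbe_obj X (one_point_bobj v) (split_obj emb v \<sigma>)"
    by (rule split_obj_gerbe_obj[OF assms])
  have "is_gerbe_choice X {v} ?V ?E ?h"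
    unfolding is_gerbe_choice_def covers_final_def
  proof (intro conjI ballI allI impI)
    fix N :: space assume "topological_manifold N"
    then show "\<exists>R. man_covering R N \<and> (\<forall>(K, f)\<in>R. \<exists>i\<in>{v}. Sec (?V i) K \<noteq> {})"
      using man_covering_id by fastforce
  next
    fix i j
    have "gerbe_restrict (prod_bobj (?V i) (?V j)) (\<lambda>K (a, b). b) (?E j) =
        gerbe_restrict (prod_bobj (?V i) (?V j)) (\<lambda>K (a, b). a) (?E i)"
      by (auto simp: gerbe_restrict_def prod_bobj_def split_obj_def)
    then show "gerbe_iso X (gerbe_restrict (prod_bobj (?V i) (?V j)) (\<lambda>K (a, b). b) (?E j))
        (gerbe_restrict (prod_bobj (?V i) (?V j)) (\<lambda>K (a, b). a) (?E i)) (?h i j)"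
      by (auto simp: gerbe_iso_def gerbe_mor_def bobj_mor_def sheaf_mor_def bij_betw_def
          gerbe_restrict_def prod_bobj_def)
  qed (simp_all add: g is_bobj_one_point)
  then have "({v}, ?V, ?E, classifying_cocycle ?h) \<in> (classifying_class X :: ('a, 'n, 'v) gerbe_cocycle set)"
    unfolding classifying_class_def by blast
  moreover have "classifying_cocycle ?h i j k K z = z" for i j k K z
    by (cases z) (simp add: classifying_cocycle_def mor_restrict_def)
  ultimately show ?thesis
    unfolding class_vanishes_def by (intro bexI[of _ "({v}, ?V, ?E, classifying_cocycle ?h)"]) auto
qed

end

section \<open>Objects of the gerbe\<close>

context group_sheaf_extension
begin

lemma is_gerbe_objD:
  assumes "is_gerbe_obj X V E"
  shows gerbe_obj_base: "is_bobj (Quot X) V" and gerbe_obj_torsor: "is_torsor (Quot X) (Mid X) (\<lambda>K n m. m) V E"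
    and gerbe_obj_bobj: "is_bobj (Quot X) E"
    and gerbe_obj_Proj_Lact: "\<And>K n x. \<lbrakk>topological_manifold K; n \<in> Sec (Quot X) K; x \<in> Sec E K\<rbrakk> \<Longrightarrow>
      Proj E K (Lact E K n x) = Lact V K n (Proj E K x)"
    and gerbe_obj_Proj_Res: "\<And>J K f x. \<lbrakk>topological_manifold J; topological_manifold K; f \<in> man_hom J K;
      x \<in> Sec E K\<rbrakk> \<Longrightarrow> Proj E J (Res E J K f x) = Res V J K f (Proj E K x)"
    and gerbe_obj_Ident_Lact: "\<And>K n x. \<lbrakk>topological_manifold K; n \<in> Sec (Quot X) K; x \<in> Sec E K\<rbrakk> \<Longrightarrow>
      snd (Ident E K (Lact E K n x)) = Mul (Quot X) K n (snd (Ident E K x))"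
    and gerbe_obj_Ident_Ract: "\<And>K m x. \<lbrakk>topological_manifold K; m \<in> Sec (Mid X) K; x \<in> Sec E K\<rbrakk> \<Longrightarrow>
      snd (Ident E K (Ract E K x m)) = Mul (Quot X) K (snd (Ident E K x)) (Pr X K m)"
    and gerbe_obj_Ident_Res: "\<And>J K f x. \<lbrakk>topological_manifold J; topological_manifold K; f \<in> man_hom J K;
      x \<in> Sec E K\<rbrakk> \<Longrightarrow> snd (Ident E J (Res E J K f x)) = Res (Quot X) J K f (snd (Ident E K x))"
    and gerbe_obj_Ident_fst: "\<And>K x. \<lbrakk>topological_manifold K; x \<in> Sec E K\<rbrakk> \<Longrightarrow>
      fst (Ident E K x) = Proj E K x"
    and gerbe_obj_epi: "sheaf_epi E (prod_bobj V (translation_bobj (Quot X))) (Ident E)"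
proof -
  let ?W = "prod_bobj V (translation_bobj (Quot X))"
  have Wsimps: "Sec ?W K = Sec V K \<times> Sec (Quot X) K"
    "Res ?W J K f z = (Res V J K f (fst z), Res (Quot X) J K f (snd z))"
    "Lact ?W K n z = (Lact V K n (fst z), Mul (Quot X) K n (snd z))" for J K f n z
    by (cases z, simp add: prod_bobj_def translation_bobj_def)+
  show base: "is_bobj (Quot X) V" and tors: "is_torsor (Quot X) (Mid X) (\<lambda>K n m. m) V E"
    and "sheaf_epi E ?W (Ident E)"
    using assms by (simp_all add: is_gerbe_obj_def)
  show "is_bobj (Quot X) E" by (rule torsor_bobj[OF tors])
  have mV: "bobj_mor (Quot X) E V (Proj E)" by (rule torsor_bobj_mor[OF tors])
  have mW: "bobj_mor (Quot X) E ?W (Ident E)" using assms by (simp add: is_gerbe_obj_def)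
  fix J K f x
  assume K: "topological_manifold K" and x: "x \<in> Sec E K"
  show "fst (Ident E K x) = Proj E K x" using assms K x by (simp add: is_gerbe_obj_def)
  show "snd (Ident E K (Ract E K x m)) = Mul (Quot X) K (snd (Ident E K x)) (Pr X K m)"
    if "m \<in> Sec (Mid X) K" for m using assms K x that by (simp add: is_gerbe_obj_def)
  show "Proj E K (Lact E K n x) = Lact V K n (Proj E K x)"
    "snd (Ident E K (Lact E K n x)) = Mul (Quot X) K n (snd (Ident E K x))"
    if "n \<in> Sec (Quot X) K" for n
    using mV mW K x that by (simp_all add: bobj_mor_def Wsimps)
  assume J: "topological_manifold J" "f \<in> man_hom J K"
  show "Proj E J (Res E J K f x) = Res V J K f (Proj E K x)"
    using mV K x J by (simp add: bobj_mor_def sheaf_mor_Res[of E _ _ J K])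
  have "Ident E J (Res E J K f x) = Res ?W J K f (Ident E K x)"
    using mW K x J unfolding bobj_mor_def by (blast intro: sheaf_mor_Res)
  then show "snd (Ident E J (Res E J K f x)) = Res (Quot X) J K f (snd (Ident E K x))"
    by (simp add: Wsimps)
qed

lemma gerbe_morD:
  assumes "gerbe_mor X f E1 E2 u"
  shows gerbe_mor_sheaf_mor: "sheaf_mor E1 E2 u"
    and gerbe_mor_Lact: "\<And>K n x. \<lbrakk>topological_manifold K; n \<in> Sec (Quot X) K; x \<in> Sec E1 K\<rbrakk> \<Longrightarrow>
      u K (Lact E1 K n x) = Lact E2 K n (u K x)"
    and gerbe_mor_Ract: "\<And>K x m. \<lbrakk>topological_manifold K; x \<in> Sec E1 K; m \<in> Sec (Mid X) K\<rbrakk> \<Longrightarrow>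
      u K (Ract E1 K x m) = Ract E2 K (u K x) m"
    and gerbe_mor_Proj: "\<And>K x. \<lbrakk>topological_manifold K; x \<in> Sec E1 K\<rbrakk> \<Longrightarrow>
      Proj E2 K (u K x) = f K (Proj E1 K x)"
    and gerbe_mor_Ident: "\<And>K x. \<lbrakk>topological_manifold K; x \<in> Sec E1 K\<rbrakk> \<Longrightarrow>
      Ident E2 K (u K x) = map_prod (f K) id (Ident E1 K x)"
  using assms by (simp_all add: gerbe_mor_def bobj_mor_def)

text \<open>The identification is an epimorphism onto V \<times> E_N, hence onto over the point, and
  x is a preimage of (v, 1). Normalising by 1 is what makes the splitting obtained from x lie over
  the identity of N.\<close>

lemma gerbe_obj_base_point:
  assumes E: "is_gerbe_obj X V E" and v: "v \<in> Sec V point_space"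
  obtains x where "x \<in> Sec E point_space" "Proj E point_space x = v"
    "snd (Ident E point_space x) = One (Quot X) point_space"
proof -
  let ?W = "prod_bobj V (translation_bobj (Quot X))"
  have "is_presheaf (translation_bobj (Quot X))"
    using quot.presheaf by (simp add: is_presheaf_def translation_bobj_def)
  then have pW: "is_presheaf ?W"
    using bobj_presheaf[OF gerbe_obj_base[OF E]] by (intro is_presheaf_prod_bobj)
  have "(v, One (Quot X) point_space) \<in> Sec ?W point_space"
    using v by (simp add: prod_bobj_def translation_bobj_def)
  from sheaf_epi_onto_point[OF bobj_presheaf[OF gerbe_obj_bobj[OF E]] pW gerbe_obj_epi[OF E] this]
  obtain x where "x \<in> Sec E point_space" "Ident E point_space x = (v, One (Quot X) point_space)" .
  with gerbe_obj_Ident_fst[OF E manifold_point_space this(1)] show thesis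
    by (intro that[of x]) auto
qed

text \<open>The cocycle \<open>h\<^sub>k\<^sub>i h\<^sub>i\<^sub>j h\<^sub>j\<^sub>k = 1\<close> makes \<open>h\<^sub>i\<^sub>j\<close> a descent datum only
  up to the automorphism \<open>d = h\<^sub>i\<^sub>i\<close> of order three, whence the correction by its square.\<close>

lemma splitting_if_descent_datum:
  assumes E: "is_gerbe_obj X V E" and v: "v \<in> Sec V point_space"
  defines "F K b x \<equiv> x \<in> Sec E K \<and> Proj E K x = b"
  assumes H_F: "\<And>K a b x. \<lbrakk>topological_manifold K; a \<in> Sec V K; b \<in> Sec V K; F K b x\<rbrakk> \<Longrightarrow> F K a (H K a b x)"
    and H_Lact: "\<And>K a b x n. \<lbrakk>topological_manifold K; a \<in> Sec V K; b \<in> Sec V K; F K b x; n \<in> Sec (Quot X) K\<rbrakk> \<Longrightarrow>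
      Lact E K n (H K a b x) = H K (Lact V K n a) (Lact V K n b) (Lact E K n x)"
    and H_Ract: "\<And>K a b x m. \<lbrakk>topological_manifold K; a \<in> Sec V K; b \<in> Sec V K; F K b x; m \<in> Sec (Mid X) K\<rbrakk> \<Longrightarrow>
      H K a b (Ract E K x m) = Ract E K (H K a b x) m"
    and H_Res: "\<And>J K f a b x. \<lbrakk>topological_manifold J; topological_manifold K; f \<in> man_hom J K;
      a \<in> Sec V K; b \<in> Sec V K; F K b x\<rbrakk> \<Longrightarrow>
      Res E J K f (H K a b x) = H J (Res V J K f a) (Res V J K f b) (Res E J K f x)"
    and H_Ident: "\<And>K a b x. \<lbrakk>topological_manifold K; a \<in> Sec V K; b \<in> Sec V K; F K b x\<rbrakk> \<Longrightarrow>
      snd (Ident E K (H K a b x)) = snd (Ident E K x)"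
    and H_cocycle: "\<And>K a b c x. \<lbrakk>topological_manifold K; a \<in> Sec V K; b \<in> Sec V K; c \<in> Sec V K; F K c x\<rbrakk> \<Longrightarrow>
      H K c a (H K a b (H K b c x)) = x"
  shows "\<exists>\<sigma>. splitting \<sigma>"
proof -
  note bV = gerbe_obj_base[OF E] and bE = gerbe_obj_bobj[OF E] and tE = gerbe_obj_torsor[OF E]
  note pV = bobj_presheaf[OF bV] and pE = bobj_presheaf[OF bE]
  obtain x where x: "x \<in> Sec E point_space" "Proj E point_space x = v"
    "snd (Ident E point_space x) = One (Quot X) point_space"
    using gerbe_obj_base_point[OF E v] .
  define u where "u K = const_sec V K v" for K
  define x0 where "x0 K = const_sec E K x" for K
  have u_in: "u K \<in> Sec V K" if "topological_manifold K" for K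
    unfolding u_def using pV that v by (rule const_sec_in)
  have u_res: "Res V J K f (u K) = u J"
    if "topological_manifold J" "topological_manifold K" "f \<in> man_hom J K" for J K f
    unfolding u_def using pV that v by (rule Res_const_sec)
  have x0_F: "F K (u K) (x0 K)" if "topological_manifold K" for K
    using that x const_sec_in[OF pE that x(1)] gerbe_obj_Proj_Res[OF E that manifold_point_space to_point_hom x(1)]
    by (simp add: F_def u_def x0_def const_sec_def)
  have Lact_F: "F K (Lact V K n b) (Lact E K n y)"
    if "topological_manifold K" "n \<in> Sec (Quot X) K" "F K b y" for K n b y
    using that by (auto simp: F_def gerbe_obj_Proj_Lact[OF E] bobj_Lact_in[OF bE])
  have Ract_F: "F K b (Ract E K y m)"
    if "topological_manifold K" "m \<in> Sec (Mid X) K" "F K b y" for K m b y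
    using that by (auto simp: F_def torsor_Ract_in[OF tE] torsor_Proj_Ract[OF tE])
  have Res_F: "F J (Res V J K f b) (Res E J K f y)"
    if "topological_manifold J" "topological_manifold K" "f \<in> man_hom J K" "F K b y" for J K f b y
    using that by (auto simp: F_def gerbe_obj_Proj_Res[OF E] presheaf_Res_in[OF pE])
  \<comment> \<open>Write d_b for H b b. The cocycle identity gives H u a H a c = H u c d_c, and d
    commutes with the comparison maps and with translations. Hence H d^-1 composes correctly, and
    d^-1 is d^2 because d^3 = 1. Since d commutes with n, the correction may be made in the fibre
    over u, before n is applied.\<close>
  define st where "st K n y = H K (u K) (Lact V K n (u K))
      (Lact E K n (H K (u K) (u K) (H K (u K) (u K) y)))" for K n y
  have st_F: "F K (u K) (st K n y)"
    if "topological_manifold K" "n \<in> Sec (Quot X) K" "F K (u K) y" for K n y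
    unfolding st_def using that
    by (intro H_F Lact_F u_in bobj_Lact_in[OF bV]) auto
  have st_Mul: "st K (Mul (Quot X) K m n) y = st K m (st K n y)"
    if K: "topological_manifold K" and mn: "m \<in> Sec (Quot X) K" "n \<in> Sec (Quot X) K"
      and y: "F K (u K) y" for K m n y
  proof -
    define U where "U = u K"
    define D where "D a = H K a a" for a
    have U: "U \<in> Sec V K" unfolding U_def by (rule u_in[OF K])
    note H_in = H_F[OF K] and coc = H_cocycle[OF K] and L_in = Lact_F[OF K]
      and V_in = bobj_Lact_in[OF bV K]
    have D_F: "F K a (D a z)" if "a \<in> Sec V K" "F K a z" for a z
      unfolding D_def using that by (intro H_in)
    \<comment> \<open>Both sides become z under H b U, by the cocycle identity with one index
      repeated; the identity for the triple U, b, U shows that H b U is injective on the fibre over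
      U.\<close>
    have D_H: "D U (H K U b z) = H K U b (D b z)" if b: "b \<in> Sec V K" and z: "F K b z" for b z
    proof -
      have "H K b U (D U (H K U b z)) = z" unfolding D_def by (rule coc[OF U U b z])
      moreover have "H K b U (H K U b (D b z)) = z" unfolding D_def by (rule coc[OF U b b z])
      moreover have "w = D U (H K U b (H K b U w))" if "F K U w" for w
        unfolding D_def using coc[OF U b U that] by simp
      moreover have "F K U (D U (H K U b z))" "F K U (H K U b (D b z))"
        using b z U by (auto intro!: D_F H_in)
      ultimately show ?thesis by metis
    qed
    have D3: "D U (D U (D U z)) = z" if "F K U z" for z
      unfolding D_def by (rule coc[OF U U U that])
    have L_D: "Lact E K k (D b z) = D (Lact V K k b) (Lact E K k z)"
      if "k \<in> Sec (Quot X) K" "b \<in> Sec V K" "F K b z" for k b z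
      unfolding D_def using that by (intro H_Lact K)
    have L_L: "Lact V K m (Lact V K n U) = Lact V K (Mul (Quot X) K m n) U"
      "Lact E K m (Lact E K n z) = Lact E K (Mul (Quot X) K m n) z" if "F K b z" for b z
      using bobj_Lact_Mul[OF bV K mn U] bobj_Lact_Mul[OF bE K mn, of z] that by (auto simp: F_def)
    let ?a = "Lact V K m U" and ?b = "Lact V K n U" and ?c = "Lact V K (Mul (Quot X) K m n) U"
    have abc: "?a \<in> Sec V K" "?b \<in> Sec V K" "?c \<in> Sec V K"
      using mn U K by (auto intro!: V_in)
    \<comment> \<open>Again both sides are inverse images of z under the injective map H c U. The
      extra \<open>D ?c\<close> is the defect of multiplicativity that \<open>st\<close>
      corrects.\<close>
    have HH: "H K U ?a (H K ?a ?c z) = H K U ?c (D ?c z)" if z: "F K ?c z" for z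
    proof -
      have "H K ?c U (H K U ?a (H K ?a ?c z)) = z" by (rule coc[OF U abc(1) abc(3) z])
      moreover have "H K ?c U (H K U ?c (D ?c z)) = z" unfolding D_def by (rule coc[OF U abc(3) abc(3) z])
      moreover have "w = D U (H K U ?c (H K ?c U w))" if "F K U w" for w
        unfolding D_def using coc[OF U abc(3) U that] by simp
      moreover have "F K U (H K U ?a (H K ?a ?c z))" "F K U (H K U ?c (D ?c z))"
        using abc z U by (auto intro!: D_F H_in)
      ultimately show ?thesis by metis
    qed
    define w where "w = D U (D U y)"
    have yU: "F K U y" using y by (simp add: U_def)
    have w: "F K U w" unfolding w_def using U yU by (intro D_F)
    have nw: "F K ?b (Lact E K n w)" by (rule L_in[OF mn(2) w])
    \<comment> \<open>The second application of \<open>st\<close> contributes two more factors d.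
      Moved to the right past H and n they meet the first two, and d^4 = d; the missing factor
      returns through \<open>HH\<close>.\<close>
    have "D U (D U (H K U ?b (Lact E K n w))) = H K U ?b (Lact E K n (D U (D U w)))"
      using D_H[OF abc(2) nw] D_H[OF abc(2) D_F[OF abc(2) nw]]
        L_D[OF mn(2) U w] L_D[OF mn(2) U D_F[OF U w]] by simp
    also have "D U (D U w) = D U y" unfolding w_def using D3[OF yU] by simp
    finally have e: "D U (D U (H K U ?b (Lact E K n w))) = H K U ?b (Lact E K n (D U y))" .
    have Dy: "F K U (D U y)" by (rule D_F[OF U yU])
    have "st K m (st K n y) = H K U ?a (Lact E K m (D U (D U (H K U ?b (Lact E K n w)))))"
      unfolding st_def U_def[symmetric] w_def D_def ..
    also have "\<dots> = H K U ?a (Lact E K m (H K U ?b (Lact E K n (D U y))))"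
      by (simp only: e)
    also have "\<dots> = H K U ?a (H K ?a ?c (Lact E K (Mul (Quot X) K m n) (D U y)))"
      using H_Lact[OF K U abc(2) L_in[OF mn(2) Dy] mn(1)] L_L[OF Dy] by simp
    also have "\<dots> = H K U ?c (D ?c (Lact E K (Mul (Quot X) K m n) (D U y)))"
      by (rule HH) (use L_in[OF _ Dy] mn K in simp)
    also have "\<dots> = H K U ?c (Lact E K (Mul (Quot X) K m n) (D U (D U y)))"
      using L_D[OF _ U Dy] mn K by simp
    also have "\<dots> = st K (Mul (Quot X) K m n) y"
      unfolding st_def U_def[symmetric] D_def ..
    finally show ?thesis by simp
  qed
  have F_E: "y \<in> Sec E K" if "F K b y" for K b y using that by (simp add: F_def)
  note FI = H_F Lact_F Ract_F Res_F u_in bobj_Lact_in[OF bV]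
  \<comment> \<open>The fibre over u is a trivial right torsor under M with base point x0, and
    \<open>st\<close> is now a left action on it.\<close>
  obtain \<sigma> where "splitting \<sigma>"
  proof (rule splitting_of_action[where S = "\<lambda>K. {y. F K (u K) y}" and base = x0 and res = "Res E"
      and ra = "Ract E" and st = st and idn = "\<lambda>K y. snd (Ident E K y)"])
    fix J K :: space and f assume JK: "topological_manifold J" "topological_manifold K" "f \<in> man_hom J K"
    show "Res E J K f (x0 K) = x0 J" unfolding x0_def by (rule Res_const_sec[OF pE JK x(1)])
    show "Res E J K f (Ract E K y m) = Ract E J (Res E J K f y) (Res (Mid X) J K f m)"
      if "y \<in> {y. F K (u K) y}" "m \<in> Sec (Mid X) K" for y m
      using that torsor_Res_Ract[OF tE JK] by (simp add: F_def)
    show "Res E J K f (st K n y) = st J (Res (Quot X) J K f n) (Res E J K f y)"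
      if n: "n \<in> Sec (Quot X) K" and y: "y \<in> {y. F K (u K) y}" for n y
    proof -
      have y: "F K (u K) y" using y by simp
      note U = u_in[OF JK(2)] and H_y = H_F[OF JK(2) u_in[OF JK(2)] u_in[OF JK(2)]]
      have "Res E J K f (H K (u K) (u K) (H K (u K) (u K) y)) =
          H J (u J) (u J) (H J (u J) (u J) (Res E J K f y))"
        using H_Res[OF JK U U y] H_Res[OF JK U U H_y[OF y]] by (simp add: u_res[OF JK])
      then show ?thesis
        unfolding st_def
        using H_Res[OF JK U bobj_Lact_in[OF bV JK(2) n U] Lact_F[OF JK(2) n H_y[OF H_y[OF y]]]]
          bobj_Res_Lact[OF bE JK n F_E[OF H_y[OF H_y[OF y]]]] bobj_Res_Lact[OF bV JK n U]
        by (simp add: u_res[OF JK])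
    qed
  next
    fix K :: space assume K: "topological_manifold K"
    show "x0 K \<in> {y. F K (u K) y}" using x0_F[OF K] by simp
    show "snd (Ident E K (x0 K)) = One (Quot X) K"
      using gerbe_obj_Ident_Res[OF E K manifold_point_space to_point_hom x(1)] K
      by (simp add: x0_def const_sec_def x(3))
    fix y assume "y \<in> {y. F K (u K) y}"
    then have y: "F K (u K) y" by simp
    note U = u_in[OF K] and H_y = H_F[OF K u_in[OF K] u_in[OF K]]
    show "\<exists>!m. m \<in> Sec (Mid X) K \<and> y = Ract E K (x0 K) m"
      by (rule torsor_transitive[OF tE K]) (use x0_F[OF K] y in \<open>auto simp: F_def\<close>)
    show "Ract E K y m \<in> {y. F K (u K) y}"
      "snd (Ident E K (Ract E K y m)) = Mul (Quot X) K (snd (Ident E K y)) (Pr X K m)"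
      if "m \<in> Sec (Mid X) K" for m
      using Ract_F[OF K that y] gerbe_obj_Ident_Ract[OF E K that F_E[OF y]] by simp_all
    show "Ract E K y (Mul (Mid X) K m m') = Ract E K (Ract E K y m) m'"
      if "m \<in> Sec (Mid X) K" "m' \<in> Sec (Mid X) K" for m m'
      by (rule torsor_Ract_Mul[OF tE K F_E[OF y] that])
    fix n assume n: "n \<in> Sec (Quot X) K"
    show "st K n y \<in> {y. F K (u K) y}" using st_F[OF K n y] by simp
    show "st K (Mul (Quot X) K n n') y = st K n (st K n' y)" if "n' \<in> Sec (Quot X) K" for n'
      by (rule st_Mul[OF K n that y])
    show "st K n (Ract E K y m) = Ract E K (st K n y) m" if m: "m \<in> Sec (Mid X) K" for m
      unfolding st_def
      using H_Ract[OF K U U y m] H_Ract[OF K U U H_y[OF y] m]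
        torsor_Lact_Ract[OF tE K n F_E[OF H_y[OF H_y[OF y]]] m]
        H_Ract[OF K U bobj_Lact_in[OF bV K n U] Lact_F[OF K n H_y[OF H_y[OF y]]] m]
      by simp
    show "snd (Ident E K (st K n y)) = Mul (Quot X) K n (snd (Ident E K y))"
      unfolding st_def
      using H_Ident[OF K U U y] H_Ident[OF K U U H_y[OF y]]
        gerbe_obj_Ident_Lact[OF E K n F_E[OF H_y[OF H_y[OF y]]]]
        H_Ident[OF K U bobj_Lact_in[OF bV K n U] Lact_F[OF K n H_y[OF H_y[OF y]]]]
      by simp
  qed
  then show ?thesis by blast
qed

text \<open>A diagonal entry suffices: over the square of \<open>U i\<close>, the map
  \<open>h i i\<close> is a family of bijections H a b from the fibre of \<open>e i\<close> over b
  to the fibre over a, for all sections a, b of \<open>U i\<close>, and the cocycle with indices i,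
  i, i is precisely the identity required of H.\<close>

lemma splitting_if_class_vanishes:
  assumes "class_vanishes (classifying_class X :: ('a, 'n, 'v) gerbe_cocycle set)"
  shows "\<exists>\<sigma>. splitting \<sigma>"
proof -
  obtain I :: "'v set" and U :: "'v \<Rightarrow> ('n, 'v) bobj" and e :: "'v \<Rightarrow> ('n, 'v, 'v, 'a) gerbe_obj"
    and h where choice: "is_gerbe_choice X I U e h"
    and van: "\<forall>i\<in>I. \<forall>j\<in>I. \<forall>k\<in>I. \<forall>K. topological_manifold K \<longrightarrow>
     (\<forall>z\<in>Sec (gerbe_restrict (prod_bobj (U i) (prod_bobj (U j) (U k))) (\<lambda>K (a, b, c). c) (e k)) K.
        classifying_cocycle h i j k K z = z)"
    using assms unfolding class_vanishes_def classifying_class_def by blast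
  have "covers_final X I U" using choice by (simp add: is_gerbe_choice_def)
  then obtain i u where i: "i \<in> I" and u: "u \<in> Sec (U i) point_space" by (rule covers_final_point)
  define V E where "V = U i" and "E = e i"
  let ?E1 = "gerbe_restrict (prod_bobj V V) (\<lambda>K (a, b). b) E"
  let ?E2 = "gerbe_restrict (prod_bobj V V) (\<lambda>K (a, b). a) E"
  have E: "is_gerbe_obj X V E" and "gerbe_iso X ?E1 ?E2 (h i i)"
    using choice i unfolding is_gerbe_choice_def V_def E_def by blast+
  then have mor: "gerbe_mor X (\<lambda>K v. v) ?E1 ?E2 (h i i)" by (simp add: gerbe_iso_def)
  note smor = gerbe_mor_sheaf_mor[OF mor]
  define H where "H K a b x = fst (h i i K (x, (a, b)))" for K a b x
  define F where "F K b x \<longleftrightarrow> x \<in> Sec E K \<and> Proj E K x = b" for K b x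
  have E1: "(x, (a, b)) \<in> Sec ?E1 K"
    if "topological_manifold K" "a \<in> Sec V K" "b \<in> Sec V K" "F K b x" for K a b x
    using that by (simp add: gerbe_restrict_def prod_bobj_def F_def)
  \<comment> \<open>A morphism over the identity preserves the base pair (a, b), so only the first
    component of its value carries information.\<close>
  have h: "h i i K (x, (a, b)) = (H K a b x, (a, b)) \<and> F K a (H K a b x)"
    if "topological_manifold K" "a \<in> Sec V K" "b \<in> Sec V K" "F K b x" for K a b x
  proof -
    have "Proj ?E2 K (h i i K (x, (a, b))) = Proj ?E1 K (x, (a, b))"
      by (rule gerbe_mor_Proj[OF mor that(1) E1[OF that]])
    then have "snd (h i i K (x, (a, b))) = (a, b)"
      by (simp add: gerbe_restrict_def case_prod_unfold)
    moreover have "h i i K (x, (a, b)) \<in> Sec ?E2 K" by (rule sheaf_mor_in[OF smor that(1) E1[OF that]])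
    ultimately show ?thesis
      by (cases "h i i K (x, (a, b))") (auto simp: gerbe_restrict_def prod_bobj_def F_def H_def)
  qed
  note h_eq = h[THEN conjunct1]
  note bE = gerbe_obj_bobj[OF E] and bV = gerbe_obj_base[OF E] and tE = gerbe_obj_torsor[OF E]
  show ?thesis
  proof (rule splitting_if_descent_datum[OF E u[folded V_def], of H, folded F_def])
    fix K a b c y
    assume K: "topological_manifold K" "a \<in> Sec V K" "b \<in> Sec V K" and c: "c \<in> Sec V K" "F K c y"
    show "H K c a (H K a b (H K b c y)) = y"
    proof -
      have "(y, (a, (b, c))) \<in>
        Sec (gerbe_restrict (prod_bobj (U i) (prod_bobj (U i) (U i))) (\<lambda>K (a, b, c). c) (e i)) K"
        using K c by (simp add: gerbe_restrict_def prod_bobj_def F_def V_def E_def)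
      with van i K(1) have "classifying_cocycle h i i i K (y, (a, (b, c))) = (y, (a, (b, c)))" by blast
      then show ?thesis by (simp add: classifying_cocycle_def mor_restrict_def H_def)
    qed
  next
    fix K a b x
    assume K: "topological_manifold K" "a \<in> Sec V K" "b \<in> Sec V K" "F K b x"
    note E1 = E1[OF K] and h1 = h_eq[OF K]
    show "F K a (H K a b x)" using h[OF K] by simp
    have "Ident ?E2 K (h i i K (x, (a, b))) = map_prod (\<lambda>v. v) id (Ident ?E1 K (x, (a, b)))"
      by (rule gerbe_mor_Ident[OF mor K(1) E1])
    then show "snd (Ident E K (H K a b x)) = snd (Ident E K x)"
      by (simp add: h1 gerbe_restrict_def)
    show "H K a b (Ract E K x m) = Ract E K (H K a b x) m" if m: "m \<in> Sec (Mid X) K" for m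
    proof -
      have "h i i K (Ract ?E1 K (x, (a, b)) m) = Ract ?E2 K (h i i K (x, (a, b))) m"
        by (rule gerbe_mor_Ract[OF mor K(1) E1 m])
      then have "h i i K (Ract E K x m, (a, b)) = (Ract E K (H K a b x) m, (a, b))"
        unfolding h1 by (simp add: gerbe_restrict_def)
      then show ?thesis by (subst H_def) simp
    qed
    show "Lact E K n (H K a b x) = H K (Lact V K n a) (Lact V K n b) (Lact E K n x)"
      if n: "n \<in> Sec (Quot X) K" for n
    proof -
      have "h i i K (Lact ?E1 K n (x, (a, b))) = Lact ?E2 K n (h i i K (x, (a, b)))"
        by (rule gerbe_mor_Lact[OF mor K(1) n E1])
      then have "h i i K (Lact E K n x, (Lact V K n a, Lact V K n b)) =
          (Lact E K n (H K a b x), (Lact V K n a, Lact V K n b))"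
        unfolding h1 by (simp add: gerbe_restrict_def prod_bobj_def)
      then show ?thesis by (subst (2) H_def) simp
    qed
    show "Res E J K f (H K a b x) = H J (Res V J K f a) (Res V J K f b) (Res E J K f x)"
      if "topological_manifold J" "f \<in> man_hom J K" for J f
    proof -
      have "h i i J (Res ?E1 J K f (x, (a, b))) = Res ?E2 J K f (h i i K (x, (a, b)))"
        by (rule sheaf_mor_Res[OF smor that(1) K(1) that(2) E1])
      then have "h i i J (Res E J K f x, Res V J K f a, Res V J K f b) =
          (Res E J K f (H K a b x), Res V J K f a, Res V J K f b)"
        unfolding h1 by (simp add: gerbe_restrict_def prod_bobj_def)
      then show ?thesis by (subst (2) H_def) simp
    qed
  qed
qed

end

section \<open>Torsors under the automorphisms of a global object\<close>

context group_sheaf_extension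
begin

lemma ker_const: "topological_manifold K \<Longrightarrow> l \<in> Sec (Ker X) point_space \<Longrightarrow>
    const_sec (Mid X) K l \<in> Sec (Ker X) K"
  by (simp add: ker_Sec const_sec_def pr_Res)

lemma ker_in: "topological_manifold K \<Longrightarrow> l \<in> Sec (Ker X) K \<Longrightarrow> l \<in> Sec (Mid X) K"
  by (simp add: ker_Sec)

lemma ker_pr: "topological_manifold K \<Longrightarrow> l \<in> Sec (Ker X) K \<Longrightarrow> Pr X K l = One (Quot X) K"
  by (simp add: ker_Sec)

end

text \<open>Fixes a trivialisation of s as a right torsor under M, forgetting N: a base point
  compatible with restriction and lying over 1. What the base point fails to be fixed by is recorded
  in \<open>\<sigma>\<^sub>0\<close>.\<close>

locale pointed_global_obj = group_sheaf_extension X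
  for X :: "('a, 'n) extension" +
  fixes s :: "('n, 'a, 'v) global_obj" and base :: "space \<Rightarrow> 'v" and \<sigma>\<^sub>0 :: "space \<Rightarrow> 'n \<Rightarrow> 'a"
  assumes gerbe_obj: "is_gerbe_obj X final_bobj s"
    and base_in: "\<And>K. topological_manifold K \<Longrightarrow> base K \<in> Sec s K"
    and base_res: "\<And>J K f. \<lbrakk>topological_manifold J; topological_manifold K; f \<in> man_hom J K\<rbrakk> \<Longrightarrow>
      Res s J K f (base K) = base J"
    and base_Ident: "\<And>K. topological_manifold K \<Longrightarrow> snd (Ident s K (base K)) = One (Quot X) K"
    and \<sigma>\<^sub>0: "splitting \<sigma>\<^sub>0"
    and base_Lact: "\<And>K n. \<lbrakk>topological_manifold K; n \<in> Sec (Quot X) K\<rbrakk> \<Longrightarrow>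
      Lact s K n (base K) = Ract s K (base K) (\<sigma>\<^sub>0 K n)"

context group_sheaf_extension
begin

text \<open>Over the final object there is only one fibre, which N preserves; so
  \<open>splitting_of_action\<close> applies to the left action of s itself, without any transport
  between fibres.\<close>

lemma global_obj_pointed:
  assumes "is_global_obj X s"
  shows "\<exists>base \<sigma>\<^sub>0. pointed_global_obj X s base \<sigma>\<^sub>0"
proof -
  have s: "is_gerbe_obj X final_bobj s" using assms by (simp add: is_global_obj_def)
  note bs = gerbe_obj_bobj[OF s] and ts = gerbe_obj_torsor[OF s]
  note ps = bobj_presheaf[OF bs]
  obtain x where x: "x \<in> Sec s point_space" "snd (Ident s point_space x) = One (Quot X) point_space"
    using gerbe_obj_base_point[OF s, of "()"] by (auto simp: final_bobj_def)
  define base where "base K = const_sec s K x" for K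
  have base: "base K \<in> Sec s K" "snd (Ident s K (base K)) = One (Quot X) K"
    if "topological_manifold K" for K
    using const_sec_in[OF ps that x(1)] gerbe_obj_Ident_Res[OF s that manifold_point_space to_point_hom x(1)] that
    by (simp_all add: base_def const_sec_def x(2))
  have base_res: "Res s J K f (base K) = base J"
    if "topological_manifold J" "topological_manifold K" "f \<in> man_hom J K" for J K f
    unfolding base_def by (rule Res_const_sec[OF ps that x(1)])
  have ex1: "\<exists>!m. m \<in> Sec (Mid X) K \<and> y = Ract s K (base K) m"
    if "topological_manifold K" "y \<in> Sec s K" for K y
    using that base by (intro torsor_transitive[OF ts]) auto
  obtain \<sigma> where "splitting \<sigma>"
    "\<And>K n. \<lbrakk>topological_manifold K; n \<in> Sec (Quot X) K\<rbrakk> \<Longrightarrow> Lact s K n (base K) = Ract s K (base K) (\<sigma> K n)"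
    by (rule splitting_of_action[where S = "Sec s" and base = base and res = "Res s" and ra = "Ract s"
          and st = "Lact s" and idn = "\<lambda>K x. snd (Ident s K x)"])
      (simp_all add: base base_res ex1 gerbe_obj_Ident_Lact[OF s] gerbe_obj_Ident_Ract[OF s]
        torsor_Ract_in[OF ts] torsor_Ract_Mul[OF ts] torsor_Res_Ract[OF ts] torsor_Lact_Ract[OF ts]
        bobj_Lact_in[OF bs] bobj_Lact_Mul[OF bs] bobj_Res_Lact[OF bs])
  then have "pointed_global_obj X s base \<sigma>"
    using s base base_res by unfold_locales
  then show ?thesis by blast
qed

end

context pointed_global_obj
begin

lemmas s_bobj = gerbe_obj_bobj[OF gerbe_obj] and s_torsor = gerbe_obj_torsor[OF gerbe_obj]

lemmas \<sigma>\<^sub>0_simps [simp] = splittingD[OF \<sigma>\<^sub>0] splitting_One[OF \<sigma>\<^sub>0] splitting_Inv[OF \<sigma>\<^sub>0]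

section \<open>Coordinates on a global object\<close>

definition pt :: "space \<Rightarrow> 'a \<Rightarrow> 'v" where
  "pt K m = Ract s K (base K) m"

text \<open>In these coordinates s is M with its right multiplication, its restrictions and its
  projection to N, and N acts by left multiplication through \<open>\<sigma>\<^sub>0\<close>; the
  simplification rules below express this.\<close>

definition coord :: "space \<Rightarrow> 'v \<Rightarrow> 'a" where
  "coord K x = (THE m. m \<in> Sec (Mid X) K \<and> x = pt K m)"

context
  fixes K :: space assumes K: "topological_manifold K"
begin

lemma pt_in [simp]: "m \<in> Sec (Mid X) K \<Longrightarrow> pt K m \<in> Sec s K"
  unfolding pt_def by (rule torsor_Ract_in[OF s_torsor K base_in[OF K]])

lemma pt_ex1: "x \<in> Sec s K \<Longrightarrow> \<exists>!m. m \<in> Sec (Mid X) K \<and> x = pt K m"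
  unfolding pt_def by (rule torsor_transitive[OF s_torsor K base_in[OF K]]) simp_all

lemma coord_in [simp]: "x \<in> Sec s K \<Longrightarrow> coord K x \<in> Sec (Mid X) K"
  and pt_coord: "x \<in> Sec s K \<Longrightarrow> pt K (coord K x) = x"
  using theI'[OF pt_ex1] by (simp_all add: coord_def)

lemma coord_pt [simp]: "m \<in> Sec (Mid X) K \<Longrightarrow> coord K (pt K m) = m"
  using pt_ex1[OF pt_in, of m] coord_in[OF pt_in, of m] pt_coord[OF pt_in, of m] by metis

lemma s_cases: assumes "x \<in> Sec s K" obtains m where "m \<in> Sec (Mid X) K" "x = pt K m"
  using pt_ex1[OF assms] by blast

lemma pt_One: "pt K (One (Mid X) K) = base K"
  unfolding pt_def by (rule torsor_Ract_one[OF s_torsor K base_in[OF K]])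

lemma Ract_pt [simp]: "m \<in> Sec (Mid X) K \<Longrightarrow> m' \<in> Sec (Mid X) K \<Longrightarrow>
    Ract s K (pt K m) m' = pt K (Mul (Mid X) K m m')"
  unfolding pt_def by (rule torsor_Ract_Mul[OF s_torsor K base_in[OF K], symmetric])

lemma Lact_pt [simp]: "n \<in> Sec (Quot X) K \<Longrightarrow> m \<in> Sec (Mid X) K \<Longrightarrow>
    Lact s K n (pt K m) = pt K (Mul (Mid X) K (\<sigma>\<^sub>0 K n) m)"
  unfolding pt_def using torsor_Lact_Ract[OF s_torsor K _ base_in[OF K]]
    torsor_Ract_Mul[OF s_torsor K base_in[OF K]] base_Lact[OF K] splitting_in[OF \<sigma>\<^sub>0 K]
  by simp

lemma Ident_pt [simp]: "m \<in> Sec (Mid X) K \<Longrightarrow> Ident s K (pt K m) = ((), Pr X K m)"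
  unfolding pt_def using gerbe_obj_Ident_Ract[OF gerbe_obj K _ base_in[OF K], of m] base_Ident[OF K] K
  by (simp add: prod_eq_iff)

lemma Res_pt [simp]: "topological_manifold J \<Longrightarrow> f \<in> man_hom J K \<Longrightarrow> m \<in> Sec (Mid X) K \<Longrightarrow>
    Res s J K f (pt K m) = pt J (Res (Mid X) J K f m)"
  unfolding pt_def using torsor_Res_Ract[OF s_torsor _ K _ base_in[OF K]] base_res[OF _ K] by simp

end

text \<open>Maps of M commuting with right multiplications are left multiplications. An automorphism
  of the restriction of s to K therefore has this form in coordinates, with the factor l restricted
  along each arrow to K.\<close>

definition twist :: "space \<Rightarrow> 'a \<Rightarrow> space \<times> smap \<Rightarrow> 'v \<Rightarrow> 'v" where
  "twist K l = (\<lambda>(J, f)\<in>arrows_to K. \<lambda>x\<in>Sec s J. pt J (Mul (Mid X) J (Res (Mid X) J K f l) (coord J x)))"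

lemma arrows_to_iff [simp]: "(J, f) \<in> arrows_to K \<longleftrightarrow> topological_manifold J \<and> f \<in> man_hom J K"
  by (simp add: arrows_to_def)

lemma twist_pt [simp]: "topological_manifold J \<Longrightarrow> f \<in> man_hom J K \<Longrightarrow> m \<in> Sec (Mid X) J \<Longrightarrow>
    twist K l (J, f) (pt J m) = pt J (Mul (Mid X) J (Res (Mid X) J K f l) m)"
  by (simp add: twist_def)

lemma family_eqI:
  assumes "u \<in> extensional (arrows_to K)" "v \<in> extensional (arrows_to K)"
    and "\<And>J f. \<lbrakk>topological_manifold J; f \<in> man_hom J K\<rbrakk> \<Longrightarrow> u (J, f) \<in> extensional (Sec s J)"
    and "\<And>J f. \<lbrakk>topological_manifold J; f \<in> man_hom J K\<rbrakk> \<Longrightarrow> v (J, f) \<in> extensional (Sec s J)"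
    and "\<And>J f m. \<lbrakk>topological_manifold J; f \<in> man_hom J K; m \<in> Sec (Mid X) J\<rbrakk> \<Longrightarrow>
      u (J, f) (pt J m) = v (J, f) (pt J m)"
  shows "u = v"
proof (rule extensionalityI[OF assms(1,2)])
  fix z assume "z \<in> arrows_to K"
  then obtain J f where z: "z = (J, f)" and J: "topological_manifold J" "f \<in> man_hom J K"
    by (cases z) auto
  show "u z = v z"
    unfolding z
  proof (rule extensionalityI[OF assms(3)[OF J] assms(4)[OF J]])
    fix x assume "x \<in> Sec s J"
    then obtain m where "m \<in> Sec (Mid X) J" "x = pt J m" by (rule s_cases[OF J(1)])
    then show "u (J, f) x = v (J, f) x" using assms(5)[OF J] by simp
  qed
qed

lemma twist_extensional [simp]: "twist K l \<in> extensional (arrows_to K)"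
  "topological_manifold J \<Longrightarrow> f \<in> man_hom J K \<Longrightarrow> twist K l (J, f) \<in> extensional (Sec s J)"
  by (simp_all add: twist_def)

text \<open>Left multiplication by l preserves the identification with N because l lies over 1, and
  it commutes with the right action by associativity; left multiplication by l^-1 inverts
  it.\<close>

lemma twist_in_Aut:
  assumes K: "topological_manifold K" and l: "l \<in> Sec (Ker X) K"
  shows "twist K l \<in> Sec (obj_Aut_sheaf X s) K"
proof -
  have lM: "l \<in> Sec (Mid X) K" by (rule ker_in[OF K l])
  have "twist K l (J, f) \<in> extensional (Sec s J) \<and>
      bij_betw (twist K l (J, f)) (Sec s J) (Sec s J) \<and>
      (\<forall>x\<in>Sec s J. Ident s J (twist K l (J, f) x) = Ident s J x \<and>
        (\<forall>m\<in>Sec (Mid X) J. twist K l (J, f) (Ract s J x m) = Ract s J (twist K l (J, f) x) m) \<and>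
        (\<forall>(J', g)\<in>arrows_to J. Res s J' J g (twist K l (J, f) x) =
          twist K l (J', compose (topspace J') f g) (Res s J' J g x)))"
    if J: "topological_manifold J" "f \<in> man_hom J K" for J f
  proof -
    define k where "k = Res (Mid X) J K f l"
    have k: "k \<in> Sec (Mid X) J" "Pr X J k = One (Quot X) J"
      using J K lM ker_pr[OF K l] by (simp_all add: k_def pr_Res)
    have tw: "twist K l (J, f) (pt J m) = pt J (Mul (Mid X) J k m)" if "m \<in> Sec (Mid X) J" for m
      using J that by (simp add: k_def)
    have "bij_betw (twist K l (J, f)) (Sec s J) (Sec s J)"
      by (rule bij_betw_byWitness[where f' = "\<lambda>x. pt J (Mul (Mid X) J (mid.Inv J k) (coord J x))"])
        (use J k in \<open>auto elim!: s_cases[OF J(1)] simp: tw simp del: twist_pt\<close>)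
    moreover have "Ident s J (twist K l (J, f) x) = Ident s J x" if "x \<in> Sec s J" for x
      using that J k by (auto elim!: s_cases[OF J(1)] simp: tw simp del: twist_pt)
    moreover have "twist K l (J, f) (Ract s J x m) = Ract s J (twist K l (J, f) x) m"
      if "x \<in> Sec s J" "m \<in> Sec (Mid X) J" for x m
      using that J k by (auto elim!: s_cases[OF J(1)] simp: tw simp del: twist_pt)
    moreover have "Res s J' J g (twist K l (J, f) x) =
        twist K l (J', compose (topspace J') f g) (Res s J' J g x)"
      if "x \<in> Sec s J" "topological_manifold J'" "g \<in> man_hom J' J" for x J' g
    proof -
      have "Res (Mid X) J' J g k = Res (Mid X) J' K (compose (topspace J') f g) l"
        unfolding k_def by (rule presheaf_Res_Res[OF mid.presheaf that(2) J(1) K that(3) J(2) lM])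
      moreover obtain m where m: "m \<in> Sec (Mid X) J" "x = pt J m"
        by (rule s_cases[OF J(1) \<open>x \<in> Sec s J\<close>])
      ultimately show ?thesis
        unfolding m(2) tw[OF m(1)] using m(1) that(2,3) J k man_hom_compose[OF that(3) J(2)] by simp
    qed
    ultimately show ?thesis using J by auto
  qed
  note main = this
  show ?thesis
    unfolding obj_Aut_sheaf_def sheaf.simps mem_Collect_eq
  proof (intro conjI twist_extensional(1) ballI, goal_cases)
    case (1 z)
    obtain J f where z: "z = (J, f)" by (cases z)
    show ?case unfolding z prod.case by (rule main) (use 1 z in simp_all)
  qed
qed

text \<open>An automorphism is determined by what the identity arrow does to the base point:
  restriction yields its value at the base point over any J, and right equivariance yields the rest.
  The coordinate l of that value lies in L since the identification is preserved.\<close>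

lemma Aut_eq_twist:
  assumes K: "topological_manifold K"
  shows "Sec (obj_Aut_sheaf X s) K = twist K ` Sec (Ker X) K"
proof
  show "twist K ` Sec (Ker X) K \<subseteq> Sec (obj_Aut_sheaf X s) K" using twist_in_Aut[OF K] by blast
  show "Sec (obj_Aut_sheaf X s) K \<subseteq> twist K ` Sec (Ker X) K"
  proof
    fix u assume u: "u \<in> Sec (obj_Aut_sheaf X s) K"
    let ?id = "\<lambda>k\<in>topspace K. k"
    have u_ext: "u \<in> extensional (arrows_to K)" using u by (simp add: obj_Aut_sheaf_def)
    have uJ: "u (J, f) \<in> extensional (Sec s J)" "bij_betw (u (J, f)) (Sec s J) (Sec s J)"
      "\<And>x. x \<in> Sec s J \<Longrightarrow> Ident s J (u (J, f) x) = Ident s J x"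
      "\<And>x m. x \<in> Sec s J \<Longrightarrow> m \<in> Sec (Mid X) J \<Longrightarrow> u (J, f) (Ract s J x m) = Ract s J (u (J, f) x) m"
      "\<And>x J' g. x \<in> Sec s J \<Longrightarrow> topological_manifold J' \<Longrightarrow> g \<in> man_hom J' J \<Longrightarrow>
        Res s J' J g (u (J, f) x) = u (J', compose (topspace J') f g) (Res s J' J g x)"
      if "topological_manifold J" "f \<in> man_hom J K" for J f
      using u that unfolding obj_Aut_sheaf_def by (fastforce simp del: restrict_apply)+
    define l where "l = coord K (u (K, ?id) (base K))"
    have uK: "u (K, ?id) (base K) \<in> Sec s K"
      using uJ(2)[OF K man_hom_id] base_in[OF K] by (rule bij_betwE[rule_format])
    then have l: "l \<in> Sec (Mid X) K" "u (K, ?id) (base K) = pt K l"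
      using K by (simp_all add: l_def pt_coord)
    have "Ident s K (pt K l) = Ident s K (pt K (One (Mid X) K))"
      using uJ(3)[OF K man_hom_id base_in[OF K]] l(2) pt_One[OF K] by simp
    then have lK: "l \<in> Sec (Ker X) K" using K l(1) by (simp add: ker_Sec)
    have "u = twist K l"
    proof (rule family_eqI[OF u_ext twist_extensional(1) uJ(1) twist_extensional(2)])
      fix J f m assume J: "topological_manifold J" "f \<in> man_hom J K" and m: "m \<in> Sec (Mid X) J"
      \<comment> \<open>The compatibility of the family is used for the identity arrow of K followed
        by f; the base point restricts to the base point.\<close>
      have "u (J, f) (base J) = Res s J K f (u (K, ?id) (base K))"
        using uJ(5)[OF K man_hom_id base_in[OF K] J] J K by (simp add: compose_id_left base_res)
      then have "u (J, f) (base J) = pt J (Res (Mid X) J K f l)"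
        using J K l by simp
      then show "u (J, f) (pt J m) = twist K l (J, f) (pt J m)"
        using uJ(4)[OF J base_in[OF J(1)] m] J K l m by (simp add: pt_def[of J m, symmetric])
    qed
    with lK show "u \<in> twist K ` Sec (Ker X) K" by blast
  qed
qed

lemma Aut_cases:
  assumes "topological_manifold K" "u \<in> Sec (obj_Aut_sheaf X s) K"
  obtains l where "l \<in> Sec (Ker X) K" "u = twist K l"
  using assms Aut_eq_twist by blast

text \<open>Evaluating at the identity arrow and at the point with coordinate 1 recovers
  \<open>pt K l\<close>, hence l.\<close>

lemma twist_inj:
  assumes K: "topological_manifold K" shows "inj_on (twist K) (Sec (Mid X) K)"
proof (rule inj_onI)
  fix l l' assume l: "l \<in> Sec (Mid X) K" "l' \<in> Sec (Mid X) K" "twist K l = twist K l'"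
  have "twist K k (K, \<lambda>k\<in>topspace K. k) (pt K (One (Mid X) K)) = pt K k" if "k \<in> Sec (Mid X) K" for k
    using that K by (simp add: presheaf_Res_id[OF mid.presheaf])
  with l have "pt K l = pt K l'" by metis
  with l K show "l = l'" by (metis coord_pt)
qed

section \<open>The automorphism sheaf as L with conjugation through the base splitting\<close>

lemma twist_Mul:
  assumes K: "topological_manifold K" and l: "l \<in> Sec (Mid X) K" "l' \<in> Sec (Mid X) K"
  shows "Mul (obj_Aut_sheaf X s) K (twist K l) (twist K l') = twist K (Mul (Mid X) K l l')"
  by (rule family_eqI) (use assms in \<open>auto simp: obj_Aut_sheaf_def compose_def\<close>)

lemma twist_One:
  assumes K: "topological_manifold K"
  shows "One (obj_Aut_sheaf X s) K = twist K (One (Mid X) K)"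
  by (rule family_eqI) (use assms in \<open>auto simp: obj_Aut_sheaf_def\<close>)

lemma twist_Res:
  assumes "topological_manifold J" "topological_manifold K" "f \<in> man_hom J K" "l \<in> Sec (Mid X) K"
  shows "Res (obj_Aut_sheaf X s) J K f (twist K l) = twist J (Res (Mid X) J K f l)"
  by (rule family_eqI)
    (use assms man_hom_compose[of _ _ J f K] in
      \<open>auto simp: obj_Aut_sheaf_def presheaf_Res_Res[OF mid.presheaf]\<close>)

text \<open>N acts on automorphisms by conjugating with its left action on s, and in coordinates
  that action is left multiplication by \<open>\<sigma>\<^sub>0\<close>.\<close>

lemma twist_conj:
  assumes K: "topological_manifold K" and n: "n \<in> Sec (Quot X) K" and l: "l \<in> Sec (Mid X) K"
  shows "obj_Aut_conj X s K n (twist K l) =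
    twist K (Mul (Mid X) K (\<sigma>\<^sub>0 K n) (Mul (Mid X) K l (mid.Inv K (\<sigma>\<^sub>0 K n))))"
  by (rule family_eqI) (use assms in \<open>auto simp: obj_Aut_conj_def Let_def\<close>)


abbreviation tract :: "('a, 'n, 'v) obj_Aut_torsor \<Rightarrow> space \<Rightarrow> 'v \<Rightarrow> 'a \<Rightarrow> 'v" where
  "tract T K t l \<equiv> Ract T K t (twist K l)"

lemma ker_One [simp]: "topological_manifold K \<Longrightarrow> One (Mid X) K \<in> Sec (Ker X) K"
  and ker_Mul [simp]: "topological_manifold K \<Longrightarrow> l \<in> Sec (Ker X) K \<Longrightarrow> l' \<in> Sec (Ker X) K \<Longrightarrow>
    Mul (Mid X) K l l' \<in> Sec (Ker X) K"
  and ker_Inv [simp]: "topological_manifold K \<Longrightarrow> l \<in> Sec (Ker X) K \<Longrightarrow> mid.Inv K l \<in> Sec (Ker X) K"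
  by (simp_all add: ker_Sec)

lemma ker_Res_in [simp]: "topological_manifold J \<Longrightarrow> topological_manifold K \<Longrightarrow> f \<in> man_hom J K \<Longrightarrow>
    l \<in> Sec (Ker X) K \<Longrightarrow> Res (Mid X) J K f l \<in> Sec (Ker X) J"
  by (simp add: ker_Sec pr_Res)

lemma ker_conj [simp]: "topological_manifold K \<Longrightarrow> m \<in> Sec (Mid X) K \<Longrightarrow> l \<in> Sec (Ker X) K \<Longrightarrow>
    Mul (Mid X) K m (Mul (Mid X) K l (mid.Inv K m)) \<in> Sec (Ker X) K"
  by (simp add: ker_Sec)

text \<open>Two splittings differ by a family in L, as both values lie over n. This difference is
  the crossed homomorphism that measures a torsor.\<close>

lemma ker_diff [simp]: "topological_manifold K \<Longrightarrow> splitting \<sigma> \<Longrightarrow> n \<in> Sec (Quot X) K \<Longrightarrow>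
    Mul (Mid X) K (\<sigma> K n) (mid.Inv K (\<sigma>\<^sub>0 K n)) \<in> Sec (Ker X) K"
  by (simp add: ker_Sec splitting_in splitting_pr)

text \<open>Rewrites the axioms of a torsor under the automorphism sheaf in terms of L, through the
  isomorphism \<open>twist\<close>, so that the computations below take place inside M.\<close>

lemma H1_torsorD:
  assumes T: "T \<in> H1_torsors X s"
  shows H1_torsor_bobj: "is_bobj (Quot X) T"
    and tract_in: "\<And>K t l. \<lbrakk>topological_manifold K; t \<in> Sec T K; l \<in> Sec (Ker X) K\<rbrakk> \<Longrightarrow> tract T K t l \<in> Sec T K"
    and tract_Mul: "\<And>K t l l'. \<lbrakk>topological_manifold K; t \<in> Sec T K; l \<in> Sec (Ker X) K; l' \<in> Sec (Ker X) K\<rbrakk> \<Longrightarrow>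
      tract T K t (Mul (Mid X) K l l') = tract T K (tract T K t l) l'"
    and tract_Lact: "\<And>K n t l. \<lbrakk>topological_manifold K; n \<in> Sec (Quot X) K; t \<in> Sec T K; l \<in> Sec (Ker X) K\<rbrakk> \<Longrightarrow>
      Lact T K n (tract T K t l) =
        tract T K (Lact T K n t) (Mul (Mid X) K (\<sigma>\<^sub>0 K n) (Mul (Mid X) K l (mid.Inv K (\<sigma>\<^sub>0 K n))))"
    and tract_Res: "\<And>J K f t l. \<lbrakk>topological_manifold J; topological_manifold K; f \<in> man_hom J K;
      t \<in> Sec T K; l \<in> Sec (Ker X) K\<rbrakk> \<Longrightarrow>
      Res T J K f (tract T K t l) = tract T J (Res T J K f t) (Res (Mid X) J K f l)"
    and tract_ex1: "\<And>K t t'. \<lbrakk>topological_manifold K; t \<in> Sec T K; t' \<in> Sec T K\<rbrakk> \<Longrightarrow>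
      \<exists>!l. l \<in> Sec (Ker X) K \<and> t' = tract T K t l"
    and tract_inj: "\<And>K t l l'. \<lbrakk>topological_manifold K; t \<in> Sec T K; l \<in> Sec (Ker X) K; l' \<in> Sec (Ker X) K;
      tract T K t l = tract T K t l'\<rbrakk> \<Longrightarrow> l = l'"
    and H1_torsor_point: "\<exists>t. t \<in> Sec T point_space"
proof -
  let ?A = "obj_Aut_sheaf X s"
  have t: "is_torsor (Quot X) ?A (obj_Aut_conj X s) final_bobj T"
    using T by (simp add: H1_torsors_def)
  show b: "is_bobj (Quot X) T" by (rule torsor_bobj[OF t])
  \<comment> \<open>The projection to the final object is an epimorphism, so it is onto over the
    point: as a sheaf without its left action, T has a global element.\<close>
  have "\<exists>t\<in>Sec T point_space. Proj T point_space t = ()"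
    by (rule sheaf_epi_onto_point[OF bobj_presheaf[OF b] _ torsor_epi[OF t], of "()"])
      (use bobj_presheaf[OF is_bobj_one_point[of "()"]] in \<open>auto simp: final_bobj_eq\<close>)
  then show "\<exists>t. t \<in> Sec T point_space" by blast
  fix K t l assume K: "topological_manifold K" and x: "t \<in> Sec T K"
  note ker = ker_in[OF K] and A = twist_in_Aut[OF K]
  show in_T: "tract T K t l \<in> Sec T K" if "l \<in> Sec (Ker X) K" for l
    by (rule torsor_Ract_in[OF t K x A[OF that]])
  show "tract T K t (Mul (Mid X) K l l') = tract T K (tract T K t l) l'"
    if "l \<in> Sec (Ker X) K" "l' \<in> Sec (Ker X) K" for l l'
    using torsor_Ract_Mul[OF t K x A[OF that(1)] A[OF that(2)]]
    by (simp add: twist_Mul[OF K ker[OF that(1)] ker[OF that(2)]])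
  show "Lact T K n (tract T K t l) =
      tract T K (Lact T K n t) (Mul (Mid X) K (\<sigma>\<^sub>0 K n) (Mul (Mid X) K l (mid.Inv K (\<sigma>\<^sub>0 K n))))"
    if "n \<in> Sec (Quot X) K" "l \<in> Sec (Ker X) K" for n l
    using torsor_Lact_Ract[OF t K that(1) x A[OF that(2)]]
    by (simp add: twist_conj[OF K that(1) ker[OF that(2)]])
  show "Res T J K f (tract T K t l) = tract T J (Res T J K f t) (Res (Mid X) J K f l)"
    if "topological_manifold J" "f \<in> man_hom J K" "l \<in> Sec (Ker X) K" for J f l
    using torsor_Res_Ract[OF t that(1) K that(2) x A[OF that(3)]]
    by (simp add: twist_Res[OF that(1) K that(2) ker[OF that(3)]])
  show ex1: "\<exists>!l. l \<in> Sec (Ker X) K \<and> t' = tract T K t l" if t': "t' \<in> Sec T K" for t'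
  proof -
    have "\<exists>!a. a \<in> Sec ?A K \<and> t' = Ract T K t a"
      by (rule torsor_transitive[OF t K x t']) simp
    then obtain a where a: "a \<in> Sec ?A K" "t' = Ract T K t a"
      and uniq: "\<And>b. b \<in> Sec ?A K \<Longrightarrow> t' = Ract T K t b \<Longrightarrow> b = a" by blast
    obtain l where l: "l \<in> Sec (Ker X) K" "a = twist K l"
      using a(1) unfolding Aut_eq_twist[OF K] by blast
    show ?thesis
    proof (rule ex1I[of _ l])
      show "l \<in> Sec (Ker X) K \<and> t' = tract T K t l" using l a by simp
      fix l' assume l': "l' \<in> Sec (Ker X) K \<and> t' = tract T K t l'"
      then have "twist K l' = twist K l" using uniq[OF A] l(2) by blast
      with l' l show "l' = l" using twist_inj[OF K] ker by (auto dest: inj_onD)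
    qed
  qed
  show "l = l'" if "l \<in> Sec (Ker X) K" "l' \<in> Sec (Ker X) K" "tract T K t l = tract T K t l'" for l l'
    using ex1[OF in_T[OF that(1)]] that by blast
qed

text \<open>A relation rather than a function, since the splitting depends on the chosen point t of
  T. By \<open>associated_iso_iff\<close> the ambiguity is exactly conjugacy on one side and
  isomorphism on the other.\<close>

definition associated :: "('a, 'n, 'v) obj_Aut_torsor \<Rightarrow> (space \<Rightarrow> 'n \<Rightarrow> 'a) \<Rightarrow> bool" where
  "associated T \<sigma> \<longleftrightarrow> T \<in> H1_torsors X s \<and> splitting \<sigma> \<and>
     (\<exists>t\<in>Sec T point_space. \<forall>K. topological_manifold K \<longrightarrow> (\<forall>n\<in>Sec (Quot X) K.
        Lact T K n (const_sec T K t) =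
          tract T K (const_sec T K t) (Mul (Mid X) K (\<sigma> K n) (mid.Inv K (\<sigma>\<^sub>0 K n)))))"

text \<open>Moving n past a(n') in n (n' t) conjugates it by \<open>\<sigma>\<^sub>0 K n\<close>,
  which gives the crossed homomorphism law for a. The law is equivalent to multiplicativity of the
  product of a with \<open>\<sigma>\<^sub>0\<close>.\<close>

lemma associated_splitting:
  assumes T: "T \<in> H1_torsors X s"
  shows "\<exists>\<sigma>. associated T \<sigma>"
proof -
  note D = H1_torsorD[OF T]
  note b = H1_torsor_bobj[OF T] and p = bobj_presheaf[OF H1_torsor_bobj[OF T]]
  obtain t where t: "t \<in> Sec T point_space" using H1_torsor_point[OF T] by blast
  define c where "c K = const_sec T K t" for K
  have c: "c K \<in> Sec T K" if "topological_manifold K" for K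
    unfolding c_def using p that t by (rule const_sec_in)
  have c_res: "Res T J K f (c K) = c J"
    if "topological_manifold J" "topological_manifold K" "f \<in> man_hom J K" for J K f
    unfolding c_def by (rule Res_const_sec[OF p that t])
  define a where "a K n = (THE l. l \<in> Sec (Ker X) K \<and> Lact T K n (c K) = tract T K (c K) l)" for K n
  have a: "a K n \<in> Sec (Ker X) K" "Lact T K n (c K) = tract T K (c K) (a K n)"
    if "topological_manifold K" "n \<in> Sec (Quot X) K" for K n
    using theI'[OF tract_ex1[OF T that(1) c[OF that(1)] bobj_Lact_in[OF b that c[OF that(1)]]]]
    by (simp_all add: a_def)
  note aM = ker_in[OF _ a(1)]
  define \<sigma> where "\<sigma> K n = Mul (Mid X) K (a K n) (\<sigma>\<^sub>0 K n)" for K n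
  have "splitting \<sigma>"
    unfolding splitting_def
  proof (intro conjI allI impI ballI, goal_cases)
    case (1 K n) then show ?case using aM[of K n] by (simp add: \<sigma>_def)
  next
    case (2 K n) then show ?case using aM[of K n] ker_pr[OF _ a(1), of K n] by (simp add: \<sigma>_def)
  next
    case (3 K n n')
    note K = 3(1) and n = 3(2) and n' = 3(3)
    \<comment> \<open>The conjugate of a(n') that appears when n is moved past it.\<close>
    let ?k = "Mul (Mid X) K (\<sigma>\<^sub>0 K n) (Mul (Mid X) K (a K n') (mid.Inv K (\<sigma>\<^sub>0 K n)))"
    have k: "?k \<in> Sec (Ker X) K" using K n a(1)[OF K n'] by simp
    have "tract T K (c K) (a K (Mul (Quot X) K n n')) = Lact T K n (Lact T K n' (c K))"
      using K n n' by (simp add: bobj_Lact_Mul[OF b] c flip: a(2))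
    also have "\<dots> = tract T K (Lact T K n (c K)) ?k"
      by (simp only: a(2)[OF K n'] tract_Lact[OF T K n c[OF K] a(1)[OF K n']])
    also have "\<dots> = tract T K (c K) (Mul (Mid X) K (a K n) ?k)"
      by (simp only: a(2)[OF K n] tract_Mul[OF T K c[OF K] a(1)[OF K n] k])
    finally have "a K (Mul (Quot X) K n n') = Mul (Mid X) K (a K n) ?k"
      using tract_inj[OF T K c[OF K] a(1)] K n n' a(1)[OF K n] k by simp
    then show ?case using K n n' aM[OF K K n] aM[OF K K n'] by (simp add: \<sigma>_def)
  next
    case (4 J K f n)
    then have JK: "topological_manifold J" "topological_manifold K" "f \<in> man_hom J K" by auto
    note n = 4(2)
    have "tract T J (c J) (a J (Res (Quot X) J K f n)) = Res T J K f (Lact T K n (c K))"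
      using JK n by (simp add: bobj_Res_Lact[OF b] c c_res flip: a(2))
    also have "\<dots> = tract T J (c J) (Res (Mid X) J K f (a K n))"
      by (simp only: a(2)[OF JK(2) n] tract_Res[OF T JK c[OF JK(2)] a(1)[OF JK(2) n]] c_res[OF JK])
    finally have "a J (Res (Quot X) J K f n) = Res (Mid X) J K f (a K n)"
      using tract_inj[OF T JK(1) c[OF JK(1)] a(1)] JK n a(1)[OF JK(2) n] by simp
    then show ?case using JK n aM[OF JK(2) JK(2) n] by (simp add: \<sigma>_def)
  qed
  moreover have "Lact T K n (c K) = tract T K (c K) (Mul (Mid X) K (\<sigma> K n) (mid.Inv K (\<sigma>\<^sub>0 K n)))"
    if "topological_manifold K" "n \<in> Sec (Quot X) K" for K n
    using a[OF that] aM[OF that(1) that] that by (simp add: \<sigma>_def)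
  ultimately show ?thesis using T t unfolding associated_def c_def by blast
qed

text \<open>L with right multiplication, and with n acting by
  \<open>m \<mapsto> \<sigma>(n) m \<sigma>\<^sub>0(n)^-1\<close>; the unit of L is then moved by
  the difference of the two splittings. Automorphisms are turned back into elements of L by
  inverting \<open>twist\<close>.\<close>

definition split_torsor :: "('a \<Rightarrow> 'v) \<Rightarrow> (space \<Rightarrow> 'n \<Rightarrow> 'a) \<Rightarrow> ('a, 'n, 'v) obj_Aut_torsor" where
  "split_torsor emb \<sigma> =
     \<lparr>Sec = (\<lambda>K. emb ` Sec (Ker X) K),
      Res = (\<lambda>J K f x. emb (Res (Mid X) J K f (the_inv emb x))),
      Lact = (\<lambda>K n x. emb (Mul (Mid X) K (\<sigma> K n) (Mul (Mid X) K (the_inv emb x) (mid.Inv K (\<sigma>\<^sub>0 K n))))),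
      Proj = (\<lambda>K x. ()),
      Ract = (\<lambda>K x u. emb (Mul (Mid X) K (the_inv emb x) (inv_into (Sec (Ker X) K) (twist K) u)))\<rparr>"

lemma associated_torsor:
  assumes emb: "inj emb" and \<sigma>: "splitting \<sigma>"
  shows "associated (split_torsor emb \<sigma>) \<sigma>"
proof -
  note [simp] = the_inv_f_f[OF emb] inj_eq[OF emb] splittingD[OF \<sigma>] splitting_One[OF \<sigma>]
  let ?T = "split_torsor emb \<sigma>" and ?A = "obj_Aut_sheaf X s"
  have inv_twist: "inv_into (Sec (Ker X) K) (twist K) (twist K l) = l"
    if "topological_manifold K" "l \<in> Sec (Ker X) K" for K l
    using that by (intro inv_into_f_f inj_on_subset[OF twist_inj]) (auto simp: ker_Sec)
  have simps [simp]: "Sec ?T K = emb ` Sec (Ker X) K" "Proj ?T K x = ()"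
    "Res ?T J K f (emb m) = emb (Res (Mid X) J K f m)"
    "Lact ?T K n (emb m) = emb (Mul (Mid X) K (\<sigma> K n) (Mul (Mid X) K m (mid.Inv K (\<sigma>\<^sub>0 K n))))"
    for J K f m n x
    by (simp_all add: split_torsor_def)
  have Ract [simp]: "tract ?T K (emb m) l = emb (Mul (Mid X) K m l)"
    if "topological_manifold K" "l \<in> Sec (Ker X) K" for K m l
    using that by (simp add: split_torsor_def inv_twist)
  \<comment> \<open>The twisted action stays in L: in N the product becomes n 1 n^-1.\<close>
  have Lact_in: "Mul (Mid X) K (\<sigma> K n) (Mul (Mid X) K m (mid.Inv K (\<sigma>\<^sub>0 K n))) \<in> Sec (Ker X) K"
    if "topological_manifold K" "n \<in> Sec (Quot X) K" "m \<in> Sec (Ker X) K" for K n m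
    using that by (simp add: ker_Sec)
  have b: "is_bobj (Quot X) ?T"
    unfolding is_bobj_def
  proof (intro conjI)
    show "is_sheaf ?T"
      by (rule is_sheaf_inj_image[OF ker_sheaf emb]) (simp_all add: ker_Res)
  qed (auto simp: left_action_def Lact_in ker_in)
  have pV: "is_presheaf (final_bobj :: ('n, unit) bobj)"
    unfolding final_bobj_eq by (rule bobj_presheaf[OF is_bobj_one_point])
  have mor: "bobj_mor (Quot X) ?T final_bobj (Proj ?T)"
    by (auto simp: bobj_mor_def sheaf_mor_def final_bobj_eq)
  have tors: "is_torsor (Quot X) ?A (obj_Aut_conj X s) final_bobj ?T"
  proof (rule is_torsorI[OF b mor sheaf_epiI[OF mor[unfolded bobj_mor_def, THEN conjunct1] pV]])
    fix N :: space and y :: unit assume "topological_manifold N"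
    then show "\<exists>x\<in>Sec ?T N. Proj ?T N x = y"
      by (intro bexI[of _ "emb (One (Mid X) N)"]) simp_all
  next
    fix K x assume K: "topological_manifold K" and "x \<in> Sec ?T K"
    then obtain m where x: "x = emb m" "m \<in> Sec (Ker X) K" by auto
    show "Ract ?T K x (One ?A K) = x"
      using K x by (simp add: twist_One ker_in)
    fix a assume "a \<in> Sec ?A K"
    then obtain l where l: "l \<in> Sec (Ker X) K" "a = twist K l" by (rule Aut_cases[OF K])
    show "Ract ?T K x a \<in> Sec ?T K" "Proj ?T K (Ract ?T K x a) = Proj ?T K x"
      using K x l by simp_all
    show "Ract ?T K x (Mul ?A K a b) = Ract ?T K (Ract ?T K x a) b" if "b \<in> Sec ?A K" for b
    proof -
      obtain l' where "l' \<in> Sec (Ker X) K" "b = twist K l'" using Aut_cases[OF K \<open>b \<in> Sec ?A K\<close>] .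
      then show ?thesis using K x l by (simp add: twist_Mul ker_in)
    qed
    \<comment> \<open>Inserting \<open>\<sigma>\<^sub>0(n)^-1 \<sigma>\<^sub>0(n)\<close> between m
      and l splits the translate of m l into the translate of m and the conjugate of l.\<close>
    show "Lact ?T K n (Ract ?T K x a) = Ract ?T K (Lact ?T K n x) (obj_Aut_conj X s K n a)"
      if "n \<in> Sec (Quot X) K" for n
      using K x l that by (simp add: twist_conj ker_in)
    show "Res ?T J K f (Ract ?T K x a) = Ract ?T J (Res ?T J K f x) (Res ?A J K f a)"
      if "topological_manifold J" "f \<in> man_hom J K" for J f
      using K x l that by (simp add: twist_Res ker_in)
  next
    fix K x y assume K: "topological_manifold K" and "x \<in> Sec ?T K"
    then obtain m where x: "x = emb m" "m \<in> Sec (Ker X) K" by auto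
    assume "y \<in> Sec ?T K"
    then obtain m' where y: "y = emb m'" "m' \<in> Sec (Ker X) K" by auto
    let ?l = "Mul (Mid X) K (mid.Inv K m) m'"
    show "\<exists>!a. a \<in> Sec ?A K \<and> y = Ract ?T K x a"
    proof (rule ex1I[of _ "twist K ?l"])
      show "twist K ?l \<in> Sec ?A K \<and> y = Ract ?T K x (twist K ?l)"
        using K x y by (auto intro!: twist_in_Aut simp: ker_in)
      fix a assume a: "a \<in> Sec ?A K \<and> y = Ract ?T K x a"
      then obtain l where l: "a = twist K l" "l \<in> Sec (Ker X) K"
        unfolding Aut_eq_twist[OF K] by auto
      with a x y K have "m' = Mul (Mid X) K m l" by simp
      with l x K show "a = twist K ?l" by (simp add: ker_in)
    qed
  qed
  have "const_sec ?T K (emb (One (Mid X) point_space)) = emb (One (Mid X) K)"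
    if "topological_manifold K" for K
    using that by (simp add: const_sec_def)
  then have "\<forall>K. topological_manifold K \<longrightarrow> (\<forall>n\<in>Sec (Quot X) K.
      Lact ?T K n (const_sec ?T K (emb (One (Mid X) point_space))) =
      tract ?T K (const_sec ?T K (emb (One (Mid X) point_space)))
        (Mul (Mid X) K (\<sigma> K n) (mid.Inv K (\<sigma>\<^sub>0 K n))))"
    using \<sigma> by simp
  then show ?thesis
    unfolding associated_def H1_torsors_def using tors \<sigma>
    by (intro conjI bexI[of _ "emb (One (Mid X) point_space)"]) simp_all
qed

text \<open>With points x of S and y of T chosen, an isomorphism is determined by the l in L with
  u(x) = y l. Compatibility with n at x reads \<open>l \<sigma>(n) \<sigma>\<^sub>0(n)^-1 =
  \<tau>(n) l \<sigma>\<^sub>0(n)^-1\<close>, and cancelling the common right factor leaves the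
  conjugacy relation.\<close>

lemma associated_iso_iff:
  assumes S: "associated S \<sigma>" and T: "associated T \<tau>"
  shows "(\<exists>u. torsor_iso (Quot X) (obj_Aut_sheaf X s) S T u) \<longleftrightarrow> conjugate \<sigma> \<tau>"
proof -
  have S1: "S \<in> H1_torsors X s" and T1: "T \<in> H1_torsors X s"
    and \<sigma>: "splitting \<sigma>" and \<tau>: "splitting \<tau>"
    using S T by (simp_all add: associated_def)
  note [simp] = splittingD[OF \<sigma>] splittingD[OF \<tau>]
  note bS = H1_torsor_bobj[OF S1] and bT = H1_torsor_bobj[OF T1]
  note pS = bobj_presheaf[OF bS] and pT = bobj_presheaf[OF bT]
  obtain x where x: "x \<in> Sec S point_space" and Lx: "\<And>K n. \<lbrakk>topological_manifold K; n \<in> Sec (Quot X) K\<rbrakk> \<Longrightarrow>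
      Lact S K n (const_sec S K x) =
          tract S K (const_sec S K x) (Mul (Mid X) K (\<sigma> K n) (mid.Inv K (\<sigma>\<^sub>0 K n)))"
    using S unfolding associated_def by blast
  obtain y where y: "y \<in> Sec T point_space" and Ly: "\<And>K n. \<lbrakk>topological_manifold K; n \<in> Sec (Quot X) K\<rbrakk> \<Longrightarrow>
      Lact T K n (const_sec T K y) =
          tract T K (const_sec T K y) (Mul (Mid X) K (\<tau> K n) (mid.Inv K (\<sigma>\<^sub>0 K n)))"
    using T unfolding associated_def by blast
  let ?x = "\<lambda>K. const_sec S K x" and ?y = "\<lambda>K. const_sec T K y"
  note x_in = const_sec_in[OF pS _ x] and y_in = const_sec_in[OF pT _ y]
  \<comment> \<open>The factor contributed by n y ends in \<open>\<sigma>\<^sub>0(n)^-1\<close> and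
    the conjugate of l begins with \<open>\<sigma>\<^sub>0(n)\<close>, so they cancel.\<close>
  have conj_l: "Lact T K n (tract T K (?y K) l) =
      tract T K (?y K) (Mul (Mid X) K (\<tau> K n) (Mul (Mid X) K l (mid.Inv K (\<sigma>\<^sub>0 K n))))"
    if K: "topological_manifold K" and n: "n \<in> Sec (Quot X) K" and l: "l \<in> Sec (Ker X) K" for K n l
  proof -
    let ?d = "Mul (Mid X) K (\<tau> K n) (mid.Inv K (\<sigma>\<^sub>0 K n))"
    let ?k = "Mul (Mid X) K (\<sigma>\<^sub>0 K n) (Mul (Mid X) K l (mid.Inv K (\<sigma>\<^sub>0 K n)))"
    have dk: "?d \<in> Sec (Ker X) K" "?k \<in> Sec (Ker X) K" using K n l \<tau> by simp_all
    have "Lact T K n (tract T K (?y K) l) = tract T K (tract T K (?y K) ?d) ?k"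
      by (simp only: tract_Lact[OF T1 K n y_in[OF K] l] Ly[OF K n])
    also have "\<dots> = tract T K (?y K) (Mul (Mid X) K ?d ?k)"
      by (rule tract_Mul[OF T1 K y_in[OF K] dk, symmetric])
    finally show ?thesis using K n ker_in[OF K l] by simp
  qed
  show ?thesis
  proof
    assume "\<exists>u. torsor_iso (Quot X) (obj_Aut_sheaf X s) S T u"
    then obtain u where u: "torsor_iso (Quot X) (obj_Aut_sheaf X s) S T u" by blast
    then have bm: "bobj_mor (Quot X) S T u" and sm: "sheaf_mor S T u"
      by (simp_all add: torsor_iso_def bobj_mor_def)
    obtain l where l: "l \<in> Sec (Ker X) point_space" "u point_space x = tract T point_space y l"
      using tract_ex1[OF T1 manifold_point_space y sheaf_mor_in[OF sm manifold_point_space x]] by blast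
    have "Mul (Mid X) K (const_sec (Mid X) K l) (\<sigma> K n) = Mul (Mid X) K (\<tau> K n) (const_sec (Mid X) K l)"
      if K: "topological_manifold K" and n: "n \<in> Sec (Quot X) K" for K n
    proof -
      let ?l = "const_sec (Mid X) K l" and ?i = "mid.Inv K (\<sigma>\<^sub>0 K n)"
      have lK: "?l \<in> Sec (Ker X) K" by (rule ker_const[OF K l(1)])
      have d: "Mul (Mid X) K (\<sigma> K n) ?i \<in> Sec (Ker X) K" using K n \<sigma> by simp
      have ux: "u K (?x K) = tract T K (?y K) ?l"
        using sheaf_mor_const_sec[OF sm K x] tract_Res[OF T1 K manifold_point_space to_point_hom y l(1)]
        by (simp add: l(2) const_sec_def)
      \<comment> \<open>The translate of u(x) by n is evaluated in two ways, as u(n x) and by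
        \<open>conj_l\<close>; the coordinates relative to y must then agree.\<close>
      have "tract T K (?y K) (Mul (Mid X) K ?l (Mul (Mid X) K (\<sigma> K n) ?i)) =
          tract T K (u K (?x K)) (Mul (Mid X) K (\<sigma> K n) ?i)"
        by (simp only: ux tract_Mul[OF T1 K y_in[OF K] lK d])
      also have "\<dots> = u K (tract S K (?x K) (Mul (Mid X) K (\<sigma> K n) ?i))"
        using u K x_in[OF K] twist_in_Aut[OF K d] unfolding torsor_iso_def by simp
      also have "\<dots> = Lact T K n (u K (?x K))"
        using bm K n x_in[OF K] by (simp add: bobj_mor_def flip: Lx)
      also have "\<dots> = tract T K (?y K) (Mul (Mid X) K (\<tau> K n) (Mul (Mid X) K ?l ?i))"
        unfolding ux by (rule conj_l[OF K n lK])
      finally have "Mul (Mid X) K ?l (Mul (Mid X) K (\<sigma> K n) ?i) =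
          Mul (Mid X) K (\<tau> K n) (Mul (Mid X) K ?l ?i)"
        by (rule tract_inj[OF T1 K y_in[OF K], rotated 2])
          (use K n ker_in[OF K lK] ker_pr[OF K lK] in \<open>simp_all add: ker_Sec\<close>)
      then have "Mul (Mid X) K (Mul (Mid X) K ?l (\<sigma> K n)) ?i = Mul (Mid X) K (Mul (Mid X) K (\<tau> K n) ?l) ?i"
        using K n ker_in[OF K lK] by simp
      then show ?thesis
        by (rule mid.Mul_cancel_right[THEN iffD1, rotated -1]) (use K n ker_in[OF K lK] in simp_all)
    qed
    with l(1) show "conjugate \<sigma> \<tau>" unfolding conjugate_def by blast
  next
    assume "conjugate \<sigma> \<tau>"
    then obtain l where l: "l \<in> Sec (Ker X) point_space" and conj: "\<And>K n. \<lbrakk>topological_manifold K;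
        n \<in> Sec (Quot X) K\<rbrakk> \<Longrightarrow> Mul (Mid X) K (const_sec (Mid X) K l) (\<sigma> K n) =
          Mul (Mid X) K (\<tau> K n) (const_sec (Mid X) K l)"
      unfolding conjugate_def by blast
    let ?l = "\<lambda>K. const_sec (Mid X) K l"
    note lK = ker_const[OF _ l]
    define c where "c K z = (THE k. k \<in> Sec (Ker X) K \<and> z = tract S K (?x K) k)" for K z
    \<comment> \<open>The only candidate compatible with the right action and with x \<mapsto> y l:
      it sends x k to y l k.\<close>
    define u where "u K z = tract T K (?y K) (Mul (Mid X) K (?l K) (c K z))" for K z
    have c: "c K z \<in> Sec (Ker X) K" "z = tract S K (?x K) (c K z)"
      if "topological_manifold K" "z \<in> Sec S K" for K z
      using theI'[OF tract_ex1[OF S1 that(1) x_in[OF that(1)] that(2)]] by (simp_all add: c_def)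
    have u: "u K (tract S K (?x K) k) = tract T K (?y K) (Mul (Mid X) K (?l K) k)"
      if K: "topological_manifold K" and k: "k \<in> Sec (Ker X) K" for K k
    proof -
      note z = tract_in[OF S1 K x_in[OF K] k]
      have "c K (tract S K (?x K) k) = k"
        by (rule tract_inj[OF S1 K x_in[OF K] c(1)[OF K z] k c(2)[OF K z, symmetric]])
      then show ?thesis by (simp add: u_def)
    qed
    have u_in: "u K z \<in> Sec T K" if "topological_manifold K" "z \<in> Sec S K" for K z
      unfolding u_def using that c(1)[OF that] lK[OF that(1)]
      by (intro tract_in[OF T1 _ y_in]) auto
    have "torsor_iso (Quot X) (obj_Aut_sheaf X s) S T u"
      unfolding torsor_iso_def bobj_mor_def sheaf_mor_def
    proof (intro conjI allI impI ballI, goal_cases)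
      case (1 K) with u_in show ?case by blast
    next
      case (2 J K f z)
      then have JK: "topological_manifold J" "topological_manifold K" "f \<in> man_hom J K" by auto
      note k = c[OF JK(2) 2(2)]
      have "Res S J K f z = tract S J (?x J) (Res (Mid X) J K f (c K z))"
        by (subst k(2)) (simp only: tract_Res[OF S1 JK x_in[OF JK(2)] k(1)] Res_const_sec[OF pS JK x])
      moreover have "Res T J K f (u K z) = tract T J (?y J) (Mul (Mid X) J (?l J) (Res (Mid X) J K f (c K z)))"
        unfolding u_def using tract_Res[OF T1 JK y_in[OF JK(2)], of "Mul (Mid X) K (?l K) (c K z)"]
          JK k(1) lK[OF JK(2)] Res_const_sec[OF pT JK y] Res_const_sec[OF mid.presheaf JK ker_in[OF _ l]]
        by (simp add: ker_in)
      ultimately show ?case using u[OF JK(1), of "Res (Mid X) J K f (c K z)"] JK k(1) by simp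
    next
      case (3 K n z)
      note K = 3(1) and n = 3(2) and k = c[OF 3(1) 3(3)]
      let ?i = "mid.Inv K (\<sigma>\<^sub>0 K n)"
      have d: "Mul (Mid X) K (\<sigma> K n) ?i \<in> Sec (Ker X) K" using K n \<sigma> by simp
      let ?k = "Mul (Mid X) K (\<sigma>\<^sub>0 K n) (Mul (Mid X) K (c K z) ?i)"
      have kk: "?k \<in> Sec (Ker X) K" using K n k(1) by simp
      have "Lact S K n z = tract S K (tract S K (?x K) (Mul (Mid X) K (\<sigma> K n) ?i)) ?k"
        by (subst k(2)) (simp only: tract_Lact[OF S1 K n x_in[OF K] k(1)] Lx[OF K n])
      also have "\<dots> = tract S K (?x K) (Mul (Mid X) K (Mul (Mid X) K (\<sigma> K n) ?i) ?k)"
        by (rule tract_Mul[OF S1 K x_in[OF K] d kk, symmetric])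
      finally have "u K (Lact S K n z) = tract T K (?y K)
          (Mul (Mid X) K (?l K) (Mul (Mid X) K (Mul (Mid X) K (\<sigma> K n) ?i) ?k))"
        using u[OF K ker_Mul[OF K d kk]] by simp
      also have "Mul (Mid X) K (?l K) (Mul (Mid X) K (Mul (Mid X) K (\<sigma> K n) ?i) ?k) =
          Mul (Mid X) K (Mul (Mid X) K (?l K) (\<sigma> K n)) (Mul (Mid X) K (c K z) ?i)"
        using K n ker_in[OF K k(1)] ker_in[OF K lK[OF K]] by simp
      also have "\<dots> = Mul (Mid X) K (\<tau> K n) (Mul (Mid X) K (Mul (Mid X) K (?l K) (c K z)) ?i)"
        unfolding conj[OF K n] using K n ker_in[OF K k(1)] ker_in[OF K lK[OF K]] by simp
      also have "tract T K (?y K) \<dots> = Lact T K n (u K z)"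
        unfolding u_def by (rule conj_l[OF K n ker_Mul[OF K lK[OF K] k(1)], symmetric])
      finally show ?case .
    next
      case (4 K)
      show ?case
        unfolding bij_betw_def
      proof (intro conjI equalityI subsetI inj_onI)
        fix z z' assume z: "z \<in> Sec S K" "z' \<in> Sec S K" "u K z = u K z'"
        note k = c[OF 4 z(1)] and k' = c[OF 4 z(2)]
        have "Mul (Mid X) K (?l K) (c K z) = Mul (Mid X) K (?l K) (c K z')"
          using z(3) unfolding u_def
          by (rule tract_inj[OF T1 4 y_in[OF 4] ker_Mul[OF 4 lK[OF 4] k(1)] ker_Mul[OF 4 lK[OF 4] k'(1)]])
        then have "c K z = c K z'"
          using 4 ker_in[OF 4 k(1)] ker_in[OF 4 k'(1)] ker_in[OF 4 lK[OF 4]] by simp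
        then show "z = z'" using k(2) k'(2) by simp
      next
        fix w assume "w \<in> u K ` Sec S K" then show "w \<in> Sec T K" using u_in[OF 4] by blast
      next
        fix w assume "w \<in> Sec T K"
        then obtain k where k: "k \<in> Sec (Ker X) K" "w = tract T K (?y K) k"
          using tract_ex1[OF T1 4 y_in[OF 4]] by blast
        let ?k = "Mul (Mid X) K (mid.Inv K (?l K)) k"
        have kk: "?k \<in> Sec (Ker X) K" using 4 k(1) lK[OF 4] by simp
        have "u K (tract S K (?x K) ?k) = w"
          unfolding u[OF 4 kk] using 4 k ker_in[OF 4 k(1)] ker_in[OF 4 lK[OF 4]] by simp
        then show "w \<in> u K ` Sec S K" using tract_in[OF S1 4 x_in[OF 4] kk] by blast
      qed
    next
      case (5 K z) show ?case by simp
    next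
      case (6 K z a)
      note K = 6(1) and k = c[OF 6(1) 6(2)]
      obtain m where m: "m \<in> Sec (Ker X) K" "a = twist K m"
        using 6(3) unfolding Aut_eq_twist[OF K] by blast
      have "tract S K z m = tract S K (?x K) (Mul (Mid X) K (c K z) m)"
        using k(2) tract_Mul[OF S1 K x_in[OF K] k(1) m(1)] by simp
      then have "u K (tract S K z m) = tract T K (?y K) (Mul (Mid X) K (?l K) (Mul (Mid X) K (c K z) m))"
        using u[OF K ker_Mul[OF K k(1) m(1)]] by simp
      also have "\<dots> = tract T K (u K z) m"
        unfolding u_def using tract_Mul[OF T1 K y_in[OF K] ker_Mul[OF K lK[OF K] k(1)] m(1)]
          K ker_in[OF K k(1)] ker_in[OF K m(1)] ker_in[OF K lK[OF K]] by simp
      finally show ?case by (simp add: m(2))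
    qed
    then show "\<exists>u. torsor_iso (Quot X) (obj_Aut_sheaf X s) S T u" by blast
  qed
qed

end

section \<open>The extension of an equivariant bundle\<close>

locale bundle_action =
  fixes G :: "'g topgroup" and H :: "'h topgroup" and P :: "('h, 'm, 'p) fibre_bundle"
    and act :: "'g \<Rightarrow> 'm \<Rightarrow> 'm"
  assumes G: "topological_group G" and H: "topological_group H"
    and act: "continuous_left_action G (Basis P) act"
    and eff: "effective_action G (topspace (Basis P)) act"
    and P: "principal_bundle H P"
begin

abbreviation E :: "'p set" where "E \<equiv> topspace (Total P)"
abbreviation Aut :: "('p \<Rightarrow> 'p) set" where "Aut \<equiv> Aut_G G H P act"
abbreviation over :: "('p \<Rightarrow> 'p) \<Rightarrow> 'g" where "over \<equiv> Aut_G_to_G G P act"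

sublocale G: group G
  using G by (simp add: topological_group_def)

sublocale H: group H
  using H by (simp add: topological_group_def)

lemma topspace_G [simp]: "topspace (topo G) = carrier G"
  and topspace_H [simp]: "topspace (topo H) = carrier H"
  using G H by (simp_all add: topological_group_def)

lemma act_in [simp]: "g \<in> carrier G \<Longrightarrow> y \<in> topspace (Basis P) \<Longrightarrow> act g y \<in> topspace (Basis P)"
  and act_one [simp]: "y \<in> topspace (Basis P) \<Longrightarrow> act \<one>\<^bsub>G\<^esub> y = y"
  and act_mult: "g \<in> carrier G \<Longrightarrow> h \<in> carrier G \<Longrightarrow> y \<in> topspace (Basis P) \<Longrightarrow>
    act (g \<otimes>\<^bsub>G\<^esub> h) y = act g (act h y)"
  using act by (simp_all add: continuous_left_action_def left_action_def)

lemma proj_in [simp]: "x \<in> E \<Longrightarrow> proj P x \<in> topspace (Basis P)"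
  using P unfolding principal_bundle_def continuous_map_def by blast

lemma ract_in [simp]: "x \<in> E \<Longrightarrow> h \<in> carrier H \<Longrightarrow> ract P x h \<in> E"
proof -
  assume "x \<in> E" "h \<in> carrier H"
  moreover have "continuous_map (prod_topology (Total P) (topo H)) (Total P) (\<lambda>(x, h). ract P x h)"
    using P by (simp add: principal_bundle_def)
  ultimately show ?thesis
    using continuous_map_funspace[of "prod_topology (Total P) (topo H)" "Total P" "\<lambda>(x, h). ract P x h"]
    by (auto simp: Pi_iff)
qed

lemma proj_onto:
  assumes y: "y \<in> topspace (Basis P)"
  obtains x where "x \<in> E" "proj P x = y"
proof -
  obtain U t where U: "openin (Basis P) U" "y \<in> U"
    and t: "homeomorphic_map (prod_topology (subtopology (Basis P) U) (topo H))
          (subtopology (Total P) {x \<in> E. proj P x \<in> U}) t"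
    and pt: "\<forall>u\<in>U. \<forall>h\<in>carrier H. proj P (t (u, h)) = u"
    using P y unfolding principal_bundle_def by meson
  have "(y, \<one>\<^bsub>H\<^esub>) \<in> topspace (prod_topology (subtopology (Basis P) U) (topo H))"
    using U y by simp
  then have "t (y, \<one>\<^bsub>H\<^esub>) \<in> topspace (subtopology (Total P) {x \<in> E. proj P x \<in> U})"
    using homeomorphic_imp_surjective_map[OF t] by blast
  with pt U(2) show thesis by (intro that[of "t (y, \<one>\<^bsub>H\<^esub>)"]) auto
qed

text \<open>Every point of M is hit by the projection, so the two group elements act alike on all of
  M, and effectiveness identifies them. This is what gives \<open>Aut_G_to_G\<close> a
  meaning.\<close>

lemma lies_over_unique:
  assumes "lies_over P (act g) a" "lies_over P (act h) a" "g \<in> carrier G" "h \<in> carrier G"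
  shows "g = h"
proof -
  have "act (inv\<^bsub>G\<^esub> g \<otimes>\<^bsub>G\<^esub> h) y = y" if y: "y \<in> topspace (Basis P)" for y
  proof -
    obtain x where x: "x \<in> E" "proj P x = y" by (rule proj_onto[OF y])
    then have "act g y = act h y" using assms(1,2) by (auto simp: lies_over_def)
    then have "act (inv\<^bsub>G\<^esub> g \<otimes>\<^bsub>G\<^esub> h) y = act (inv\<^bsub>G\<^esub> g \<otimes>\<^bsub>G\<^esub> g) y"
      using assms(3,4) y by (simp only: act_mult G.inv_closed)
    then show ?thesis using assms(3) y by simp
  qed
  then have "inv\<^bsub>G\<^esub> g \<otimes>\<^bsub>G\<^esub> h = \<one>\<^bsub>G\<^esub>" using eff assms(3,4) by (simp add: effective_action_def)
  then show ?thesis using assms(3,4) G.inv_solve_left' by force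
qed

lemma over_eqI:
  assumes "g \<in> carrier G" "lies_over P (act g) a"
  shows "over a = g"
  unfolding Aut_G_to_G_def using assms lies_over_unique by (intro the_equality) auto

lemma AutD:
  assumes "a \<in> Aut"
  shows over_in [simp]: "over a \<in> carrier G" and lies_over_over: "lies_over P (act (over a)) a"
    and Aut_extensional: "a \<in> extensional E"
    and Aut_homeomorphic: "homeomorphic_map (Total P) (Total P) a"
    and Aut_ract: "\<And>x h. x \<in> E \<Longrightarrow> h \<in> carrier H \<Longrightarrow> a (ract P x h) = ract P (a x) h"
    and Aut_bij: "bij_betw a E E" and Aut_in: "\<And>x. x \<in> E \<Longrightarrow> a x \<in> E"
    and proj_Aut: "\<And>x. x \<in> E \<Longrightarrow> proj P (a x) = act (over a) (proj P x)"
proof -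
  obtain g where g: "g \<in> carrier G" "lies_over P (act g) a"
    using assms by (auto simp: Aut_G_def)
  with over_eqI[OF this] show "over a \<in> carrier G" "lies_over P (act (over a)) a" by simp_all
  then show "\<And>x. x \<in> E \<Longrightarrow> proj P (a x) = act (over a) (proj P x)"
    by (simp add: lies_over_def)
  show h: "homeomorphic_map (Total P) (Total P) a" and "a \<in> extensional E"
    and "\<And>x h. x \<in> E \<Longrightarrow> h \<in> carrier H \<Longrightarrow> a (ract P x h) = ract P (a x) h"
    using assms by (simp_all add: Aut_G_def bundle_automorphisms_def)
  show b: "bij_betw a E E"
    using h homeomorphic_eq_everything_map[of "Total P" "Total P" a] by (simp add: bij_betw_def)
  show "\<And>x. x \<in> E \<Longrightarrow> a x \<in> E" using b by (rule bij_betw_apply)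
qed

lemma AutI:
  assumes "a \<in> extensional E" "homeomorphic_map (Total P) (Total P) a"
    and "\<And>x h. x \<in> E \<Longrightarrow> h \<in> carrier H \<Longrightarrow> a (ract P x h) = ract P (a x) h"
    and "g \<in> carrier G" and "\<And>x. x \<in> E \<Longrightarrow> proj P (a x) = act g (proj P x)"
  shows "a \<in> Aut" and "over a = g"
proof -
  have l: "lies_over P (act g) a" using assms(5) by (simp add: lies_over_def)
  then show "a \<in> Aut" using assms(1-4) by (auto simp: Aut_G_def bundle_automorphisms_def)
  show "over a = g" by (rule over_eqI[OF assms(4) l])
qed

lemma gauge_iff: "a \<in> gauge_transformations H P \<longleftrightarrow> a \<in> Aut \<and> over a = \<one>\<^bsub>G\<^esub>"
proof
  assume a: "a \<in> gauge_transformations H P"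
  then have "lies_over P (act \<one>\<^bsub>G\<^esub>) a"
    by (auto simp: gauge_transformations_def lies_over_def)
  with a show "a \<in> Aut \<and> over a = \<one>\<^bsub>G\<^esub>"
    using over_eqI[OF G.one_closed] by (auto simp: gauge_transformations_def Aut_G_def)
next
  assume a: "a \<in> Aut \<and> over a = \<one>\<^bsub>G\<^esub>"
  then have "lies_over P (\<lambda>y. y) a" using proj_Aut[of a] by (auto simp: lies_over_def)
  with a show "a \<in> gauge_transformations H P"
    by (auto simp: gauge_transformations_def Aut_G_def)
qed

definition inverse_map :: "('p \<Rightarrow> 'p) \<Rightarrow> 'p \<Rightarrow> 'p" where
  "inverse_map a = restrict (inv_into E a) E"

lemma inverse_map_left: "a \<in> Aut \<Longrightarrow> x \<in> E \<Longrightarrow> inverse_map a (a x) = x"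
  and inverse_map_right: "a \<in> Aut \<Longrightarrow> x \<in> E \<Longrightarrow> a (inverse_map a x) = x"
  and inverse_map_in: "a \<in> Aut \<Longrightarrow> x \<in> E \<Longrightarrow> inverse_map a x \<in> E"
  using Aut_bij[of a] Aut_in[of a x]
  by (simp_all add: inverse_map_def bij_betw_inv_into_left bij_betw_inv_into_right
      bij_betw_def inv_into_into)

lemma homeomorphic_inverse_map:
  assumes a: "a \<in> Aut"
  shows "homeomorphic_maps (Total P) (Total P) a (inverse_map a)"
proof -
  obtain c where c: "homeomorphic_maps (Total P) (Total P) a c"
    using Aut_homeomorphic[OF a] homeomorphic_map_maps by blast
  have "c x = inverse_map a x" if "x \<in> E" for x
    using c that inverse_map_right[OF a that] inverse_map_in[OF a that]
    unfolding homeomorphic_maps_def by metis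
  then show ?thesis using c by (auto intro: homeomorphic_maps_eq[OF c])
qed

lemma inverse_map_Aut:
  assumes a: "a \<in> Aut"
  shows "inverse_map a \<in> Aut" and "over (inverse_map a) = inv\<^bsub>G\<^esub> (over a)"
proof -
  have 1: "inverse_map a \<in> extensional E" by (simp add: inverse_map_def)
  have 2: "homeomorphic_map (Total P) (Total P) (inverse_map a)"
    using homeomorphic_inverse_map[OF a] homeomorphic_maps_map by blast
  have 3: "inverse_map a (ract P x h) = ract P (inverse_map a x) h" if "x \<in> E" "h \<in> carrier H" for x h
    using Aut_ract[OF a inverse_map_in[OF a that(1)] that(2)] inverse_map_right[OF a that(1)]
      inverse_map_left[OF a ract_in[OF inverse_map_in[OF a that(1)] that(2)]] by simp
  have 4: "proj P (inverse_map a x) = act (inv\<^bsub>G\<^esub> (over a)) (proj P x)" if x: "x \<in> E" for x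
  proof -
    have "proj P x = act (over a) (proj P (inverse_map a x))"
      using proj_Aut[OF a inverse_map_in[OF a x]] inverse_map_right[OF a x] by simp
    then have "act (inv\<^bsub>G\<^esub> (over a)) (proj P x) = act (inv\<^bsub>G\<^esub> (over a) \<otimes>\<^bsub>G\<^esub> over a) (proj P (inverse_map a x))"
      using over_in[OF a] inverse_map_in[OF a x] by (simp only: act_mult proj_in G.inv_closed)
    then show ?thesis using over_in[OF a] inverse_map_in[OF a x] by simp
  qed
  show "inverse_map a \<in> Aut" "over (inverse_map a) = inv\<^bsub>G\<^esub> (over a)"
    using AutI[OF 1 2 3 _ 4] over_in[OF a] by simp_all
qed

lemma compose_Aut:
  assumes a: "a \<in> Aut" and b: "b \<in> Aut"
  shows "compose E a b \<in> Aut" and "over (compose E a b) = over a \<otimes>\<^bsub>G\<^esub> over b"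
proof -
  have 2: "homeomorphic_map (Total P) (Total P) (compose E a b)"
    by (rule homeomorphic_map_eq[OF homeomorphic_map_compose[OF Aut_homeomorphic[OF b] Aut_homeomorphic[OF a]]])
      (simp add: compose_def)
  have 3: "compose E a b (ract P x h) = ract P (compose E a b x) h" if "x \<in> E" "h \<in> carrier H" for x h
    using that Aut_in[OF b] by (simp add: compose_def Aut_ract[OF a] Aut_ract[OF b])
  have 4: "proj P (compose E a b x) = act (over a \<otimes>\<^bsub>G\<^esub> over b) (proj P x)" if "x \<in> E" for x
    using that Aut_in[OF b] over_in[OF a] over_in[OF b]
    by (simp add: compose_def act_mult proj_Aut[OF a] proj_Aut[OF b])
  show "compose E a b \<in> Aut" "over (compose E a b) = over a \<otimes>\<^bsub>G\<^esub> over b"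
    using AutI[OF compose_extensional 2 3 _ 4] over_in[OF a] over_in[OF b] by simp_all
qed

lemma id_Aut: "(\<lambda>x\<in>E. x) \<in> Aut" and over_id: "over (\<lambda>x\<in>E. x) = \<one>\<^bsub>G\<^esub>"
proof -
  have "homeomorphic_map (Total P) (Total P) (\<lambda>x\<in>E. x)"
    by (rule homeomorphic_map_eq[OF iffD2[OF homeomorphic_map_id]]) auto
  then show "(\<lambda>x\<in>E. x) \<in> Aut" "over (\<lambda>x\<in>E. x) = \<one>\<^bsub>G\<^esub>"
    using AutI[of "\<lambda>x\<in>E. x" "\<one>\<^bsub>G\<^esub>"] by simp_all
qed

section \<open>Continuous families of automorphisms\<close>

definition cont_family :: "space \<Rightarrow> ((nat \<Rightarrow> real) \<Rightarrow> 'p \<Rightarrow> 'p) \<Rightarrow> bool" where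
  "cont_family N A \<longleftrightarrow> continuous_map (prod_topology N (Total P)) (Total P) (\<lambda>(n, x). A n x)"

lemma cont_family_cong:
  "(\<And>n x. n \<in> topspace N \<Longrightarrow> x \<in> E \<Longrightarrow> A n x = B n x) \<Longrightarrow> cont_family N A \<longleftrightarrow> cont_family N B"
  unfolding cont_family_def by (auto intro: continuous_map_eq)

lemma cont_family_pair:
  assumes "cont_family N A"
  shows "continuous_map (prod_topology N (Total P)) (prod_topology N (Total P)) (\<lambda>(n, x). (n, A n x))"
  using assms by (simp add: cont_family_def continuous_map_pairwise o_def case_prod_unfold
      continuous_map_fst)

lemma cont_family_compose:
  assumes "cont_family N A" "cont_family N B"
  shows "cont_family N (\<lambda>n x. A n (B n x))"
  using continuous_map_compose[OF cont_family_pair[OF assms(2)] assms(1)[unfolded cont_family_def]]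
  by (simp add: cont_family_def o_def case_prod_unfold)

lemma cont_family_pull:
  assumes "cont_family N A" "continuous_map K N f"
  shows "cont_family K (\<lambda>k. A (f k))"
proof -
  have "continuous_map (prod_topology K (Total P)) (prod_topology N (Total P)) (\<lambda>(k, x). (f k, x))"
    using assms(2) by (auto simp: continuous_map_prod_top)
  from continuous_map_compose[OF this assms(1)[unfolded cont_family_def]]
  show ?thesis by (simp add: cont_family_def o_def case_prod_unfold)
qed

lemma cont_family_glue:
  assumes "man_covering R N" "\<And>K f. (K, f) \<in> R \<Longrightarrow> cont_family K (\<lambda>k. A (f k))"
  shows "cont_family N A"
  using assms unfolding cont_family_def by (rule continuous_map_of_covering)

lemma cont_family_const:
  assumes "continuous_map (Total P) (Total P) a"
  shows "cont_family N (\<lambda>_. a)"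
  using continuous_map_compose[OF continuous_map_snd assms, of N]
  by (simp add: cont_family_def o_def case_prod_unfold)

text \<open>The inverse of (n, x) \<mapsto> (n, a_n(x)) can only be fibrewise inversion. The
  homeomorphism condition thus splits into joint continuity of a and of its inverses, two conditions
  that can be composed, pulled back and glued separately.\<close>

lemma continuous_family_iff:
  assumes a: "\<And>n. n \<in> topspace N \<Longrightarrow> a n \<in> Aut"
  shows "continuous_family P N a \<longleftrightarrow> cont_family N a \<and> cont_family N (\<lambda>n. inverse_map (a n))"
proof
  let ?Z = "prod_topology N (Total P)"
  assume "continuous_family P N a"
  then obtain c where c: "homeomorphic_maps ?Z ?Z (\<lambda>(n, x). (n, a n x)) c"
    unfolding continuous_family_def homeomorphic_map_maps by blast
  then have "continuous_map ?Z ?Z (\<lambda>(n, x). (n, a n x))" "continuous_map ?Z ?Z c"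
    by (simp_all add: homeomorphic_maps_def)
  from this[THEN continuous_map_compose[OF _ continuous_map_snd]]
  have "continuous_map ?Z (Total P) (snd \<circ> (\<lambda>(n, x). (n, a n x)))"
    and cc: "continuous_map ?Z (Total P) (snd \<circ> c)" .
  then have "cont_family N a" by (simp add: cont_family_def o_def case_prod_unfold)
  moreover have "c (n, x) = (n, inverse_map (a n) x)" if n: "n \<in> topspace N" and x: "x \<in> E" for n x
  proof -
    have "c (n, a n (inverse_map (a n) x)) = (n, inverse_map (a n) x)"
      using c n inverse_map_in[OF a[OF n] x] unfolding homeomorphic_maps_def by auto
    then show ?thesis using inverse_map_right[OF a[OF n] x] by simp
  qed
  then have "cont_family N (\<lambda>n. inverse_map (a n))"
    unfolding cont_family_def by (intro continuous_map_eq[OF cc]) auto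
  ultimately show "cont_family N a \<and> cont_family N (\<lambda>n. inverse_map (a n))" ..
next
  let ?Z = "prod_topology N (Total P)"
  assume c: "cont_family N a \<and> cont_family N (\<lambda>n. inverse_map (a n))"
  have "homeomorphic_maps ?Z ?Z (\<lambda>(n, x). (n, a n x)) (\<lambda>(n, x). (n, inverse_map (a n) x))"
    unfolding homeomorphic_maps_def
    using cont_family_pair[of N a] cont_family_pair[of N "\<lambda>n. inverse_map (a n)"] c
    by (auto simp: inverse_map_left inverse_map_right a)
  then show "continuous_family P N a"
    unfolding continuous_family_def homeomorphic_map_maps by blast
qed

section \<open>The groups of the topos attached to the bundle form an extension\<close>

abbreviation X :: "((nat \<Rightarrow> real) \<Rightarrow> 'p \<Rightarrow> 'p, (nat \<Rightarrow> real) \<Rightarrow> 'g) extension" where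
  "X \<equiv> Aut_extension G H P act"

lemma extension_simps [simp]:
  "Ker X = gauge_sheaf H P" "Mid X = Aut_sheaf G H P act" "Quot X = topgroup_sheaf G"
  "Pr X = Aut_sheaf_to_G G P act"
  by (simp_all add: Aut_extension_def)

lemma Aut_Sec_iff:
  "a \<in> Sec (Aut_sheaf G H P act) N \<longleftrightarrow> a \<in> topspace N \<rightarrow>\<^sub>E Aut \<and> cont_family N a \<and>
     cont_family N (\<lambda>n. inverse_map (a n)) \<and> continuous_map N (topo G) (\<lambda>n. over (a n))"
  using continuous_family_iff[of N a] by (auto simp: Aut_sheaf_def)

lemma Aut_sheaf_simps [simp]:
  "Res (Aut_sheaf G H P act) K N f a = compose (topspace K) a f"
  "Mul (Aut_sheaf G H P act) N a b = (\<lambda>n\<in>topspace N. compose E (a n) (b n))"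
  "One (Aut_sheaf G H P act) N = (\<lambda>n\<in>topspace N. \<lambda>x\<in>E. x)"
  by (simp_all add: Aut_sheaf_def)

lemma topgroup_sheaf_simps [simp]:
  "Sec (topgroup_sheaf G) N = {g \<in> extensional (topspace N). continuous_map N (topo G) g}"
  "Res (topgroup_sheaf G) K N f g = compose (topspace K) g f"
  "Mul (topgroup_sheaf G) N g h = (\<lambda>n\<in>topspace N. g n \<otimes>\<^bsub>G\<^esub> h n)"
  "One (topgroup_sheaf G) N = (\<lambda>n\<in>topspace N. \<one>\<^bsub>G\<^esub>)"
  by (simp_all add: topgroup_sheaf_def)

lemma continuous_mult:
  assumes "continuous_map N (topo G) g" "continuous_map N (topo G) h"
  shows "continuous_map N (topo G) (\<lambda>n. g n \<otimes>\<^bsub>G\<^esub> h n)"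
proof -
  have "continuous_map (prod_topology (topo G) (topo G)) (topo G) (\<lambda>(g, h). g \<otimes>\<^bsub>G\<^esub> h)"
    using G by (simp add: topological_group_def)
  from continuous_map_compose[OF continuous_map_pairedI[OF assms] this] show ?thesis
    by (simp add: o_def)
qed

lemma continuous_inv:
  assumes "continuous_map N (topo G) g"
  shows "continuous_map N (topo G) (\<lambda>n. inv\<^bsub>G\<^esub> (g n))"
proof -
  have "continuous_map (topo G) (topo G) (\<lambda>g. inv\<^bsub>G\<^esub> g)"
    using G by (simp add: topological_group_def)
  from continuous_map_compose[OF assms this] show ?thesis by (simp add: o_def)
qed

lemma continuous_in_carrier: "continuous_map N (topo G) g \<Longrightarrow> n \<in> topspace N \<Longrightarrow> g n \<in> carrier G"
  using continuous_map_funspace[of N "topo G" g] by auto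

lemma continuous_map_restrict_topspace [simp]:
  "continuous_map N Y (restrict g (topspace N)) \<longleftrightarrow> continuous_map N Y g"
  by (auto intro: continuous_map_eq)

lemma continuous_map_compose_topspace:
  "f \<in> man_hom K N \<Longrightarrow> continuous_map N Y g \<Longrightarrow> continuous_map K Y (compose (topspace K) g f)"
  using continuous_map_compose[of K N f Y g] by (simp add: compose_def man_hom_continuous o_def)

lemma topgroup_group_sheaf: "is_group_sheaf (topgroup_sheaf G)"
  unfolding is_group_sheaf_def
proof (intro conjI allI impI)
  show "is_sheaf (topgroup_sheaf G)"
  proof (rule is_sheaf_functions[where A = UNIV and Q = "\<lambda>N g. continuous_map N (topo G) g"])
    fix K N f g assume "f \<in> man_hom K N" "continuous_map N (topo G) g"
    then show "continuous_map K (topo G) (compose (topspace K) g f)"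
      by (rule continuous_map_compose_topspace)
  next
    fix N R g assume R: "man_covering R N"
      and c: "\<And>K f. (K, f) \<in> R \<Longrightarrow> continuous_map K (topo G) (compose (topspace K) g f)"
    show "continuous_map N (topo G) g"
      by (rule continuous_map_of_covering_simple[OF R]) (use c in \<open>simp add: compose_def\<close>)
  qed (auto simp: PiE_def)
next
  fix K :: space
  show "group (sec_group (topgroup_sheaf G) K)"
  proof (rule groupI)
    fix g assume "g \<in> carrier (sec_group (topgroup_sheaf G) K)"
    then have g: "g \<in> extensional (topspace K)" "continuous_map K (topo G) g"
      by (simp_all add: sec_group_def)
    have "(\<lambda>n\<in>topspace K. inv\<^bsub>G\<^esub> (g n)) \<in> carrier (sec_group (topgroup_sheaf G) K)"
      using continuous_inv[OF g(2)] by (simp add: sec_group_def)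
    moreover have "(\<lambda>n\<in>topspace K. inv\<^bsub>G\<^esub> (g n)) \<otimes>\<^bsub>sec_group (topgroup_sheaf G) K\<^esub> g =
        \<one>\<^bsub>sec_group (topgroup_sheaf G) K\<^esub>"
      using continuous_in_carrier[OF g(2)] by (auto simp: sec_group_def fun_eq_iff)
    ultimately show "\<exists>y\<in>carrier (sec_group (topgroup_sheaf G) K).
        y \<otimes>\<^bsub>sec_group (topgroup_sheaf G) K\<^esub> g = \<one>\<^bsub>sec_group (topgroup_sheaf G) K\<^esub>" by blast
    show "\<one>\<^bsub>sec_group (topgroup_sheaf G) K\<^esub> \<otimes>\<^bsub>sec_group (topgroup_sheaf G) K\<^esub> g = g"
      using g continuous_in_carrier[OF g(2)]
      by (auto simp: sec_group_def fun_eq_iff extensional_def)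
  qed (auto simp: sec_group_def fun_eq_iff continuous_mult continuous_in_carrier G.m_assoc)
next
  fix K N :: space and f assume "topological_manifold K \<and> topological_manifold N \<and> f \<in> man_hom K N"
  then have f: "f \<in> man_hom K N" by simp
  show "Res (topgroup_sheaf G) K N f \<in> hom (sec_group (topgroup_sheaf G) N) (sec_group (topgroup_sheaf G) K)"
    using continuous_map_compose_topspace[OF f] man_hom_image[OF f]
    by (auto simp: hom_def sec_group_def compose_def fun_eq_iff)
qed

lemma Aut_Sec_pull:
  assumes "f \<in> man_hom K N" "a \<in> Sec (Aut_sheaf G H P act) N"
  shows "compose (topspace K) a f \<in> Sec (Aut_sheaf G H P act) K"
proof -
  note f = man_hom_continuous[OF assms(1)]
  have a: "a \<in> topspace N \<rightarrow>\<^sub>E Aut" "cont_family N a" "cont_family N (\<lambda>n. inverse_map (a n))"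
    "continuous_map N (topo G) (\<lambda>n. over (a n))"
    using assms(2) by (simp_all add: Aut_Sec_iff)
  have "cont_family K (compose (topspace K) a f)"
    using cont_family_pull[OF a(2) f] by (subst cont_family_cong) (auto simp: compose_def)
  moreover have "cont_family K (\<lambda>n. inverse_map (compose (topspace K) a f n))"
    using cont_family_pull[OF a(3) f] by (subst cont_family_cong) (auto simp: compose_def)
  moreover have "continuous_map K (topo G) (\<lambda>k. over (compose (topspace K) a f k))"
    by (rule continuous_map_eq[OF continuous_map_compose[OF f a(4)]]) (simp add: compose_def)
  ultimately show ?thesis
    using a(1) man_hom_image[OF assms(1)] by (auto simp: Aut_Sec_iff compose_def PiE_iff)
qed

text \<open>Sections are functions of n subject to joint continuity of the maps, of their inverses,
  and continuity of the induced map to G; each of the three is local for coverings.\<close>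

lemma Aut_is_sheaf: "is_sheaf (Aut_sheaf G H P act)"
proof (rule is_sheaf_functions[where A = Aut and Q = "\<lambda>N a. a \<in> Sec (Aut_sheaf G H P act) N"])
  fix N R a assume R: "man_covering R N" and a: "a \<in> topspace N \<rightarrow>\<^sub>E Aut"
    and loc: "\<And>K f. (K, f) \<in> R \<Longrightarrow> compose (topspace K) a f \<in> Sec (Aut_sheaf G H P act) K"
  have "cont_family K (\<lambda>k. a (f k)) \<and> cont_family K (\<lambda>k. inverse_map (a (f k))) \<and>
      continuous_map K (topo G) (\<lambda>k. over (a (f k)))" if "(K, f) \<in> R" for K f
  proof (intro conjI)
    note l = loc[OF that, unfolded Aut_Sec_iff]
    show "cont_family K (\<lambda>k. a (f k))"
      using l by (subst (asm) cont_family_cong[of _ _ "\<lambda>k. a (f k)"]) (auto simp: compose_def)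
    have "cont_family K (\<lambda>n. inverse_map (compose (topspace K) a f n))" using l by blast
    then show "cont_family K (\<lambda>k. inverse_map (a (f k)))"
      by (subst (asm) cont_family_cong[of _ _ "\<lambda>k. inverse_map (a (f k))"]) (auto simp: compose_def)
    have "continuous_map K (topo G) (\<lambda>n. over (compose (topspace K) a f n))" using l by blast
    then show "continuous_map K (topo G) (\<lambda>k. over (a (f k)))"
      by (rule continuous_map_eq) (simp add: compose_def)
  qed
  then show "a \<in> Sec (Aut_sheaf G H P act) N"
    unfolding Aut_Sec_iff using a R
    by (auto intro: cont_family_glue[OF R] continuous_map_of_covering_simple[OF R])
next
  fix K N f a assume "f \<in> man_hom K N" "a \<in> Sec (Aut_sheaf G H P act) N"
  then show "compose (topspace K) a f \<in> Sec (Aut_sheaf G H P act) K" by (rule Aut_Sec_pull)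
qed (auto simp: Aut_Sec_iff)

lemma inverse_map_compose:
  assumes a: "a \<in> Aut" and b: "b \<in> Aut" and x: "x \<in> E"
  shows "inverse_map (compose E a b) x = inverse_map b (inverse_map a x)"
proof -
  have "compose E a b (inverse_map b (inverse_map a x)) = x"
    using inverse_map_in[OF a x] inverse_map_in[OF b inverse_map_in[OF a x]]
    by (simp add: compose_def inverse_map_right a b x)
  with inverse_map_left[OF compose_Aut(1)[OF a b] inverse_map_in[OF b inverse_map_in[OF a x]]]
  show ?thesis by simp
qed

lemma inverse_map_id: "x \<in> E \<Longrightarrow> inverse_map (\<lambda>x\<in>E. x) x = x"
  using inverse_map_left[OF id_Aut] by simp

lemma inverse_map_inverse_map:
  assumes "a \<in> Aut" "x \<in> E" shows "inverse_map (inverse_map a) x = a x"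
  using inverse_map_left[OF inverse_map_Aut(1)[OF assms(1)] Aut_in[OF assms]]
    inverse_map_left[OF assms] by simp

lemma Aut_group_sheaf: "is_group_sheaf (Aut_sheaf G H P act)"
  unfolding is_group_sheaf_def
proof (intro conjI allI impI Aut_is_sheaf)
  fix K :: space
  let ?S = "Sec (Aut_sheaf G H P act) K" and ?M = "Mul (Aut_sheaf G H P act) K"
    and ?I = "One (Aut_sheaf G H P act) K"
  have mul: "?M a b \<in> ?S" if "a \<in> ?S" "b \<in> ?S" for a b
  proof -
    have a: "a \<in> topspace K \<rightarrow>\<^sub>E Aut" "cont_family K a" "cont_family K (\<lambda>n. inverse_map (a n))"
        "continuous_map K (topo G) (\<lambda>n. over (a n))"
      and b: "b \<in> topspace K \<rightarrow>\<^sub>E Aut" "cont_family K b" "cont_family K (\<lambda>n. inverse_map (b n))"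
        "continuous_map K (topo G) (\<lambda>n. over (b n))"
      using that by (simp_all add: Aut_Sec_iff)
    have ab: "a n \<in> Aut" "b n \<in> Aut" if "n \<in> topspace K" for n using a(1) b(1) that by auto
    have "cont_family K (?M a b)"
      using cont_family_compose[OF a(2) b(2)]
      by (subst cont_family_cong) (auto simp: compose_def)
    moreover have "cont_family K (\<lambda>n. inverse_map (?M a b n))"
      using cont_family_compose[OF b(3) a(3)]
      by (subst cont_family_cong) (auto simp: inverse_map_compose ab)
    moreover have "continuous_map K (topo G) (\<lambda>n. over (?M a b n))"
      by (rule continuous_map_eq[OF continuous_mult[OF a(4) b(4)]]) (simp add: compose_Aut(2) ab)
    ultimately show ?thesis by (auto simp: Aut_Sec_iff compose_Aut(1) ab)
  qed
  have one: "?I \<in> ?S"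
  proof -
    have "cont_family K (\<lambda>_ x. x)" by (rule cont_family_const) simp
    then have "cont_family K ?I" "cont_family K (\<lambda>n. inverse_map (?I n))"
      by (subst cont_family_cong; auto simp: inverse_map_id)+
    moreover have "continuous_map K (topo G) (\<lambda>n. over (?I n))"
      by (rule continuous_map_eq[of _ _ "\<lambda>_. \<one>\<^bsub>G\<^esub>"]) (simp_all add: over_id)
    ultimately show ?thesis by (auto simp: Aut_Sec_iff id_Aut)
  qed
  have Aut_S: "a n \<in> Aut" if "a \<in> ?S" "n \<in> topspace K" for a n using that by (auto simp: Aut_Sec_iff)
  have inv: "(\<lambda>n\<in>topspace K. inverse_map (a n)) \<in> ?S \<and> ?M (\<lambda>n\<in>topspace K. inverse_map (a n)) a = ?I"
    if aS: "a \<in> ?S" for a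
  proof
    have a: "cont_family K a" "cont_family K (\<lambda>n. inverse_map (a n))"
        "continuous_map K (topo G) (\<lambda>n. over (a n))"
      using aS by (simp_all add: Aut_Sec_iff)
    let ?i = "\<lambda>n\<in>topspace K. inverse_map (a n)"
    have "cont_family K ?i" using a(2) by (subst cont_family_cong) auto
    \<comment> \<open>Inversion merely exchanges the two joint continuity conditions.\<close>
    moreover have "cont_family K (\<lambda>n. inverse_map (?i n))"
      using a(1) by (subst cont_family_cong) (auto simp: inverse_map_inverse_map Aut_S[OF aS])
    moreover have "continuous_map K (topo G) (\<lambda>n. over (?i n))"
      by (rule continuous_map_eq[OF continuous_inv[OF a(3)]]) (simp add: inverse_map_Aut(2) Aut_S[OF aS])
    ultimately show "?i \<in> ?S" by (auto simp: Aut_Sec_iff inverse_map_Aut(1) Aut_S[OF aS])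
    show "?M ?i a = ?I"
      by (auto simp: fun_eq_iff compose_def inverse_map_left Aut_S[OF aS])
  qed
  show "group (sec_group (Aut_sheaf G H P act) K)"
  proof (rule groupI)
    fix a b c assume "a \<in> carrier (sec_group (Aut_sheaf G H P act) K)"
      "b \<in> carrier (sec_group (Aut_sheaf G H P act) K)" "c \<in> carrier (sec_group (Aut_sheaf G H P act) K)"
    then have "a \<in> ?S" "b \<in> ?S" "c \<in> ?S" by (simp_all add: sec_group_def)
    then have "compose E (compose E (a n) (b n)) (c n) = compose E (a n) (compose E (b n) (c n))"
      if "n \<in> topspace K" for n
      using Aut_in[OF Aut_S[OF _ that]] by (auto simp: compose_def fun_eq_iff)
    then show "a \<otimes>\<^bsub>sec_group (Aut_sheaf G H P act) K\<^esub> b \<otimes>\<^bsub>sec_group (Aut_sheaf G H P act) K\<^esub> c =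
        a \<otimes>\<^bsub>sec_group (Aut_sheaf G H P act) K\<^esub> (b \<otimes>\<^bsub>sec_group (Aut_sheaf G H P act) K\<^esub> c)"
      by (auto simp: sec_group_def fun_eq_iff)
  next
    fix a assume "a \<in> carrier (sec_group (Aut_sheaf G H P act) K)"
    then have a: "a \<in> ?S" by (simp add: sec_group_def)
    then show "\<exists>y\<in>carrier (sec_group (Aut_sheaf G H P act) K).
        y \<otimes>\<^bsub>sec_group (Aut_sheaf G H P act) K\<^esub> a = \<one>\<^bsub>sec_group (Aut_sheaf G H P act) K\<^esub>"
      using inv[OF a] by (auto simp: sec_group_def simp del: Aut_sheaf_simps)
    have "compose E (\<lambda>x\<in>E. x) (a n) = a n" if "n \<in> topspace K" for n
      using Aut_in[OF Aut_S[OF a that]] Aut_extensional[OF Aut_S[OF a that]]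
      by (auto simp: compose_def fun_eq_iff extensional_def)
    moreover have "a \<in> extensional (topspace K)" using a by (auto simp: Aut_Sec_iff PiE_def)
    ultimately show "\<one>\<^bsub>sec_group (Aut_sheaf G H P act) K\<^esub> \<otimes>\<^bsub>sec_group (Aut_sheaf G H P act) K\<^esub> a = a"
      by (auto simp: sec_group_def fun_eq_iff extensional_def)
  qed (use mul one in \<open>simp_all add: sec_group_def del: Aut_sheaf_simps\<close>)
next
  fix K N :: space and f assume "topological_manifold K \<and> topological_manifold N \<and> f \<in> man_hom K N"
  then have f: "f \<in> man_hom K N" by simp
  have "compose (topspace K) (\<lambda>n\<in>topspace N. compose E (a n) (b n)) f =
      (\<lambda>k\<in>topspace K. compose E (compose (topspace K) a f k) (compose (topspace K) b f k))"
    for a b :: "(nat \<Rightarrow> real) \<Rightarrow> 'p \<Rightarrow> 'p"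
    using man_hom_image[OF f] by (auto simp: compose_def fun_eq_iff)
  then show "Res (Aut_sheaf G H P act) K N f \<in>
      hom (sec_group (Aut_sheaf G H P act) N) (sec_group (Aut_sheaf G H P act) K)"
    using Aut_Sec_pull[OF f] by (simp add: hom_def sec_group_def)
qed

text \<open>For a family of gauge transformations the induced map to G is constant, so the
  continuity condition that distinguishes the two definitions holds automatically.\<close>

lemma gauge_Sec_iff:
  "a \<in> Sec (gauge_sheaf H P) N \<longleftrightarrow>
     a \<in> Sec (Aut_sheaf G H P act) N \<and> (\<forall>n\<in>topspace N. over (a n) = \<one>\<^bsub>G\<^esub>)"
proof -
  have "continuous_map N (topo G) (\<lambda>n. over (a n))" if "\<forall>n\<in>topspace N. over (a n) = \<one>\<^bsub>G\<^esub>"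
    by (rule continuous_map_eq[of _ _ "\<lambda>_. \<one>\<^bsub>G\<^esub>"]) (use that in simp_all)
  then show ?thesis
    by (auto simp: gauge_sheaf_def Aut_sheaf_def gauge_iff PiE_iff)
qed

lemma gauge_is_sheaf: "is_sheaf (gauge_sheaf H P)"
proof (rule is_sheaf_functions[where A = "gauge_transformations H P" and Q = "\<lambda>N a. a \<in> Sec (gauge_sheaf H P) N"])
  fix K N f a assume f: "f \<in> man_hom K N" and a: "a \<in> Sec (gauge_sheaf H P) N"
  then show "compose (topspace K) a f \<in> Sec (gauge_sheaf H P) K"
    using Aut_Sec_pull[OF f] man_hom_image[OF f] by (auto simp: gauge_Sec_iff compose_def)
next
  fix N R a assume R: "man_covering R N" and N: "topological_manifold N"
    and a: "a \<in> topspace N \<rightarrow>\<^sub>E gauge_transformations H P"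
    and loc: "\<And>K f. (K, f) \<in> R \<Longrightarrow> compose (topspace K) a f \<in> Sec (gauge_sheaf H P) K"
  have a': "a \<in> topspace N \<rightarrow>\<^sub>E Aut" using a by (auto simp: gauge_iff PiE_iff)
  have "cont_family N a"
  proof (rule cont_family_glue[OF R])
    fix K f assume "(K, f) \<in> R"
    from loc[OF this] have "cont_family K (compose (topspace K) a f)"
      by (simp add: gauge_Sec_iff Aut_Sec_iff)
    then show "cont_family K (\<lambda>k. a (f k))"
      by (subst (asm) cont_family_cong[of _ _ "\<lambda>k. a (f k)"]) (auto simp: compose_def)
  qed
  moreover have "cont_family N (\<lambda>n. inverse_map (a n))"
  proof (rule cont_family_glue[OF R])
    fix K f assume "(K, f) \<in> R"
    from loc[OF this] have "cont_family K (\<lambda>k. inverse_map (compose (topspace K) a f k))"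
      by (simp add: gauge_Sec_iff Aut_Sec_iff)
    then show "cont_family K (\<lambda>k. inverse_map (a (f k)))"
      by (subst (asm) cont_family_cong[of _ _ "\<lambda>k. inverse_map (a (f k))"]) (auto simp: compose_def)
  qed
  moreover have "continuous_map N (topo G) (\<lambda>n. over (a n))"
    by (rule continuous_map_eq[of _ _ "\<lambda>_. \<one>\<^bsub>G\<^esub>"]) (use a in \<open>auto simp: gauge_iff PiE_iff\<close>)
  ultimately show "a \<in> Sec (gauge_sheaf H P) N"
    using a a' by (auto simp: gauge_Sec_iff Aut_Sec_iff gauge_iff PiE_iff)
qed (auto simp: gauge_sheaf_def)

sublocale group_sheaf_extension X
proof
  fix K :: space
  show "Sec (Ker X) K = {m \<in> Sec (Mid X) K. Pr X K m = One (Quot X) K}"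
    by (auto simp: gauge_Sec_iff Aut_sheaf_to_G_def fun_eq_iff)
  fix a b assume "a \<in> Sec (Mid X) K" "b \<in> Sec (Mid X) K"
  then show "Pr X K (Mul (Mid X) K a b) = Mul (Quot X) K (Pr X K a) (Pr X K b)"
    by (auto simp: Aut_sheaf_to_G_def fun_eq_iff Aut_Sec_iff PiE_iff compose_Aut(2))
next
  show "sheaf_mor (Mid X) (Quot X) (Pr X)"
    using man_hom_image
    by (auto simp: sheaf_mor_def Aut_sheaf_to_G_def Aut_Sec_iff compose_def fun_eq_iff)
next
  show "Res (Ker X) = Res (Mid X)" by (simp add: gauge_sheaf_def Aut_sheaf_def)
qed (simp_all add: Aut_group_sheaf topgroup_group_sheaf gauge_is_sheaf)

end

section \<open>Liftings are splittings\<close>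

context bundle_action
begin

definition lift_splitting :: "('g \<Rightarrow> 'p \<Rightarrow> 'p) \<Rightarrow> space \<Rightarrow> ((nat \<Rightarrow> real) \<Rightarrow> 'g) \<Rightarrow> (nat \<Rightarrow> real) \<Rightarrow> 'p \<Rightarrow> 'p" where
  "lift_splitting b K g = (\<lambda>k\<in>topspace K. restrict (b (g k)) E)"

lemma is_liftingD:
  assumes "is_lifting G H P act b"
  shows lifting_in: "\<And>g x. g \<in> carrier G \<Longrightarrow> x \<in> E \<Longrightarrow> b g x \<in> E"
    and lifting_one: "\<And>x. x \<in> E \<Longrightarrow> b \<one>\<^bsub>G\<^esub> x = x"
    and lifting_mult: "\<And>g h x. g \<in> carrier G \<Longrightarrow> h \<in> carrier G \<Longrightarrow> x \<in> E \<Longrightarrow>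
      b (g \<otimes>\<^bsub>G\<^esub> h) x = b g (b h x)"
    and lifting_cont: "\<And>(N :: space) f. topological_manifold N \<Longrightarrow> continuous_map N (topo G) f \<Longrightarrow>
      cont_family N (\<lambda>n. b (f n))"
    and lifting_ract: "\<And>g x h. g \<in> carrier G \<Longrightarrow> x \<in> E \<Longrightarrow> h \<in> carrier H \<Longrightarrow> b g (ract P x h) = ract P (b g x) h"
    and lifting_proj: "\<And>g x. g \<in> carrier G \<Longrightarrow> x \<in> E \<Longrightarrow> proj P (b g x) = act g (proj P x)"
  using assms by (simp_all add: is_lifting_def left_action_def cont_family_def)

lemma cont_family_slice:
  assumes "cont_family N A" "n \<in> topspace N"
  shows "continuous_map (Total P) (Total P) (A n)"
proof -
  have "continuous_map (Total P) (prod_topology N (Total P)) (\<lambda>x. (n, x))"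
    using assms(2) by (simp add: continuous_map_pairedI)
  from continuous_map_compose[OF this assms(1)[unfolded cont_family_def]]
  show ?thesis by (simp add: o_def)
qed

lemma lifting_inv:
  assumes b: "is_lifting G H P act b" and g: "g \<in> carrier G" and x: "x \<in> E"
  shows "b (inv\<^bsub>G\<^esub> g) (b g x) = x" "b g (b (inv\<^bsub>G\<^esub> g) x) = x"
  using lifting_mult[OF b, of "inv\<^bsub>G\<^esub> g" g x] lifting_mult[OF b, of g "inv\<^bsub>G\<^esub> g" x]
    lifting_one[OF b x] g x by simp_all

text \<open>Applying the continuity of a lifting to a constant map from the one-point manifold shows
  that each single b(g) is continuous; b(g^-1) is its inverse, so it is a homeomorphism.\<close>

lemma lifting_Aut:
  assumes b: "is_lifting G H P act b" and g: "g \<in> carrier G"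
  shows "restrict (b g) E \<in> Aut" and "over (restrict (b g) E) = g"
    and "\<And>x. x \<in> E \<Longrightarrow> inverse_map (restrict (b g) E) x = b (inv\<^bsub>G\<^esub> g) x"
proof -
  have cont: "continuous_map (Total P) (Total P) (b h)" if h: "h \<in> carrier G" for h
    by (rule cont_family_slice[OF lifting_cont[OF b manifold_point_space, of "\<lambda>_. h"], of "\<lambda>_. 0"])
      (use h in simp_all)
  have "homeomorphic_maps (Total P) (Total P) (b g) (b (inv\<^bsub>G\<^esub> g))"
    unfolding homeomorphic_maps_def using cont g lifting_inv[OF b g] by simp
  then have "homeomorphic_map (Total P) (Total P) (b g)" using homeomorphic_maps_map by blast
  then have 2: "homeomorphic_map (Total P) (Total P) (restrict (b g) E)"
    by (rule homeomorphic_map_eq) simp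
  have 3: "restrict (b g) E (ract P x h) = ract P (restrict (b g) E x) h" if "x \<in> E" "h \<in> carrier H" for x h
    using that lifting_ract[OF b g] by simp
  have 4: "proj P (restrict (b g) E x) = act g (proj P x)" if "x \<in> E" for x
    using that lifting_proj[OF b g] by simp
  show a: "restrict (b g) E \<in> Aut" "over (restrict (b g) E) = g"
    using AutI[OF restrict_extensional 2 3 g 4] by blast+
  fix x assume x: "x \<in> E"
  have "b (inv\<^bsub>G\<^esub> g) x \<in> E" by (rule lifting_in[OF b _ x]) (use g in simp)
  with inverse_map_left[OF a(1) this] lifting_inv(2)[OF b g x]
  show "inverse_map (restrict (b g) E) x = b (inv\<^bsub>G\<^esub> g) x" by simp
qed

lemma splitting_lift_splitting:
  assumes b: "is_lifting G H P act b"
  shows "splitting (lift_splitting b)"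
  unfolding splitting_def extension_simps
proof (intro conjI allI impI ballI, goal_cases)
  case (1 K g)
  then have g: "continuous_map K (topo G) g" by simp
  have gG: "g k \<in> carrier G" if "k \<in> topspace K" for k using continuous_in_carrier[OF g that] .
  have "cont_family K (lift_splitting b K g)"
    using lifting_cont[OF b 1(1) g] by (subst cont_family_cong) (auto simp: lift_splitting_def)
  moreover have "cont_family K (\<lambda>k. inverse_map (lift_splitting b K g k))"
    \<comment> \<open>The inverse of b(g(k)) is b(g(k)^-1), so continuity of inversion in G yields
      continuity of the inverse family.\<close>
    using lifting_cont[OF b 1(1) continuous_inv[OF g]]
    by (subst cont_family_cong) (auto simp: lift_splitting_def lifting_Aut(3)[OF b gG])
  moreover have "continuous_map K (topo G) (\<lambda>k. over (lift_splitting b K g k))"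
    by (rule continuous_map_eq[OF g]) (simp add: lift_splitting_def lifting_Aut(2)[OF b gG])
  ultimately show ?case
    by (auto simp: Aut_Sec_iff lift_splitting_def lifting_Aut(1)[OF b gG])
next
  case (2 K g)
  then have g: "continuous_map K (topo G) g" "g \<in> extensional (topspace K)" by simp_all
  then show ?case
    using lifting_Aut(2)[OF b continuous_in_carrier[OF g(1)]]
    by (auto simp: Aut_sheaf_to_G_def lift_splitting_def fun_eq_iff extensional_def)
next
  case (3 K g g')
  then show ?case
    using continuous_in_carrier[of K g] continuous_in_carrier[of K g']
    by (auto simp: lift_splitting_def fun_eq_iff compose_def lifting_in[OF b] lifting_mult[OF b])
next
  case (4 J K f g)
  then show ?case
    using man_hom_image[of f J K] by (auto simp: lift_splitting_def compose_def fun_eq_iff)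
qed

text \<open>Group elements are sections over the point, and b is \<sigma> there. Naturality along
  the points of K shows that \<sigma> over K is computed pointwise by b; hence the continuity asked
  of b along a map g to G is that of the section \<sigma>(g).\<close>

lemma lifting_of_splitting:
  assumes \<sigma>: "splitting \<sigma>"
  shows "\<exists>b. is_lifting G H P act b \<and> (\<forall>K. topological_manifold K \<longrightarrow>
    (\<forall>g\<in>Sec (topgroup_sheaf G) K. lift_splitting b K g = \<sigma> K g))"
proof -
  define c where "c g = (\<lambda>_\<in>topspace point_space. g)" for g :: 'g
  define b where "b g = \<sigma> point_space (c g) (\<lambda>_. 0)" for g
  have c_in: "c g \<in> Sec (topgroup_sheaf G) point_space" if "g \<in> carrier G" for g
    using that by (simp add: c_def del: topspace_point_space)
  note \<sigma>D = splittingD[OF \<sigma>, unfolded extension_simps]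
  have c_mult: "c (g \<otimes>\<^bsub>G\<^esub> h) = Mul (topgroup_sheaf G) point_space (c g) (c h)" for g h
    by (auto simp: c_def fun_eq_iff)
  have c_one: "c \<one>\<^bsub>G\<^esub> = One (topgroup_sheaf G) point_space" by (simp add: c_def)
  have b_Aut: "b g \<in> Aut" "over (b g) = g" if g: "g \<in> carrier G" for g
  proof -
    show "b g \<in> Aut" using \<sigma>D(1)[OF manifold_point_space c_in[OF g]] by (auto simp: Aut_Sec_iff b_def)
    from \<sigma>D(2)[OF manifold_point_space c_in[OF g]]
    have "Aut_sheaf_to_G G P act point_space (\<sigma> point_space (c g)) (\<lambda>_. 0) = c g (\<lambda>_. 0)" by simp
    then show "over (b g) = g" by (simp add: Aut_sheaf_to_G_def b_def c_def)
  qed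
  \<comment> \<open>The constant section \<open>c (g k)\<close> is the restriction of g along the
    point k, with which \<sigma> commutes.\<close>
  have b_eq: "b (g k) = \<sigma> K g k"
    if K: "topological_manifold K" "g \<in> Sec (topgroup_sheaf G) K" and k: "k \<in> topspace K" for K g k
  proof -
    note i = from_point_hom[OF k]
    have "c (g k) = Res (topgroup_sheaf G) point_space K (\<lambda>_\<in>topspace point_space. k) g"
      by (auto simp: c_def compose_def fun_eq_iff)
    then show ?thesis
      unfolding b_def using \<sigma>D(4)[OF manifold_point_space K(1) i K(2)] by (simp add: compose_def)
  qed
  have "is_lifting G H P act b"
    unfolding is_lifting_def left_action_def
  proof (intro conjI ballI allI impI)
    fix g x assume g: "g \<in> carrier G" and x: "x \<in> E"
    note b = b_Aut[OF g]
    show "b g x \<in> E" by (rule Aut_in[OF b(1) x])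
    show "proj P (b g x) = act g (proj P x)" using proj_Aut[OF b(1) x] b(2) by simp
    show "b g (ract P x h) = ract P (b g x) h" if "h \<in> carrier H" for h
      by (rule Aut_ract[OF b(1) x that])
    show "b (g \<otimes>\<^bsub>G\<^esub> h) x = b g (b h x)" if h: "h \<in> carrier G" for h
      using \<sigma>D(3)[OF manifold_point_space c_in[OF g] c_in[OF h]] x
      by (simp add: b_def c_mult compose_def del: topgroup_sheaf_simps)
  next
    fix x assume "x \<in> E"
    then show "b \<one>\<^bsub>G\<^esub> x = x"
      using splitting_One[OF \<sigma> manifold_point_space, unfolded extension_simps]
      by (simp add: b_def c_one del: topgroup_sheaf_simps)
  next
    fix N :: space and f assume N: "topological_manifold N \<and> continuous_map N (topo G) f"
    let ?f = "restrict f (topspace N)"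
    have f: "?f \<in> Sec (topgroup_sheaf G) N" using N by simp
    have "cont_family N (\<sigma> N ?f)" using \<sigma>D(1)[OF _ f] N by (simp add: Aut_Sec_iff)
    then have "cont_family N (\<lambda>n. b (f n))"
      using b_eq[OF _ f] N by (subst (asm) cont_family_cong[of _ _ "\<lambda>n. b (f n)"]) auto
    then show "continuous_map (prod_topology N (Total P)) (Total P) (\<lambda>(n, x). b (f n) x)"
      by (simp add: cont_family_def)
  qed
  moreover have "lift_splitting b K g = \<sigma> K g"
    if K: "topological_manifold K" "g \<in> Sec (topgroup_sheaf G) K" for K g
  proof -
    have S: "\<sigma> K g \<in> topspace K \<rightarrow>\<^sub>E Aut" using \<sigma>D(1)[OF K] by (simp add: Aut_Sec_iff)
    show ?thesis
    proof
      fix k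
      show "lift_splitting b K g k = \<sigma> K g k"
      proof (cases "k \<in> topspace K")
        case True
        then have "\<sigma> K g k \<in> extensional E" using S Aut_extensional by blast
        then show ?thesis using True b_eq[OF K True] by (simp add: lift_splitting_def extensional_restrict)
      next
        case False
        then show ?thesis using S by (auto simp: lift_splitting_def)
      qed
    qed
  qed
  ultimately show ?thesis by blast
qed

text \<open>A section of the gauge sheaf over the one-point manifold is a single gauge
  transformation a, and its constant spreading turns the conjugacy relation into a b(g) = c(g) a at
  each point.\<close>

lemma lifting_iso_iff:
  assumes b: "is_lifting G H P act b" and c: "is_lifting G H P act c"
  shows "(b, c) \<in> lifting_iso G H P act \<longleftrightarrow> conjugate (lift_splitting b) (lift_splitting c)"
proof
  have const: "const_sec (Mid X) K l = (\<lambda>k\<in>topspace K. l (\<lambda>_. 0))" for K l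
    by (auto simp: const_sec_def compose_def to_point_def fun_eq_iff)
  {
    assume "(b, c) \<in> lifting_iso G H P act"
    then obtain a where a: "a \<in> gauge_transformations H P"
      and eq: "\<And>g x. g \<in> carrier G \<Longrightarrow> x \<in> E \<Longrightarrow> a (b g x) = c g (a x)"
      by (auto simp: lifting_iso_def)
    have aA: "a \<in> Aut" "over a = \<one>\<^bsub>G\<^esub>" using a by (simp_all add: gauge_iff)
    define l where "l = (\<lambda>n\<in>topspace point_space. a)"
    have "continuous_map (Total P) (Total P) a" "continuous_map (Total P) (Total P) (inverse_map a)"
      using homeomorphic_inverse_map[OF aA(1)] by (simp_all add: homeomorphic_maps_def)
    note cont = this[THEN cont_family_const[of _ point_space]]
    have "cont_family point_space l"
      using cont(1) by (subst cont_family_cong) (auto simp: l_def)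
    moreover have "cont_family point_space (\<lambda>n. inverse_map (l n))"
      using cont(2) by (subst cont_family_cong) (auto simp: l_def)
    moreover have "continuous_map point_space (topo G) (\<lambda>n. over (l n))"
      by (rule continuous_map_eq[of _ _ "\<lambda>_. \<one>\<^bsub>G\<^esub>"]) (simp_all add: l_def aA)
    ultimately have l: "l \<in> Sec (Ker X) point_space"
      using aA by (auto simp: gauge_Sec_iff Aut_Sec_iff l_def)
    show "conjugate (lift_splitting b) (lift_splitting c)"
      unfolding conjugate_def
    proof (intro bexI[OF _ l] allI impI ballI)
      fix K g assume "g \<in> Sec (Quot X) K"
      then have "g k \<in> carrier G" if "k \<in> topspace K" for k
        using that continuous_in_carrier[of K g] by simp
      then show "Mul (Mid X) K (const_sec (Mid X) K l) (lift_splitting b K g) =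
          Mul (Mid X) K (lift_splitting c K g) (const_sec (Mid X) K l)"
        unfolding const using Aut_in[OF aA(1)] eq
        by (auto simp: lift_splitting_def l_def compose_def fun_eq_iff)
    qed
  }
  assume "conjugate (lift_splitting b) (lift_splitting c)"
  then obtain l where l: "l \<in> Sec (Ker X) point_space"
    and eq: "\<And>K g. \<lbrakk>topological_manifold K; g \<in> Sec (Quot X) K\<rbrakk> \<Longrightarrow>
      Mul (Mid X) K (const_sec (Mid X) K l) (lift_splitting b K g) =
        Mul (Mid X) K (lift_splitting c K g) (const_sec (Mid X) K l)"
    unfolding conjugate_def by blast
  define a where "a = l (\<lambda>_. 0)"
  have a: "a \<in> gauge_transformations H P"
    using l by (auto simp: gauge_Sec_iff Aut_Sec_iff gauge_iff a_def)
  have "a (b g x) = c g (a x)" if g: "g \<in> carrier G" and x: "x \<in> E" for g x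
  proof -
    \<comment> \<open>One group element is recovered from the relation between sections by testing
      it on a constant section over the point.\<close>
    have "(\<lambda>_\<in>topspace point_space. g) \<in> Sec (Quot X) point_space"
      using g by (simp del: topspace_point_space)
    from fun_cong[OF fun_cong[OF eq[OF manifold_point_space this]], of "\<lambda>_. 0" x]
    show ?thesis
      unfolding const using x Aut_in[of a x] a lifting_in[OF b g x]
      by (simp add: lift_splitting_def compose_def a_def gauge_iff)
  qed
  with a b c show "(b, c) \<in> lifting_iso G H P act" by (auto simp: lifting_iso_def)
qed

lemma equiv_lifting_iso: "equiv {b. is_lifting G H P act b} (lifting_iso G H P act)"
proof (rule equivI)
  show "lifting_iso G H P act \<subseteq> {b. is_lifting G H P act b} \<times> {b. is_lifting G H P act b}"
    by (auto simp: lifting_iso_def)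
  have "(\<lambda>x\<in>E. x) \<in> gauge_transformations H P" by (simp add: gauge_iff id_Aut over_id)
  then show "refl_on {b. is_lifting G H P act b} (lifting_iso G H P act)"
    by (auto simp: refl_on_def lifting_iso_def lifting_in intro!: bexI[of _ "\<lambda>x\<in>E. x"])
  show "sym (lifting_iso G H P act)"
  proof (rule symI)
    fix b c assume "(b, c) \<in> lifting_iso G H P act"
    then obtain a where b: "is_lifting G H P act b" and c: "is_lifting G H P act c"
      and a: "a \<in> gauge_transformations H P"
      and eq: "\<And>g x. g \<in> carrier G \<Longrightarrow> x \<in> E \<Longrightarrow> a (b g x) = c g (a x)"
      by (auto simp: lifting_iso_def)
    have aA: "a \<in> Aut" "over a = \<one>\<^bsub>G\<^esub>" using a by (simp_all add: gauge_iff)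
    have i: "inverse_map a \<in> gauge_transformations H P"
      by (simp add: gauge_iff inverse_map_Aut[OF aA(1)] aA(2))
    have "inverse_map a (c g x) = b g (inverse_map a x)" if g: "g \<in> carrier G" and x: "x \<in> E" for g x
      using eq[OF g inverse_map_in[OF aA(1) x]] inverse_map_right[OF aA(1) x]
        inverse_map_left[OF aA(1) lifting_in[OF b g inverse_map_in[OF aA(1) x]]] by simp
    with i b c show "(c, b) \<in> lifting_iso G H P act" by (auto simp: lifting_iso_def)
  qed
  show "trans (lifting_iso G H P act)"
  proof (rule transI)
    fix b c d assume bc: "(b, c) \<in> lifting_iso G H P act" and cd: "(c, d) \<in> lifting_iso G H P act"
    then have b: "is_lifting G H P act b" and d: "is_lifting G H P act d"
      by (simp_all add: lifting_iso_def)
    obtain a where a: "a \<in> gauge_transformations H P"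
      and eq: "\<And>g x. g \<in> carrier G \<Longrightarrow> x \<in> E \<Longrightarrow> a (b g x) = c g (a x)"
      using bc by (auto simp: lifting_iso_def)
    obtain a' where a': "a' \<in> gauge_transformations H P"
      and eq': "\<And>g x. g \<in> carrier G \<Longrightarrow> x \<in> E \<Longrightarrow> a' (c g x) = d g (a' x)"
      using cd by (auto simp: lifting_iso_def)
    have "compose E a' a \<in> gauge_transformations H P"
      using a a' by (simp add: gauge_iff compose_Aut)
    moreover have "compose E a' a (b g x) = d g (compose E a' a x)"
      if g: "g \<in> carrier G" and x: "x \<in> E" for g x
      using that eq eq' a lifting_in[OF b g x] Aut_in[of a x] by (simp add: compose_def gauge_iff)
    ultimately show "(b, d) \<in> lifting_iso G H P act"
      using b d by (auto simp: lifting_iso_def)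
  qed
qed

end

section \<open>From liftings to cohomology classes\<close>

lemma quotient_bij:
  assumes r: "equiv A r" and s: "s \<subseteq> B \<times> B"
    and R_A: "\<And>a. a \<in> A \<Longrightarrow> \<exists>b\<in>B. R a b" and R_B: "\<And>b. b \<in> B \<Longrightarrow> \<exists>a\<in>A. R a b"
    and R: "\<And>a b a' b'. \<lbrakk>a \<in> A; b \<in> B; a' \<in> A; b' \<in> B; R a b; R a' b'\<rbrakk> \<Longrightarrow> (a, a') \<in> r \<longleftrightarrow> (b, b') \<in> s"
  shows "\<exists>\<phi>. bij_betw \<phi> (A // r) (B // s)"
proof -
  define \<phi> where "\<phi> C = {b \<in> B. \<exists>a\<in>C. R a b}" for C
  have rA: "r \<subseteq> A \<times> A" and refl: "\<And>a. a \<in> A \<Longrightarrow> (a, a) \<in> r"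
    using r by (auto simp: equiv_def refl_on_def)
  \<comment> \<open>A correspondence \<open>R\<close> is used because passing between liftings and
    torsors involves choosing base points. A class is sent to all partners of its members, and these
    fill exactly one class of s.\<close>
  have img: "\<phi> (r `` {a}) = s `` {b}" if ab: "a \<in> A" "b \<in> B" "R a b" for a b
  proof (intro equalityI subsetI)
    fix b' assume "b' \<in> \<phi> (r `` {a})"
    then obtain a' where "b' \<in> B" "(a, a') \<in> r" "R a' b'" by (auto simp: \<phi>_def)
    with ab rA R show "b' \<in> s `` {b}" by blast
  next
    fix b' assume "b' \<in> s `` {b}"
    then have b': "(b, b') \<in> s" "b' \<in> B" using s by auto
    then obtain a' where "a' \<in> A" "R a' b'" using R_B by blast
    with ab b' R have "(a, a') \<in> r" by blast
    with b' \<open>R a' b'\<close> show "b' \<in> \<phi> (r `` {a})" by (auto simp: \<phi>_def)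
  qed
  have "inj_on \<phi> (A // r)"
  proof (rule inj_onI)
    fix C D assume "C \<in> A // r" "D \<in> A // r" and eq: "\<phi> C = \<phi> D"
    then obtain a a' where a: "a \<in> A" "C = r `` {a}" "a' \<in> A" "D = r `` {a'}"
      by (auto elim!: quotientE)
    obtain b where b: "b \<in> B" "R a b" using R_A a(1) by blast
    obtain b' where b': "b' \<in> B" "R a' b'" using R_A a(3) by blast
    \<comment> \<open>Reflexivity of s is imported from r through \<open>R\<close>.\<close>
    have "(b', b') \<in> s" using R[OF a(3) b'(1) a(3) b'(1) b'(2) b'(2)] refl[OF a(3)] by blast
    then have "(b, b') \<in> s" using eq img[OF a(1) b] img[OF a(3) b'] a by blast
    then have "(a, a') \<in> r" using R[OF a(1) b(1) a(3) b'(1) b(2) b'(2)] by blast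
    then show "C = D" using equiv_class_eq[OF r] a by simp
  qed
  moreover have "\<phi> ` (A // r) = B // s"
  proof
    show "\<phi> ` (A // r) \<subseteq> B // s"
      using img R_A by (fastforce elim!: quotientE intro: quotientI)
    show "B // s \<subseteq> \<phi> ` (A // r)"
    proof
      fix D assume "D \<in> B // s"
      then obtain b where b: "b \<in> B" "D = s `` {b}" by (auto elim: quotientE)
      then obtain a where "a \<in> A" "R a b" using R_B by blast
      with img b show "D \<in> \<phi> ` (A // r)" by (metis image_eqI quotientI)
    qed
  qed
  ultimately show ?thesis unfolding bij_betw_def by blast
qed

text \<open>A splitting and the one rebuilt from its lifting agree on sections over manifolds, which
  is all that \<open>associated\<close> refers to.\<close>

lemma (in pointed_global_obj) associated_cong:
  assumes "associated T \<sigma>" "splitting \<tau>"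
    and "\<And>K n. topological_manifold K \<Longrightarrow> n \<in> Sec (Quot X) K \<Longrightarrow> \<tau> K n = \<sigma> K n"
  shows "associated T \<tau>"
  using assms unfolding associated_def by simp

context bundle_action
begin

text \<open>A lifting is matched with the twisted form of L given by its splitting, a torsor with
  the lifting of an associated splitting. Isomorphism on either side is conjugacy of splittings by
  \<open>lifting_iso_iff\<close> and \<open>associated_iso_iff\<close>.\<close>

lemma lifting_classes_bij_H1:
  fixes s :: "(_, _, 'v) global_obj" and emb :: "((nat \<Rightarrow> real) \<Rightarrow> 'p \<Rightarrow> 'p) \<Rightarrow> 'v"
  assumes s: "is_global_obj X s" and emb: "inj emb"
  shows "\<exists>\<phi>. bij_betw \<phi> (lifting_classes G H P act) (H1 X s)"
proof -
  obtain base \<sigma>\<^sub>0 where "pointed_global_obj X s base \<sigma>\<^sub>0"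
    using global_obj_pointed[OF s] by blast
  then interpret pointed_global_obj X s base \<sigma>\<^sub>0 .
  let ?iso = "{(S, T). S \<in> H1_torsors X s \<and> T \<in> H1_torsors X s \<and>
      (\<exists>u. torsor_iso (Quot X) (obj_Aut_sheaf X s) S T u)}"
  show ?thesis
    unfolding lifting_classes_def H1_def
  proof (rule quotient_bij[OF equiv_lifting_iso, where R = "\<lambda>b T. associated T (lift_splitting b)"])
    fix b assume "b \<in> {b. is_lifting G H P act b}"
    then have "associated (split_torsor emb (lift_splitting b)) (lift_splitting b)"
      by (intro associated_torsor emb splitting_lift_splitting) simp
    then show "\<exists>T\<in>H1_torsors X s. associated T (lift_splitting b)"
      by (auto simp: associated_def)
  next
    fix T assume "T \<in> H1_torsors X s"
    then obtain \<sigma> where \<sigma>: "associated T \<sigma>" using associated_splitting by blast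
    then have "splitting \<sigma>" by (simp add: associated_def)
    then obtain b where b: "is_lifting G H P act b"
      "\<And>K g. topological_manifold K \<Longrightarrow> g \<in> Sec (topgroup_sheaf G) K \<Longrightarrow> lift_splitting b K g = \<sigma> K g"
      using lifting_of_splitting by blast
    then have "associated T (lift_splitting b)"
      by (intro associated_cong[OF \<sigma> splitting_lift_splitting]) simp_all
    with b show "\<exists>b\<in>{b. is_lifting G H P act b}. associated T (lift_splitting b)" by blast
  next
    fix b T c T' assume "b \<in> {b. is_lifting G H P act b}" "c \<in> {b. is_lifting G H P act b}"
      "T \<in> H1_torsors X s" "T' \<in> H1_torsors X s"
      "associated T (lift_splitting b)" "associated T' (lift_splitting c)"
    then show "(b, c) \<in> lifting_iso G H P act \<longleftrightarrow> (T, T') \<in> ?iso"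
      using associated_iso_iff[of T "lift_splitting b" T' "lift_splitting c"] by (simp add: lifting_iso_iff)
  qed auto
qed

lemma lifting_iff_class_vanishes:
  assumes emb: "inj (emb :: ((nat \<Rightarrow> real) \<Rightarrow> 'p \<Rightarrow> 'p) \<Rightarrow> 'v)"
  shows "(\<exists>b. is_lifting G H P act b) \<longleftrightarrow>
    class_vanishes (classifying_class X :: (_, _, 'v) gerbe_cocycle set)"
proof
  assume "\<exists>b. is_lifting G H P act b"
  then show "class_vanishes (classifying_class X :: (_, _, 'v) gerbe_cocycle set)"
    using splitting_lift_splitting class_vanishes_if_splitting[OF emb] by blast
next
  assume "class_vanishes (classifying_class X :: (_, _, 'v) gerbe_cocycle set)"
  then obtain \<sigma> where "splitting \<sigma>" using splitting_if_class_vanishes by blast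
  then show "\<exists>b. is_lifting G H P act b" using lifting_of_splitting by blast
qed

lemma global_obj_if_lifting:
  assumes emb: "inj (emb :: ((nat \<Rightarrow> real) \<Rightarrow> 'p \<Rightarrow> 'p) \<Rightarrow> 'v)" and b: "is_lifting G H P act b"
  shows "\<exists>s :: (_, _, 'v) global_obj. is_global_obj X s"
  using split_obj_gerbe_obj[OF emb splitting_lift_splitting[OF b], of "()"]
  unfolding is_global_obj_def final_bobj_eq by blast

end

theorem theorem4p1:
  fixes G :: "'g topgroup" and H :: "'h topgroup" and P :: "('h, 'm, 'p) fibre_bundle"
    and act :: "'g \<Rightarrow> 'm \<Rightarrow> 'm"
  assumes "topological_group G" and "topological_group H"
    and "topological_manifold (Basis P)" and "locally_contractible_space (Basis P)"
    and "continuous_left_action G (Basis P) act"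
    and "effective_action G (topspace (Basis P)) act"
    and "principal_bundle H P"
    and "sheaf_epi (Aut_sheaf G H P act) (topgroup_sheaf G) (Aut_sheaf_to_G G P act)"
    and "universe_for TYPE('v) TYPE('g) TYPE('p)"
  shows "((\<exists>b. is_lifting G H P act b) \<longleftrightarrow>
           class_vanishes (classifying_class (Aut_extension G H P act) :: (_, _, 'v) gerbe_cocycle set)) \<and>
         (class_vanishes (classifying_class (Aut_extension G H P act) :: (_, _, 'v) gerbe_cocycle set) \<longrightarrow>
           (\<exists>s :: (_, _, 'v) global_obj. is_global_obj (Aut_extension G H P act) s) \<and>
           (\<forall>s :: (_, _, 'v) global_obj. is_global_obj (Aut_extension G H P act) s \<longrightarrow>
              (\<exists>\<phi>. bij_betw \<phi> (lifting_classes G H P act) (H1 (Aut_extension G H P act) s))))"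
proof -
  interpret bundle_action G H P act
    using assms by unfold_locales
  obtain emb :: "((nat \<Rightarrow> real) \<Rightarrow> 'p \<Rightarrow> 'p) \<Rightarrow> 'v" where emb: "inj emb"
    using assms(9) by (auto simp: universe_for_def)
  show ?thesis
    using lifting_iff_class_vanishes[OF emb] global_obj_if_lifting[OF emb]
      lifting_classes_bij_H1[OF _ emb] by blast
qed

end
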